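(* Let $p>1$ and let $\hat{\pi}=\frac{2\pi}{p\sin(\pi/p)}$. For $\rho\in L^{1}(0,\hat{\pi})$ with $\rho>0$ a.e., let $\mu_1<\mu_2<\cdots$ denote the eigenvalues of the Dirichlet problem $$(|y'|^{p-2}y')'=-(p-1)\mu\,\rho(x)|y|^{p-2}y\ \text{ on } (0,\hat{\pi}),\qquad y(0)=y(\hat{\pi})=0 .$$ (a) If $\rho$ is single-barrier with transition point $\frac{\hat{\pi}}{2}$, then $$\frac{\mu_2}{\mu_1}\ge 2^{p},$$ and equality holds if and only if $\rho$ is constant (a.e.). Furthermore, for every $a\in[0,\hat{\pi}]$ with $a\ne\frac{\hat{\pi}}{2}$, there exists a single-barrier density $\rho$ with transition point $a$ such that $\frac{\mu_2}{\mu_1}<2^{p}$. (b) If $\rho$ is a symmetric single-well density with transition point $\frac{\hat{\pi}}{2}$, then $$\frac{\mu_2}{\mu_1}\le 2^{p},$$ and equality holds if and only if $\rho$ is constant a.e.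
   Context: A function $V$ on $[0,\hat{\pi}]$ is called single-well with transition point $a\in[0,\hat{\pi}]$ if $V$ is decreasing (in the weak sense) on $[0,a]$ and increasing (in the weak sense) on $[a,\hat{\pi}]$. $V$ is called single-barrier with transition point $a$ if $-V$ is single-well with transition point $a$. $V$ is symmetric if $V(x)=V(\hat{\pi}-x)$. A density is a function $\rho\in L^1(0,\hat{\pi})$ with $\rho>0$ a.e. An eigenvalue is a real number $\mu$ for which the boundary value problem has a nontrivial solution $y$ (with $y$ and $|y'|^{p-2}y'$ absolutely continuous and the equation holding a.e.). The eigenvalues form a strictly increasing sequence $\mu_1<\mu_2<\cdots$ tending to $\infty$, and an eigenfunction for $\mu_n$ has exactly $n-1$ zeros in $(0,\hat{\pi})$. *)

theory Defs
  imports "HOL-Analysis.Analysis"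
begin

definition pi_hat :: "real \<Rightarrow> real" where
  "pi_hat p = 2 * pi / (p * sin (pi / p))"

definition single_well :: "real \<Rightarrow> real \<Rightarrow> (real \<Rightarrow> real) \<Rightarrow> bool" where
  "single_well p a V \<longleftrightarrow>
     a \<in> {0..pi_hat p} \<and> antimono_on {0..a} V \<and> mono_on {a..pi_hat p} V"

definition single_barrier :: "real \<Rightarrow> real \<Rightarrow> (real \<Rightarrow> real) \<Rightarrow> bool" where
  "single_barrier p a V \<longleftrightarrow> single_well p a (\<lambda>x. - V x)"

definition symmetric :: "real \<Rightarrow> (real \<Rightarrow> real) \<Rightarrow> bool" where
  "symmetric p V \<longleftrightarrow> (\<forall>x\<in>{0..pi_hat p}. V x = V (pi_hat p - x))"

definition is_density :: "real \<Rightarrow> (real \<Rightarrow> real) \<Rightarrow> bool" where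
  "is_density p \<rho> \<longleftrightarrow>
     \<rho> absolutely_integrable_on {0<..<pi_hat p} \<and> (AE x\<in>{0<..<pi_hat p} in lebesgue. \<rho> x > 0)"

definition ae_constant :: "real \<Rightarrow> (real \<Rightarrow> real) \<Rightarrow> bool" where
  "ae_constant p \<rho> \<longleftrightarrow> (\<exists>c. AE x\<in>{0<..<pi_hat p} in lebesgue. \<rho> x = c)"

text \<open>
  Absolute continuity of a function on an interval. (The constant \<^const>\<open>absolutely_continuous\<close>
  is about measures.)
\<close>

definition abs_continuous_on :: "real set \<Rightarrow> (real \<Rightarrow> real) \<Rightarrow> bool" where
  "abs_continuous_on S f \<longleftrightarrow>
     (\<forall>\<epsilon>>0. \<exists>\<delta>>0. \<forall>(n::nat) a b.
        (\<forall>i<n. a i \<le> b i \<and> {a i..b i} \<subseteq> S) \<and>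
        disjoint_family_on (\<lambda>i. {a i<..<b i}) {..<n} \<and>
        (\<Sum>i<n. b i - a i) < \<delta> \<longrightarrow>
        (\<Sum>i<n. \<bar>f (b i) - f (a i)\<bar>) < \<epsilon>)"

text \<open>The map $s \mapsto |s|^{p-2}s$; its value at $0$ is $0$ for every $p > 1$.\<close>

definition signed_pow :: "real \<Rightarrow> real \<Rightarrow> real" where
  "signed_pow p s = \<bar>s\<bar> powr (p - 2) * s"

text \<open>
  Here \<open>dy\<close> is the derivative $y'$, one-sided at the end points; it has to exist at every
  point, since $|y'|^{p-2}y'$ is required to be an absolutely continuous function.
\<close>

definition dirichlet_solution ::
    "real \<Rightarrow> (real \<Rightarrow> real) \<Rightarrow> real \<Rightarrow> (real \<Rightarrow> real) \<Rightarrow> bool" where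
  "dirichlet_solution p \<rho> \<mu> y \<longleftrightarrow>
     abs_continuous_on {0..pi_hat p} y \<and>
     (\<exists>dy. (\<forall>x\<in>{0..pi_hat p}. (y has_real_derivative dy x) (at x within {0..pi_hat p})) \<and>
           abs_continuous_on {0..pi_hat p} (\<lambda>x. signed_pow p (dy x)) \<and>
           (AE x\<in>{0<..<pi_hat p} in lebesgue.
              ((\<lambda>t. signed_pow p (dy t)) has_real_derivative
                 - (p - 1) * \<mu> * \<rho> x * signed_pow p (y x)) (at x))) \<and>
     y 0 = 0 \<and> y (pi_hat p) = 0"

definition is_eigenvalue :: "real \<Rightarrow> (real \<Rightarrow> real) \<Rightarrow> real \<Rightarrow> bool" where
  "is_eigenvalue p \<rho> \<mu> \<longleftrightarrow>
     (\<exists>y. dirichlet_solution p \<rho> \<mu> y \<and> (\<exists>x\<in>{0..pi_hat p}. y x \<noteq> 0))"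

text \<open>
  The \<open>n\<close>-th eigenvalue $\mu_n$ in increasing order, counted from \<open>n = 1\<close>: the eigenvalue
  that has exactly \<open>n - 1\<close> eigenvalues below it.
\<close>

definition eigenvalue :: "real \<Rightarrow> (real \<Rightarrow> real) \<Rightarrow> nat \<Rightarrow> real" where
  "eigenvalue p \<rho> n =
     (THE \<mu>. is_eigenvalue p \<rho> \<mu> \<and>
        finite {\<nu>. is_eigenvalue p \<rho> \<nu> \<and> \<nu> < \<mu>} \<and>
        Suc (card {\<nu>. is_eigenvalue p \<rho> \<nu> \<and> \<nu> < \<mu>}) = n)"

text \<open>Any strictly increasing enumeration of the eigenvalues agrees with \<^const>\<open>eigenvalue\<close>.\<close>

lemma eigenvalue_enumeration:
  assumes mono: "strict_mono m" and range: "range m = {\<mu>. is_eigenvalue p \<rho> \<mu>}"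
  shows "eigenvalue p \<rho> (Suc n) = m n"
proof -
  have below: "{\<nu>. is_eigenvalue p \<rho> \<nu> \<and> \<nu> < m k} = m ` {..<k}" for k
  proof -
    have "{\<nu>. is_eigenvalue p \<rho> \<nu> \<and> \<nu> < m k} = {\<nu> \<in> range m. \<nu> < m k}"
      using range by auto
    also have "\<dots> = m ` {..<k}"
      using strict_mono_less[OF mono] by auto
    finally show ?thesis .
  qed
  have card: "card (m ` {..<k}) = k" for k
    using card_image[OF inj_on_subset[OF strict_mono_on_imp_inj_on[OF mono] subset_UNIV]] by simp
  show ?thesis
    unfolding eigenvalue_def
  proof (rule the_equality)
    show "is_eigenvalue p \<rho> (m n) \<and> finite {\<nu>. is_eigenvalue p \<rho> \<nu> \<and> \<nu> < m n} \<and>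
        Suc (card {\<nu>. is_eigenvalue p \<rho> \<nu> \<and> \<nu> < m n}) = Suc n"
      using range by (auto simp: below card)
  next
    fix \<mu>
    assume \<mu>: "is_eigenvalue p \<rho> \<mu> \<and> finite {\<nu>. is_eigenvalue p \<rho> \<nu> \<and> \<nu> < \<mu>} \<and>
        Suc (card {\<nu>. is_eigenvalue p \<rho> \<nu> \<and> \<nu> < \<mu>}) = Suc n"
    then obtain k where "\<mu> = m k"
      using range by auto
    with \<mu> show "\<mu> = m n"
      by (simp add: below card)
  qed
qed

end

theory Submission
  imports Defs
begin

text \<open>
  Where a solution \<open>y\<close> does not vanish, \<open>W = \<bar>y'\<bar> powr (p - 2) * y' / (\<bar>y\<bar> powr (p - 2) * y)\<close> solves the
  Riccati equation \<open>W' = - (p - 1) (\<mu> \<rho> + \<bar>W\<bar> powr q)\<close> with \<open>q = p / (p - 1)\<close>, and at a zero \<open>c\<close> of \<open>y\<close> the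
  difference between \<open>W\<close> and \<open>(x - c) powr (1 - p)\<close> tends to \<open>0\<close>; so Sturm comparison becomes a linear
  differential inequality for the difference of two such functions.

  Let \<open>(a, b)\<close> be a nodal interval of the second eigenfunction and \<open>L\<close> the constant density that has \<open>(a, b)\<close>
  as a nodal interval at the same eigenvalue \<open>\<mu>\<^sub>2\<close>. Let \<open>B\<^sub>2\<close> be its Riccati function and \<open>B\<^sub>1\<close> the one on the
  doubled interval, so that \<open>B\<^sub>1 b = 0\<close>; let \<open>A\<^sub>1\<close>, \<open>A\<^sub>2\<close> belong to the first two eigenfunctions of \<open>\<rho>\<close>. If \<open>\<rho>\<close>
  crosses \<open>L\<close> upwards once, then \<open>A\<^sub>2 \<ge> B\<^sub>2\<close>, and convexity of \<open>\<bar>w\<bar> powr q\<close> yields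
  \<open>A\<^sub>1 - B\<^sub>1 \<le> (\<mu>\<^sub>1 / \<mu>\<^sub>2) (A\<^sub>2 - B\<^sub>2)\<close> as soon as \<open>\<mu>\<^sub>2 \<le> 2 powr p * \<mu>\<^sub>1\<close>. The right-hand side tends to \<open>0\<close> at
  \<open>b\<close>, so \<open>A\<^sub>1 b \<le> 0\<close>, with equality only for \<open>\<rho> = L\<close> almost everywhere. For a barrier this applies to both
  nodal intervals (on the right one after a reflection) and forces equality; downward crossings reverse
  all inequalities, which gives the well and the counterexamples.

  Monotone densities are continuous outside countable sets, so all differential equations hold outside
  countable sets and no Lebesgue points are needed. Existence of the eigenvalues comes from a Pruefer
  angle along the boundary of a square, for which the right-hand side is Lipschitz also when \<open>p \<noteq> 2\<close>.
\<close>

section \<open>Derivatives outside countable sets\<close>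

definition cocountable :: "'a set \<Rightarrow> 'a filter" where
  "cocountable A = Abs_filter (\<lambda>P. countable {x \<in> A. \<not> P x})"

lemma eventually_cocountable: "eventually P (cocountable A) \<longleftrightarrow> countable {x \<in> A. \<not> P x}"
proof -
  have "is_filter (\<lambda>P. countable {x \<in> A. \<not> P x})"
  proof
    fix P Q :: "'a \<Rightarrow> bool"
    show "countable {x \<in> A. \<not> (P x \<and> Q x)}" if "countable {x \<in> A. \<not> P x}" "countable {x \<in> A. \<not> Q x}"
      using countable_Un[OF that] by (rule countable_subset[rotated]) auto
    show "countable {x \<in> A. \<not> Q x}" if "\<forall>x. P x \<longrightarrow> Q x" "countable {x \<in> A. \<not> P x}"
      using that(2) by (rule countable_subset[rotated]) (use that(1) in auto)
  qed simp
  then show ?thesis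
    unfolding cocountable_def by (simp add: eventually_Abs_filter)
qed

lemma eventually_cocountableI: "(\<And>x. x \<in> A \<Longrightarrow> P x) \<Longrightarrow> eventually P (cocountable A)"
  by (auto simp: eventually_cocountable intro: countable_subset[of _ "{}"])

lemma eventually_in_cocountable: "\<forall>\<^sub>F x in cocountable A. x \<in> A"
  by (rule eventually_cocountableI)

lemma eventually_cocountable_subset:
  assumes "eventually P (cocountable B)" "A \<subseteq> B" "\<And>x. x \<in> A \<Longrightarrow> P x \<Longrightarrow> Q x"
  shows "eventually Q (cocountable A)"
  using assms(1) unfolding eventually_cocountable
  by (rule countable_subset[rotated]) (use assms(2,3) in auto)

lemma eventually_cocountable_image:
  assumes "inj_on f A"
  shows "eventually P (cocountable (f ` A)) \<longleftrightarrow> (\<forall>\<^sub>F x in cocountable A. P (f x))"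
proof -
  have "{y \<in> f ` A. \<not> P y} = f ` {x \<in> A. \<not> P (f x)}"
    by auto
  moreover have "inj_on f {x \<in> A. \<not> P (f x)}"
    using assms by (rule inj_on_subset) auto
  ultimately show ?thesis
    by (simp add: eventually_cocountable countable_image_inj_eq)
qed

lemma eventually_cocountable_reflect:
  fixes r :: real
  assumes "eventually P (cocountable {c<..<d})"
  shows "\<forall>\<^sub>F x in cocountable {r - d<..<r - c}. P (r - x)"
proof -
  have "x \<in> (\<lambda>x. r - x) ` {r - d<..<r - c}" if "x \<in> {c<..<d}" for x
    using that by (intro image_eqI[of _ _ "r - x"]) auto
  then have "(\<lambda>x. r - x) ` {r - d<..<r - c} = {c<..<d}"
    by auto
  then show ?thesis
    using assms eventually_cocountable_image[of "\<lambda>x. r - x" "{r - d<..<r - c}" P]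
    by (simp add: inj_on_def)
qed

lemma eventually_cocountable_split:
  fixes a b c :: real
  assumes "eventually P (cocountable {a<..<c})" "eventually P (cocountable {c<..<b})"
  shows "eventually P (cocountable {a<..<b})"
proof -
  have "countable (insert c ({x \<in> {a<..<c}. \<not> P x} \<union> {x \<in> {c<..<b}. \<not> P x}))"
    using assms by (simp add: eventually_cocountable)
  then show ?thesis
    unfolding eventually_cocountable
    by (rule countable_subset[rotated]) (auto simp: not_less_iff_gr_or_eq)
qed

lemma eventually_cocountable_obtains:
  fixes a b :: real
  assumes "eventually P (cocountable {a<..<b})" "a < b"
  obtains x where "x \<in> {a<..<b}" "P x"
proof -
  have "\<not> {a<..<b} \<subseteq> {x \<in> {a<..<b}. \<not> P x}"
    using assms uncountable_open_interval[of a b] countable_subset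
    unfolding eventually_cocountable by blast
  then show thesis
    using that by blast
qed

lemma le_of_eventually_cocountable_le:
  fixes f g :: "real \<Rightarrow> real"
  assumes eventually_le: "\<forall>\<^sub>F x in cocountable {a<..<b}. f x \<le> g x"
    and cont: "continuous_on {a<..<b} f" "continuous_on {a<..<b} g" and x: "x \<in> {a<..<b}"
  shows "f x \<le> g x"
proof (rule ccontr)
  assume "\<not> f x \<le> g x"
  have "open {x \<in> {a<..<b}. f x - g x \<in> {0<..}}"
    using continuous_open_preimage[OF continuous_on_diff[OF cont], of "{0<..}"]
    by (simp add: Int_def vimage_def)
  moreover have "x \<in> {x \<in> {a<..<b}. f x - g x \<in> {0<..}}"
    using \<open>\<not> f x \<le> g x\<close> x by simp
  ultimately obtain e where "e > 0" "ball x e \<subseteq> {x \<in> {a<..<b}. f x - g x \<in> {0<..}}"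
    by (rule openE)
  then have "ball x e \<subseteq> {x \<in> {a<..<b}. \<not> f x \<le> g x}"
    by auto
  then show False
    using eventually_le \<open>e > 0\<close> uncountable_ball[of e x] countable_subset unfolding eventually_cocountable by blast
qed

lemma continuous_last_crossing:
  fixes g :: "real \<Rightarrow> real"
  assumes "a \<le> b" and cont: "continuous_on {a..b} g" and w: "g b < w" "w < g a"
  obtains t where "t \<in> {a<..<b}" "g t = w" "\<And>x. x \<in> {t<..b} \<Longrightarrow> g x < w"
proof -
  define T where "T = {x \<in> {a..b}. w \<le> g x}"
  define t where "t = Sup T"
  have "closed T"
    unfolding T_def using continuous_closed_preimage[OF cont, of "{w..}"]
    by (simp add: vimage_def Int_def conj_commute)
  moreover have "a \<in> T" and bdd: "bdd_above T"
    using w(2) \<open>a \<le> b\<close> by (auto simp: T_def bdd_above_def)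
  ultimately have "t \<in> T"
    unfolding t_def using closed_contains_Sup by blast
  then have t: "a \<le> t" "t < b" "w \<le> g t"
    using w(1) by (auto simp: T_def order_less_le)
  have above: "g x < w" if "x \<in> {t<..b}" for x
  proof -
    have "x \<notin> T"
      using that cSup_upper[OF _ bdd, of x] by (auto simp: t_def)
    then show ?thesis
      using that t(1) by (auto simp: T_def)
  qed
  have "g t \<le> w"
  proof (rule tendsto_upperbound)
    show "(g \<longlongrightarrow> g t) (at_right t)"
      using t by (intro continuous_on_Icc_at_rightD[of _ b] continuous_on_subset[OF cont]) auto
    show "\<forall>\<^sub>F x in at_right t. g x \<le> w"
      using above t(2) by (intro eventually_at_rightI[of _ b]) (auto intro: less_imp_le)
  qed simp
  with t(3) have "g t = w" by simp
  moreover from this have "t \<in> {a<..<b}"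
    using t(1,2) w(2) by (auto simp: order_less_le)
  ultimately show thesis
    using that above by blast
qed

lemma deriv_nonpos_of_strict_last_max:
  fixes g :: "real \<Rightarrow> real"
  assumes deriv: "(g has_real_derivative d) (at t)" and "t < b" and below: "\<And>x. x \<in> {t<..b} \<Longrightarrow> g x < g t"
  shows "d \<le> 0"
proof (rule ccontr)
  assume "\<not> d \<le> 0"
  then obtain \<delta> where "\<delta> > 0" and inc: "\<And>h. h > 0 \<Longrightarrow> h < \<delta> \<Longrightarrow> g t < g (t + h)"
    using DERIV_pos_inc_right[OF deriv] by auto
  define h where "h = min (\<delta> / 2) (b - t)"
  have "h > 0" "h < \<delta>" "t + h \<in> {t<..b}"
    using \<open>\<delta> > 0\<close> \<open>t < b\<close> by (auto simp: h_def min_def)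
  then show False
    using inc[of h] below[of "t + h"] by auto
qed

lemma min_le_of_nonneg_deriv_below:
  fixes f :: "real \<Rightarrow> real"
  assumes "a \<le> b" and cont: "continuous_on {a..b} f"
    and deriv: "\<forall>\<^sub>F x in cocountable {a<..<b}. f x < v \<longrightarrow> (\<exists>d\<ge>0. (f has_real_derivative d) (at x))"
  shows "min v (f a) \<le> f b"
proof (rule ccontr)
  assume "\<not> min v (f a) \<le> f b"
  then have "a < b"
    using \<open>a \<le> b\<close> by (auto simp: order_less_le)
  define u where "u = min v (f a)"
  have less: "f b < u"
    unfolding u_def using \<open>\<not> min v (f a) \<le> f b\<close> by (rule not_le_imp_less)
  define e where "e = (u - f b) / (2 * (b - a))"
  define g where "g x = f x + e * (x - a)" for x
  define S where "S = {x \<in> {a<..<b}. \<not> (f x < v \<longrightarrow> (\<exists>d\<ge>0. (f has_real_derivative d) (at x)))}"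
  have "e > 0"
    using less \<open>a < b\<close> by (simp add: e_def)
  have "e * (b - a) = (u - f b) / 2"
    unfolding e_def using \<open>a < b\<close> by (simp add: divide_simps)
  then have "g b = f b + (u - f b) / 2"
    by (simp only: g_def)
  then have "g b < u"
    using less by (simp add: field_simps)
  moreover have "countable (g ` S)"
    using deriv by (simp add: S_def eventually_cocountable)
  \<comment> \<open>The tilted function attains some level that it does not attain at an exceptional point.\<close>
  ultimately obtain w where w: "g b < w" "w < u" "w \<notin> g ` S"
    by (meson countable_subset greaterThanLessThan_iff subsetI uncountable_open_interval)
  have "continuous_on {a..b} g"
    unfolding g_def by (intro continuous_intros cont)
  then obtain t where t: "t \<in> {a<..<b}" "g t = w" and below: "\<And>x. x \<in> {t<..b} \<Longrightarrow> g x < w"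
    by (rule continuous_last_crossing[OF \<open>a \<le> b\<close>, of g w]) (use w in \<open>auto simp: g_def u_def\<close>)
  have "e * (t - a) > 0"
    using t(1) \<open>e > 0\<close> by simp
  then have "f t < v"
    using t(2) w(2) by (simp add: g_def u_def)
  then obtain d where "d \<ge> 0" "(f has_real_derivative d) (at t)"
    using t w(3) by (auto simp: S_def)
  then have "(g has_real_derivative (d + e)) (at t)"
    unfolding g_def by (auto intro!: derivative_eq_intros)
  from deriv_nonpos_of_strict_last_max[OF this, of b] show False
    using below t \<open>e > 0\<close> \<open>d \<ge> 0\<close> by auto
qed

lemma le_of_nonneg_deriv:
  fixes f :: "real \<Rightarrow> real"
  assumes "a \<le> b" "continuous_on {a..b} f"
    and "\<forall>\<^sub>F x in cocountable {a<..<b}. \<exists>d\<ge>0. (f has_real_derivative d) (at x)"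
  shows "f a \<le> f b"
  using min_le_of_nonneg_deriv_below[OF assms(1,2), of "f a"] eventually_mono[OF assms(3)] by simp

lemma less_of_pos_deriv:
  fixes f :: "real \<Rightarrow> real"
  assumes "a < b" and cont: "continuous_on {a..b} f"
    and deriv: "\<forall>\<^sub>F x in cocountable {a<..<b}. \<exists>d>0. (f has_real_derivative d) (at x)"
  shows "f a < f b"
proof (rule ccontr)
  assume "\<not> f a < f b"
  have mono: "f u \<le> f v" if "a \<le> u" "u \<le> v" "v \<le> b" for u v
    by (rule le_of_nonneg_deriv[OF that(2) continuous_on_subset[OF cont]
          eventually_cocountable_subset[OF deriv]])
      (use that in \<open>auto intro: less_imp_le\<close>)
  have const: "f u = f a" if "u \<in> {a<..<b}" for u
    using mono[of a u] mono[of u b] that \<open>\<not> f a < f b\<close> by auto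
  obtain u d where u: "u \<in> {a<..<b}" and "d > 0" "(f has_real_derivative d) (at u)"
    using deriv \<open>a < b\<close> by (auto elim: eventually_cocountable_obtains)
  moreover have "(f has_real_derivative 0) (at u)"
    by (rule has_field_derivative_transform_within_open[OF DERIV_const open_greaterThanLessThan u])
      (use const in auto)
  ultimately show False
    using DERIV_unique by blast
qed

lemma pos_of_exp_weight_bound:
  fixes y s A k :: real
  assumes "k / A < exp (- A * s) * (y + k / A)" "0 < A" "0 \<le> k" "0 \<le> s"
  shows "0 < y"
proof (rule ccontr)
  assume "\<not> 0 < y"
  then have "exp (- A * s) * (y + k / A) \<le> exp (- A * s) * (k / A)"
    by (intro mult_left_mono) auto
  also have "\<dots> \<le> k / A"
    using assms(2-4) by (intro mult_left_le_one_le) auto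
  finally show False
    using assms(1) by simp
qed

lemma gronwall:
  fixes f :: "real \<Rightarrow> real"
  assumes "a \<le> b" "A > 0" "k \<ge> 0" and cont: "continuous_on {a..b} f"
    and deriv: "\<forall>\<^sub>F x in cocountable {a<..<b}.
      0 < f x \<longrightarrow> (\<exists>d\<le>A * f x + k. (f has_real_derivative d) (at x))"
  shows "f b + k / A \<le> exp (A * (b - a)) * (max 0 (f a) + k / A)"
proof -
  define g where "g x = - (exp (- A * (x - a)) * (f x + k / A))" for x
  have "min (- (max 0 (f a) + k / A)) (g a) \<le> g b"
  proof (rule min_le_of_nonneg_deriv_below[OF \<open>a \<le> b\<close>])
    show "continuous_on {a..b} g"
      unfolding g_def by (intro continuous_intros cont)
    show "\<forall>\<^sub>F x in cocountable {a<..<b}.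
        g x < - (max 0 (f a) + k / A) \<longrightarrow> (\<exists>d\<ge>0. (g has_real_derivative d) (at x))"
      using deriv eventually_in_cocountable
    proof eventually_elim
      case (elim x)
      show ?case
      proof
        assume "g x < - (max 0 (f a) + k / A)"
        then have large: "k / A < exp (- A * (x - a)) * (f x + k / A)"
          by (simp add: g_def)
        have "0 < f x"
          by (rule pos_of_exp_weight_bound[OF large assms(2,3)]) (use elim(2) in simp)
        then obtain d where d: "d \<le> A * f x + k" "(f has_real_derivative d) (at x)"
          using elim(1) by blast
        have "(g has_real_derivative (exp (- A * (x - a)) * (A * f x + k - d))) (at x)"
          unfolding g_def using d(2) \<open>A > 0\<close>
          by (auto intro!: derivative_eq_intros simp: field_simps)
        then show "\<exists>d\<ge>0. (g has_real_derivative d) (at x)"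
          using d(1) by (intro exI[of _ "exp (- A * (x - a)) * (A * f x + k - d)"]) auto
      qed
    qed
  qed
  then have "exp (- A * (b - a)) * (f b + k / A) \<le> max 0 (f a) + k / A"
    by (simp add: g_def)
  then have "exp (A * (b - a)) * (exp (- A * (b - a)) * (f b + k / A)) \<le>
      exp (A * (b - a)) * (max 0 (f a) + k / A)"
    by (intro mult_left_mono) auto
  moreover have "exp (A * (b - a)) * (exp (- A * (b - a)) * (f b + k / A)) = f b + k / A"
    by (simp add: mult.assoc[symmetric] exp_add[symmetric])
  ultimately show ?thesis
    by (simp only:)
qed

lemma lipschitz_on_of_bounded_deriv:
  fixes f :: "real \<Rightarrow> real"
  assumes "M \<ge> 0" and cont: "continuous_on {a..b} f"
    and deriv: "\<forall>\<^sub>F x in cocountable {a<..<b}. \<exists>d. \<bar>d\<bar> \<le> M \<and> (f has_real_derivative d) (at x)"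
  shows "M-lipschitz_on {a..b} f"
proof (rule lipschitz_on_leI)
  fix x y assume xy: "x \<in> {a..b}" "y \<in> {a..b}" "x \<le> y"
  have "s * f x + M * x \<le> s * f y + M * y" if "s = 1 \<or> s = -1" for s
  proof (rule le_of_nonneg_deriv[OF \<open>x \<le> y\<close>, of "\<lambda>t. s * f t + M * t"])
    show "continuous_on {x..y} (\<lambda>t. s * f t + M * t)"
      using xy by (intro continuous_intros continuous_on_subset[OF cont]) auto
    show "\<forall>\<^sub>F t in cocountable {x<..<y}. \<exists>d\<ge>0. ((\<lambda>t. s * f t + M * t) has_real_derivative d) (at t)"
    proof (rule eventually_cocountable_subset[OF deriv])
      fix t assume "\<exists>d. \<bar>d\<bar> \<le> M \<and> (f has_real_derivative d) (at t)"
      then obtain d where "\<bar>d\<bar> \<le> M" "(f has_real_derivative d) (at t)"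
        by blast
      then show "\<exists>d\<ge>0. ((\<lambda>t. s * f t + M * t) has_real_derivative d) (at t)"
        using that by (intro exI[of _ "s * d + M"]) (auto intro!: derivative_eq_intros)
    qed (use xy in auto)
  qed
  from this[of 1] this[of "-1"] show "dist (f x) (f y) \<le> M * dist x y"
    using \<open>x \<le> y\<close> by (auto simp: dist_real_def algebra_simps abs_le_iff)
qed (fact \<open>M \<ge> 0\<close>)

lemma has_real_derivative_of_continuous_deriv:
  fixes f g :: "real \<Rightarrow> real"
  assumes cont: "continuous_on {a..b} f" "continuous_on {a..b} g"
    and deriv: "\<forall>\<^sub>F x in cocountable {a<..<b}. (f has_real_derivative g x) (at x)"
    and x: "x \<in> {a..b}"
  shows "(f has_real_derivative g x) (at x within {a..b})"
proof -
  define G where "G x = integral {a..x} g" for x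
  have G: "(G has_real_derivative g x) (at x within {a..b})" if "x \<in> {a..b}" for x
    unfolding G_def by (rule integral_has_real_derivative[OF cont(2) that])
  have "0-lipschitz_on {a..b} (\<lambda>x. f x - G x)"
  proof (rule lipschitz_on_of_bounded_deriv)
    have "continuous_on {a..b} G"
      using G by (meson DERIV_continuous continuous_on_eq_continuous_within)
    then show "continuous_on {a..b} (\<lambda>x. f x - G x)"
      by (intro continuous_on_diff cont)
    show "\<forall>\<^sub>F x in cocountable {a<..<b}.
        \<exists>d. \<bar>d\<bar> \<le> 0 \<and> ((\<lambda>x. f x - G x) has_real_derivative d) (at x)"
      using deriv eventually_in_cocountable
    proof eventually_elim
      case (elim x)
      then have "(G has_real_derivative g x) (at x)"
        using G[of x] at_within_Icc_at[of a x b] by auto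
      with elim(1) show ?case
        by (auto intro!: derivative_eq_intros)
    qed
  qed simp
  then have eq: "f t = f a - G a + G t" if "t \<in> {a..b}" for t
    using lipschitz_onD[of 0 "{a..b}" "\<lambda>x. f x - G x" t a] that by (auto simp: dist_real_def)
  have "((\<lambda>x. f a - G a + G x) has_real_derivative g x) (at x within {a..b})"
    using G[OF x] by (auto intro!: derivative_eq_intros)
  then show ?thesis
    unfolding has_field_derivative_def by (rule has_derivative_transform[OF x, rotated]) (rule eq)
qed

lemma linear_decay_nonpos:
  fixes D g :: "real \<Rightarrow> real"
  assumes cont: "continuous_on {c<..<d} D"
    and deriv: "\<forall>\<^sub>F x in cocountable {c<..<d}.
      0 < D x \<longrightarrow> (\<exists>D'\<le>- g x * D x. (D has_real_derivative D') (at x))"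
    and x: "x \<in> {c<..<d}"
    and rate: "\<And>y. y \<in> {c<..x} \<Longrightarrow> 0 < D y \<Longrightarrow> m \<le> g y"
    and lim: "\<And>e. e > 0 \<Longrightarrow> \<forall>\<^sub>F y in at_right c. D y < e"
  shows "D x \<le> 0"
proof (rule ccontr)
  define A where "A = \<bar>m\<bar> + 1"
  assume "\<not> D x \<le> 0"
  then have "\<forall>\<^sub>F y in at_right c. D y < D x / exp (A * (x - c))"
    by (intro lim) simp
  moreover have "\<forall>\<^sub>F y in at_right c. y \<in> {c<..<x}"
    using x by (auto intro: eventually_at_rightI)
  ultimately have "\<forall>\<^sub>F y in at_right c. y \<in> {c<..<x} \<and> D y < D x / exp (A * (x - c))"
    by eventually_elim simp
  then obtain t where t: "t \<in> {c<..<x}" "D t < D x / exp (A * (x - c))"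
    using eventually_happens' trivial_limit_at_right_real by blast
  have "D x + 0 / A \<le> exp (A * (x - t)) * (max 0 (D t) + 0 / A)"
  proof (rule gronwall)
    show "continuous_on {t..x} D"
      by (rule continuous_on_subset[OF cont]) (use t x in auto)
    show "\<forall>\<^sub>F y in cocountable {t<..<x}. 0 < D y \<longrightarrow> (\<exists>d\<le>A * D y + 0. (D has_real_derivative d) (at y))"
    proof (rule eventually_cocountable_subset[OF deriv], safe)
      fix y D' assume y: "y \<in> {t<..<x}" "0 < D y"
        and D': "D' \<le> - g y * D y" "(D has_real_derivative D') (at y)"
      have "- g y * D y \<le> A * D y"
        using rate[of y] y t by (intro mult_right_mono) (auto simp: A_def)
      with D' show "\<exists>d\<le>A * D y + 0. (D has_real_derivative d) (at y)"
        by (intro exI[of _ D']) auto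
    qed (use t x in auto)
  qed (use t in \<open>auto simp: A_def\<close>)
  also have "\<dots> \<le> exp (A * (x - c)) * max 0 (D t)"
    using t by (auto simp: A_def intro!: mult_right_mono mult_left_mono)
  also have "\<dots> < D x"
    using t(2) \<open>\<not> D x \<le> 0\<close> by (simp add: max_def field_simps)
  finally show False by simp
qed

lemma linear_decay_weighted_le:
  fixes D g :: "real \<Rightarrow> real"
  assumes "x \<le> t" and cont: "continuous_on {x..t} D"
    and deriv: "\<forall>\<^sub>F y in cocountable {x<..<t}. \<exists>D'\<le>- g y * D y. (D has_real_derivative D') (at y)"
    and nonpos: "\<And>y. y \<in> {x<..<t} \<Longrightarrow> D y \<le> 0" and rate: "\<And>y. y \<in> {x<..<t} \<Longrightarrow> g y \<le> m"
  shows "exp (m * (t - x)) * D t \<le> D x"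
proof -
  let ?G = "\<lambda>y. - (exp (m * (y - x)) * D y)"
  have "?G x \<le> ?G t"
  proof (rule le_of_nonneg_deriv[where f = ?G])
    show "continuous_on {x..t} ?G"
      by (intro continuous_intros cont)
    show "\<forall>\<^sub>F y in cocountable {x<..<t}. \<exists>d\<ge>0. (?G has_real_derivative d) (at y)"
      using deriv eventually_in_cocountable
    proof eventually_elim
      case (elim y)
      then obtain D' where D': "D' \<le> - g y * D y" "(D has_real_derivative D') (at y)"
        by blast
      note D'(1)
      also have "- g y * D y \<le> - m * D y"
        using rate[OF elim(2)] by (intro mult_right_mono_neg nonpos[OF elim(2)]) simp
      finally have "0 \<le> exp (m * (y - x)) * - (D' + m * D y)"
        by simp
      moreover have "(?G has_real_derivative exp (m * (y - x)) * - (D' + m * D y)) (at y)"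
        using D'(2) by (auto intro!: derivative_eq_intros simp: algebra_simps)
      ultimately show ?case
        by blast
    qed
  qed fact
  then show ?thesis
    by simp
qed

lemma linear_decay_eq_0:
  fixes D g :: "real \<Rightarrow> real"
  assumes cont: "continuous_on {c<..<d} D"
    and deriv: "\<forall>\<^sub>F x in cocountable {c<..<d}. \<exists>D'\<le>- g x * D x. (D has_real_derivative D') (at x)"
    and nonpos: "\<And>x. x \<in> {c<..<d} \<Longrightarrow> D x \<le> 0"
    and x: "x \<in> {c<..<d}"
    and rate: "\<And>y. y \<in> {x..<d} \<Longrightarrow> g y \<le> m"
    and lim: "(D \<longlongrightarrow> 0) (at_left d)"
  shows "D x = 0"
proof -
  have "exp (m * (t - x)) * D t \<le> D x" if t: "t \<in> {x<..<d}" for t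
    by (rule linear_decay_weighted_le[OF _ continuous_on_subset[OF cont] eventually_cocountable_subset[OF deriv]])
      (use t x in \<open>auto intro: nonpos rate\<close>)
  then have "\<forall>\<^sub>F t in at_left d. exp (m * (t - x)) * D t \<le> D x"
    using x by (intro eventually_at_leftI[of x]) auto
  moreover have "((\<lambda>t. exp (m * (t - x)) * D t) \<longlongrightarrow> exp (m * (d - x)) * 0) (at_left d)"
    by (intro tendsto_intros lim)
  ultimately have "exp (m * (d - x)) * 0 \<le> D x"
    by (intro tendsto_upperbound) auto
  then show ?thesis
    using nonpos[OF x] by simp
qed

section \<open>Signed powers\<close>

abbreviation conjugate :: "real \<Rightarrow> real" where
  "conjugate p \<equiv> p / (p - 1)"

lemma conjugate_exponent:
  fixes p :: real
  assumes "p > 1"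
  shows "conjugate p > 1" "(p - 1) * conjugate p = p" "(p - 1) * (conjugate p - 1) = 1"
    "(conjugate p - 1) * (p - 1) = 1"
  using assms by (simp_all add: field_simps)

lemma signed_pow_eq_sgn: "signed_pow r x = sgn x * \<bar>x\<bar> powr (r - 1)"
proof (cases "x = 0")
  case False
  then have "\<bar>x\<bar> powr (r - 1) = \<bar>x\<bar> powr (r - 2) * \<bar>x\<bar>"
    using powr_add[of "\<bar>x\<bar>" "r - 2" 1] by simp
  then show ?thesis
    by (simp add: signed_pow_def sgn_mult_abs mult.commute mult.left_commute abs_mult_sgn[of x])
qed (simp add: signed_pow_def)

lemma signed_pow_zero [simp]: "signed_pow r 0 = 0"
  by (simp add: signed_pow_def)

lemma signed_pow_minus [simp]: "signed_pow r (- x) = - signed_pow r x"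
  by (simp add: signed_pow_def)

lemma signed_pow_eq_0_iff [simp]: "signed_pow r x = 0 \<longleftrightarrow> x = 0"
  by (auto simp: signed_pow_def)

lemma signed_pow_of_nonneg: "x \<ge> 0 \<Longrightarrow> signed_pow r x = x powr (r - 1)"
  by (cases "x = 0") (auto simp: signed_pow_eq_sgn)

lemma abs_signed_pow: "\<bar>signed_pow r x\<bar> = \<bar>x\<bar> powr (r - 1)"
  by (cases "x = 0") (auto simp: signed_pow_eq_sgn abs_mult abs_sgn_eq)

lemma sgn_signed_pow [simp]: "sgn (signed_pow r x) = sgn x"
  by (cases "x = 0") (auto simp: signed_pow_eq_sgn sgn_mult)

lemma signed_pow_pos_iff [simp]: "signed_pow r x > 0 \<longleftrightarrow> x > 0"
  by (metis sgn_signed_pow sgn_greater)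

lemma signed_pow_neg_iff [simp]: "signed_pow r x < 0 \<longleftrightarrow> x < 0"
  by (metis sgn_signed_pow sgn_less)

lemma signed_pow_mult: "signed_pow r (x * y) = signed_pow r x * signed_pow r y"
  by (simp add: signed_pow_def abs_mult powr_mult)

lemma mult_signed_pow: "x * signed_pow r x = \<bar>x\<bar> powr r"
proof (cases "x = 0")
  case False
  have "\<bar>x\<bar> powr r = \<bar>x\<bar> powr (r - 1) * \<bar>x\<bar>"
    using powr_add[of "\<bar>x\<bar>" "r - 1" 1] False by simp
  then show ?thesis
    by (simp add: signed_pow_eq_sgn abs_sgn)
qed simp

lemma signed_pow_sq: "signed_pow r x * signed_pow r x = \<bar>x\<bar> powr (r - 2) * \<bar>x\<bar> powr r"
  using mult_signed_pow[of x r] by (simp add: signed_pow_def mult_ac)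

lemma signed_pow_signed_pow:
  assumes "(r - 1) * (r' - 1) = 1"
  shows "signed_pow r' (signed_pow r x) = x"
proof (cases "x = 0")
  case False
  have "\<bar>signed_pow r x\<bar> powr (r' - 1) = \<bar>x\<bar>"
    using False assms by (simp add: abs_signed_pow powr_powr)
  then show ?thesis
    by (subst signed_pow_eq_sgn) (simp add: sgn_mult_abs)
qed simp

lemma abs_signed_pow_powr:
  assumes "(r - 1) * r' = r"
  shows "\<bar>signed_pow r x\<bar> powr r' = \<bar>x\<bar> powr r"
  using assms by (simp add: abs_signed_pow powr_powr)

lemma signed_pow_strict_mono:
  assumes "r > 1" "x < y"
  shows "signed_pow r x < signed_pow r y"
proof -
  have nonneg: "signed_pow r x < signed_pow r y" if "0 \<le> x" "x < y" for x y
    using that assms(1) by (simp add: signed_pow_of_nonneg powr_less_mono2)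
  consider "0 \<le> x" | "x < 0" "0 \<le> y" | "y < 0"
    by linarith
  then show ?thesis
  proof cases
    case 2
    then have "signed_pow r x < 0" "signed_pow r y \<ge> 0"
      by (simp_all only: signed_pow_neg_iff signed_pow_of_nonneg powr_ge_zero)
    then show ?thesis by (rule less_le_trans)
  next
    case 3
    then show ?thesis
      using nonneg[of "- y" "- x"] assms by simp
  qed (use nonneg assms in auto)
qed

lemma signed_pow_mono:
  assumes "r > 1" "x \<le> y"
  shows "signed_pow r x \<le> signed_pow r y"
  using signed_pow_strict_mono[OF assms(1), of x y] assms(2) by (cases "x = y") auto

lemma abs_signed_pow_le_one:
  assumes "r > 1" "\<bar>x\<bar> \<le> 1"
  shows "\<bar>signed_pow r x\<bar> \<le> 1"
  unfolding abs_signed_pow using powr_mono2[of "r - 1" "\<bar>x\<bar>" 1] assms by simp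

lemma abs_signed_pow_mult_le:
  assumes "p > 1"
  shows "\<bar>signed_pow p u * signed_pow (conjugate p) v\<bar> \<le> \<bar>u\<bar> powr p + \<bar>v\<bar> powr conjugate p"
proof -
  note q = conjugate_exponent[OF assms]
  have eq: "\<bar>signed_pow p u * signed_pow (conjugate p) v\<bar> =
      \<bar>u\<bar> powr (p - 1) * \<bar>v\<bar> powr (conjugate p - 1)"
    by (simp add: abs_mult abs_signed_pow)
  show ?thesis
  proof (cases "\<bar>u\<bar> powr (p - 1) \<le> \<bar>v\<bar>")
    case True
    then have "\<bar>u\<bar> powr (p - 1) * \<bar>v\<bar> powr (conjugate p - 1) \<le> \<bar>v\<bar> * \<bar>v\<bar> powr (conjugate p - 1)"
      by (intro mult_right_mono) auto
    also have "\<dots> = \<bar>v\<bar> powr conjugate p"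
      using mult_signed_pow[of "\<bar>v\<bar>" "conjugate p"] by (simp add: signed_pow_of_nonneg)
    finally show ?thesis
      unfolding eq by (simp add: add_increasing)
  next
    case False
    have "\<bar>v\<bar> powr (conjugate p - 1) \<le> (\<bar>u\<bar> powr (p - 1)) powr (conjugate p - 1)"
      using False q(1) by (intro powr_mono2) auto
    also have "\<dots> = \<bar>u\<bar>"
      using q(3) by (simp only: powr_powr) simp
    finally have "\<bar>u\<bar> powr (p - 1) * \<bar>v\<bar> powr (conjugate p - 1) \<le> \<bar>u\<bar> powr (p - 1) * \<bar>u\<bar>"
      by (intro mult_left_mono) auto
    also have "\<dots> = \<bar>u\<bar> powr p"
      using mult_signed_pow[of "\<bar>u\<bar>" p] by (simp add: signed_pow_of_nonneg mult.commute)
    finally show ?thesis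
      unfolding eq by (simp add: add_increasing2)
  qed
qed

lemma has_real_derivative_abs:
  assumes "x \<noteq> 0"
  shows "(abs has_real_derivative sgn x) (at (x::real))"
proof -
  have "((\<lambda>y. sgn x * y) has_real_derivative sgn x) (at x)"
    by (auto intro!: derivative_eq_intros)
  then show ?thesis
    by (rule has_field_derivative_transform_within_open[where S = "if x > 0 then {0<..} else {..<0}"])
      (use assms in \<open>auto simp: sgn_if split: if_splits\<close>)
qed

lemma isCont_signed_pow:
  assumes "r > 1"
  shows "isCont (signed_pow r) x"
proof (cases "x = 0")
  case True
  have "((\<lambda>x. \<bar>signed_pow r x\<bar>) \<longlongrightarrow> \<bar>0\<bar> powr (r - 1)) (at 0)"
    unfolding abs_signed_pow using assms by (intro tendsto_powr' tendsto_intros) auto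
  then show ?thesis
    using assms True by (simp add: tendsto_rabs_zero_iff isCont_def)
qed (auto simp: signed_pow_def[abs_def] intro!: continuous_intros)

lemma continuous_on_signed_pow [continuous_intros]:
  assumes "r > 1" "continuous_on S f"
  shows "continuous_on S (\<lambda>x. signed_pow r (f x))"
  by (rule continuous_on_compose2[OF continuous_at_imp_continuous_on assms(2)])
    (use isCont_signed_pow[OF assms(1)] in auto)

lemma continuous_on_abs_powr [continuous_intros]:
  fixes f :: "real \<Rightarrow> real"
  assumes "r > 1" "continuous_on S f"
  shows "continuous_on S (\<lambda>x. \<bar>f x\<bar> powr r)"
  unfolding mult_signed_pow[symmetric] by (intro continuous_intros assms)

lemma has_real_derivative_abs_powr:
  assumes "r > 1"
  shows "((\<lambda>x. \<bar>x\<bar> powr r) has_real_derivative r * signed_pow r x) (at x)"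
proof (cases "x = 0")
  case True
  have "((\<lambda>x. \<bar>x\<bar> powr r) has_real_derivative 0) (at 0)"
    unfolding has_field_derivative_iff
  proof (rule Lim_transform_eventually)
    show "(signed_pow r \<longlongrightarrow> 0) (at 0)"
      using isCont_signed_pow[OF assms, of 0] by (simp add: isCont_def)
    show "\<forall>\<^sub>F x in at 0. signed_pow r x = (\<bar>x\<bar> powr r - \<bar>0\<bar> powr r) / (x - 0)"
      using assms by (auto simp: eventually_at_filter mult_signed_pow[symmetric])
  qed
  then show ?thesis
    using True by simp
next
  case False
  then have "((\<lambda>x. \<bar>x\<bar> powr r) has_real_derivative (r * \<bar>x\<bar> powr (r - 1) * sgn x)) (at x)"
    by (auto intro!: derivative_eq_intros has_real_derivative_abs)
  then show ?thesis
    by (simp add: signed_pow_eq_sgn mult_ac)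
qed

lemma has_real_derivative_signed_pow:
  assumes "x \<noteq> 0"
  shows "(signed_pow r has_real_derivative (r - 1) * \<bar>x\<bar> powr (r - 2)) (at x)"
proof -
  have "((\<lambda>x. \<bar>x\<bar> powr (r - 2) * x) has_real_derivative
      ((r - 2) * \<bar>x\<bar> powr (r - 2 - 1) * sgn x) * x + \<bar>x\<bar> powr (r - 2)) (at x)"
    using assms by (auto intro!: derivative_eq_intros has_real_derivative_abs simp: algebra_simps)
  moreover have "\<bar>x\<bar> powr (r - 2) = \<bar>x\<bar> powr (r - 2 - 1) * (sgn x * x)"
    using assms powr_add[of "\<bar>x\<bar>" "r - 3" 1] by (simp add: sgn_if split: if_splits)
  ultimately show ?thesis
    unfolding signed_pow_def [abs_def] by (simp add: algebra_simps)
qed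

lemma abs_powr_lipschitz_on_unit:
  assumes "r > 1"
  shows "r-lipschitz_on {- 1..1} (\<lambda>x::real. \<bar>x\<bar> powr r)"
proof (rule lipschitz_on_of_bounded_deriv)
  show "continuous_on {- 1..1} (\<lambda>x::real. \<bar>x\<bar> powr r)"
    using assms by (intro continuous_intros)
  show "\<forall>\<^sub>F x in cocountable {- 1<..<1}. \<exists>d. \<bar>d\<bar> \<le> r \<and> ((\<lambda>x. \<bar>x\<bar> powr r) has_real_derivative d) (at x)"
  proof (rule eventually_cocountableI)
    fix x :: real assume "x \<in> {- 1<..<1}"
    then have "\<bar>signed_pow r x\<bar> \<le> 1"
      by (intro abs_signed_pow_le_one assms) auto
    then have "\<bar>r * signed_pow r x\<bar> \<le> r"
      using assms by (simp add: abs_mult)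
    then show "\<exists>d. \<bar>d\<bar> \<le> r \<and> ((\<lambda>x. \<bar>x\<bar> powr r) has_real_derivative d) (at x)"
      using has_real_derivative_abs_powr[OF assms] by blast
  qed
qed (use assms in simp)

definition abs_powr_secant :: "real \<Rightarrow> real \<Rightarrow> real \<Rightarrow> real" where
  "abs_powr_secant r a b = integral {0..1} (\<lambda>t. r * signed_pow r (b + t * (a - b)))"

lemma abs_powr_diff:
  assumes "r > 1"
  shows "\<bar>a\<bar> powr r - \<bar>b\<bar> powr r = abs_powr_secant r a b * (a - b)"
proof -
  have "((\<lambda>t. r * signed_pow r (b + t * (a - b)) * (a - b)) has_integral
      \<bar>b + 1 * (a - b)\<bar> powr r - \<bar>b + 0 * (a - b)\<bar> powr r) {0..1}"
  proof (rule fundamental_theorem_of_calculus)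
    fix t :: real
    have "((\<lambda>t. \<bar>b + t * (a - b)\<bar> powr r) has_real_derivative
        (r * signed_pow r (b + t * (a - b)) * (a - b))) (at t within {0..1})"
      by (rule DERIV_chain2[OF has_real_derivative_abs_powr[OF assms]])
        (auto intro!: derivative_eq_intros)
    then show "((\<lambda>t. \<bar>b + t * (a - b)\<bar> powr r) has_vector_derivative
        (r * signed_pow r (b + t * (a - b)) * (a - b))) (at t within {0..1})"
      by (simp add: has_real_derivative_iff_has_vector_derivative)
  qed simp
  from integral_unique[OF this] show ?thesis
    unfolding abs_powr_secant_def by (simp only: integral_mult_left) simp
qed

lemma abs_powr_secant_self: "abs_powr_secant r a a = r * signed_pow r a"
  by (simp add: abs_powr_secant_def)

lemma continuous_on_secant_integrand:
  assumes "r > 1"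
  shows "continuous_on {0..1} (\<lambda>t. r * signed_pow r (b + t * (a - b)))"
  using assms by (intro continuous_intros)

lemma abs_powr_secant_mono:
  assumes "r > 1" "a2 \<le> a1" "b2 \<le> b1"
  shows "abs_powr_secant r a2 b2 \<le> abs_powr_secant r a1 b1"
proof -
  have "b2 + t * (a2 - b2) \<le> b1 + t * (a1 - b1)" if "t \<in> {0..1}" for t
  proof -
    have "(1 - t) * b2 + t * a2 \<le> (1 - t) * b1 + t * a1"
      using assms that by (intro add_mono mult_left_mono) auto
    then show ?thesis
      by (simp add: algebra_simps)
  qed
  then show ?thesis
    unfolding abs_powr_secant_def using assms(1)
    by (intro integral_le integrable_continuous_real continuous_on_secant_integrand
        mult_left_mono signed_pow_mono) auto
qed

lemma abs_powr_secant_strict_mono: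
  assumes "r > 1" "a2 \<le> a1" "b2 < b1"
  shows "abs_powr_secant r a2 b2 < abs_powr_secant r a1 b1"
proof -
  let ?f = "\<lambda>a b t. r * signed_pow r (b + t * (a - b))"
  have "?f a2 b2 t < ?f a1 b1 t" if "t \<in> box 0 1" for t
  proof -
    have "(1 - t) * b2 + t * a2 < (1 - t) * b1 + t * a1"
      using assms that by (intro add_less_le_mono mult_strict_left_mono mult_left_mono) auto
    then show ?thesis
      using assms(1) by (intro mult_strict_left_mono signed_pow_strict_mono) (auto simp: algebra_simps)
  qed
  then have "integral (cbox 0 1) (?f a2 b2) < integral (cbox 0 1) (?f a1 b1)"
    using assms(1) continuous_on_secant_integrand[OF assms(1)] by (intro integral_less) auto
  then show ?thesis
    by (simp add: abs_powr_secant_def)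
qed

lemma abs_powr_secant_ge:
  assumes "r > 1" "m \<le> a" "m \<le> b"
  shows "r * signed_pow r m \<le> abs_powr_secant r a b"
  using abs_powr_secant_mono[OF assms] by (simp add: abs_powr_secant_self)

lemma abs_powr_secant_le:
  assumes "r > 1" "a \<le> m" "b \<le> m"
  shows "abs_powr_secant r a b \<le> r * signed_pow r m"
  using abs_powr_secant_mono[OF assms] by (simp add: abs_powr_secant_self)

section \<open>Riccati equations and Sturm comparison\<close>

definition riccati :: "real \<Rightarrow> (real \<Rightarrow> real) \<Rightarrow> real \<Rightarrow> real \<Rightarrow> (real \<Rightarrow> real) \<Rightarrow> bool" where
  "riccati p Q c d W \<longleftrightarrow> continuous_on {c<..<d} W \<and>
     (\<forall>\<^sub>F x in cocountable {c<..<d}.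
        (W has_real_derivative - (p - 1) * (Q x + \<bar>W x\<bar> powr conjugate p)) (at x))"

lemma riccatiD:
  assumes "riccati p Q c d W"
  shows "continuous_on {c<..<d} W"
    and "\<forall>\<^sub>F x in cocountable {c<..<d}.
      (W has_real_derivative - (p - 1) * (Q x + \<bar>W x\<bar> powr conjugate p)) (at x)"
  using assms by (auto simp: riccati_def)

lemma riccati_subinterval:
  assumes "riccati p Q c d W" "c \<le> c'" "d' \<le> d"
  shows "riccati p Q c' d' W"
proof -
  have "{c'<..<d'} \<subseteq> {c<..<d}"
    using assms(2,3) by auto
  with assms(1) show ?thesis
    unfolding riccati_def by (auto intro: continuous_on_subset eventually_cocountable_subset)
qed

lemma riccati_cong:
  assumes "riccati p Q c d W" "\<forall>\<^sub>F x in cocountable {c<..<d}. Q x = Q' x"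
  shows "riccati p Q' c d W"
  using assms unfolding riccati_def by (auto elim: eventually_elim2)

lemma riccati_reflect:
  assumes "riccati p Q c d W"
  shows "riccati p (\<lambda>x. Q (r - x)) (r - d) (r - c) (\<lambda>x. - W (r - x))"
  unfolding riccati_def
proof
  show "continuous_on {r - d<..<r - c} (\<lambda>x. - W (r - x))"
    by (intro continuous_on_minus continuous_on_compose2[OF riccatiD(1)[OF assms]] continuous_intros) auto
  show "\<forall>\<^sub>F x in cocountable {r - d<..<r - c}. ((\<lambda>x. - W (r - x)) has_real_derivative
      - (p - 1) * (Q (r - x) + \<bar>- W (r - x)\<bar> powr conjugate p)) (at x)"
    using eventually_cocountable_reflect[OF riccatiD(2)[OF assms], of r]
  proof eventually_elim
    case (elim x)
    have "((\<lambda>x. r - x) has_real_derivative - 1) (at x)"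
      by (auto intro!: derivative_eq_intros)
    from DERIV_minus[OF DERIV_chain2[OF elim this]] show ?case
      by simp
  qed
qed

lemma riccati_eq_imp_potential_eq:
  assumes "p > 1" and A: "riccati p QA c d A" and B: "riccati p QB c d B"
    and eq: "\<And>x. x \<in> {c<..<d} \<Longrightarrow> A x = B x"
  shows "\<forall>\<^sub>F x in cocountable {c<..<d}. QA x = QB x"
  using riccatiD(2)[OF A] riccatiD(2)[OF B] eventually_in_cocountable
proof eventually_elim
  case (elim x)
  have "(A has_real_derivative - (p - 1) * (QB x + \<bar>B x\<bar> powr conjugate p)) (at x)"
    by (rule has_field_derivative_transform_within_open[OF elim(2) open_greaterThanLessThan elim(3)])
      (simp add: eq)
  from DERIV_unique[OF elim(1) this] show ?case
    using \<open>p > 1\<close> eq[OF elim(3)] by simp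
qed

lemma riccati_diff_deriv:
  assumes "p > 1" and A: "riccati p QA c d A" and B: "riccati p QB c d B"
  shows "\<forall>\<^sub>F x in cocountable {c<..<d}. ((\<lambda>x. A x - B x) has_real_derivative
    - (p - 1) * (QA x - QB x + abs_powr_secant (conjugate p) (A x) (B x) * (A x - B x))) (at x)"
  using riccatiD(2)[OF A] riccatiD(2)[OF B]
proof eventually_elim
  case (elim x)
  show ?case
    using DERIV_diff[OF elim]
    unfolding abs_powr_diff[OF conjugate_exponent(1)[OF \<open>p > 1\<close>], symmetric]
    by (simp add: algebra_simps)
qed

lemma at_left_reflect: "at_left a = filtermap (\<lambda>x. r - x) (at_right (r - a))" for a r :: real
proof -
  have "at_left a = filtermap uminus (at_right (- a))"
    by (rule at_left_minus)
  also have "at_right (- a) = filtermap (\<lambda>x. x - r) (at_right (r - a))"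
    using filtermap_at_right_shift[of r "r - a"] by simp
  finally show ?thesis
    by (simp add: filtermap_filtermap)
qed

text \<open>Near a zero \<open>c\<close> of a solution its Riccati function behaves like that of \<open>x - c\<close>; the
  one-sided notions also admit functions that stay bounded at the end point.\<close>

definition singular_left :: "real \<Rightarrow> real \<Rightarrow> (real \<Rightarrow> real) \<Rightarrow> bool" where
  "singular_left p c W \<longleftrightarrow> ((\<lambda>x. W x - (x - c) powr (1 - p)) \<longlongrightarrow> 0) (at_right c)"

definition singular_right :: "real \<Rightarrow> real \<Rightarrow> (real \<Rightarrow> real) \<Rightarrow> bool" where
  "singular_right p d W \<longleftrightarrow> ((\<lambda>x. W x + (d - x) powr (1 - p)) \<longlongrightarrow> 0) (at_left d)"

definition subsingular_left :: "real \<Rightarrow> real \<Rightarrow> (real \<Rightarrow> real) \<Rightarrow> bool" where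
  "subsingular_left p c W \<longleftrightarrow> (\<forall>e>0. \<forall>\<^sub>F x in at_right c. W x - (x - c) powr (1 - p) < e)"

definition subsingular_right :: "real \<Rightarrow> real \<Rightarrow> (real \<Rightarrow> real) \<Rightarrow> bool" where
  "subsingular_right p d W \<longleftrightarrow> (\<forall>e>0. \<forall>\<^sub>F x in at_left d. - e < W x + (d - x) powr (1 - p))"

lemma singular_left_reflect_iff:
  "singular_left p (r - d) (\<lambda>x. - W (r - x)) \<longleftrightarrow> singular_right p d W"
proof -
  have "singular_right p d W \<longleftrightarrow>
      ((\<lambda>x. W (r - x) + (d - (r - x)) powr (1 - p)) \<longlongrightarrow> 0) (at_right (r - d))"
    unfolding singular_right_def at_left_reflect[of d r] by (simp add: filterlim_filtermap)
  also have "\<dots> \<longleftrightarrow>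
      ((\<lambda>x. - (W (r - x) + (d - (r - x)) powr (1 - p))) \<longlongrightarrow> - 0) (at_right (r - d))"
    by (simp only: tendsto_minus_cancel_left[symmetric] minus_zero)
  finally show ?thesis
    by (simp add: singular_left_def algebra_simps)
qed

lemma singular_right_reflect_iff:
  "singular_right p (r - c) (\<lambda>x. - W (r - x)) \<longleftrightarrow> singular_left p c W"
  using singular_left_reflect_iff[of p r "r - c" "\<lambda>x. - W (r - x)"] by simp

lemma subsingular_left_reflect_iff:
  "subsingular_left p (r - d) (\<lambda>x. - W (r - x)) \<longleftrightarrow> subsingular_right p d W"
proof -
  have "- e < W (r - x) + (d - (r - x)) powr (1 - p) \<longleftrightarrow>
      - W (r - x) - (x - (r - d)) powr (1 - p) < e" for e x
    by (auto simp: algebra_simps)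
  then show ?thesis
    unfolding subsingular_left_def subsingular_right_def at_left_reflect[of d r] eventually_filtermap
    by simp
qed

lemma filterlim_negative_powr_at_top:
  assumes "p > 1"
  shows "filterlim (\<lambda>x. (x - c) powr (1 - p)) at_top (at_right (c::real))"
  unfolding filterlim_at_right_to_0[of _ _ c]
proof -
  have "filterlim (\<lambda>x::real. inverse (x powr (p - 1))) at_top (at_right 0)"
  proof (rule filterlim_inverse_at_top)
    show "((\<lambda>x::real. x powr (p - 1)) \<longlongrightarrow> 0) (at_right 0)"
      using assms tendsto_powr'[of "\<lambda>x::real. x" 0 "at_right 0" "\<lambda>_. p - 1" "p - 1"]
      by (auto simp: eventually_at_right_less eventually_at_filter)
    show "\<forall>\<^sub>F x::real in at_right 0. 0 < x powr (p - 1)"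
      by (auto simp: eventually_at_filter)
  qed
  then show "filterlim (\<lambda>x. (x + c - c) powr (1 - p)) at_top (at_right 0)"
    by (simp add: powr_minus[symmetric])
qed

lemma singular_left_at_top:
  assumes "p > 1" "singular_left p c W"
  shows "filterlim W at_top (at_right c)"
  using filterlim_tendsto_add_at_top[OF assms(2)[unfolded singular_left_def]
      filterlim_negative_powr_at_top[OF assms(1), of c]] by simp

lemma singular_right_at_bot:
  assumes "p > 1" "singular_right p d W"
  shows "filterlim W at_bot (at_left d)"
proof -
  have "filterlim (\<lambda>x. - W (d - x)) at_top (at_right (d - d))"
    by (rule singular_left_at_top[OF assms(1) singular_left_reflect_iff[THEN iffD2, OF assms(2)]])
  then show ?thesis
    unfolding filterlim_uminus_at_top[of W] at_left_reflect[of d d]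
    by (simp add: filterlim_filtermap filterlim_uminus_at_bot)
qed

lemma tendsto_imp_not_singular_left:
  assumes "p > 1" "(W \<longlongrightarrow> l) (at_right c)"
  shows "\<not> singular_left p c W"
  using singular_left_at_top[OF assms(1)] not_tendsto_and_filterlim_at_infinity[OF _ assms(2)]
    filterlim_at_top_imp_at_infinity by fastforce

lemma tendsto_imp_not_singular_right:
  assumes "p > 1" "(W \<longlongrightarrow> l) (at_left d)"
  shows "\<not> singular_right p d W"
  using singular_right_at_bot[OF assms(1)] not_tendsto_and_filterlim_at_infinity[OF _ assms(2)]
    filterlim_at_bot_imp_at_infinity by fastforce

lemma singular_left_imp_subsingular_left: "singular_left p c W \<Longrightarrow> subsingular_left p c W"
  by (auto simp: singular_left_def subsingular_left_def dest: order_tendstoD(2))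

lemma singular_right_imp_subsingular_right: "singular_right p d W \<Longrightarrow> subsingular_right p d W"
  by (auto simp: singular_right_def subsingular_right_def intro: order_tendstoD(1))

lemma tendsto_imp_subsingular_left:
  assumes "p > 1" "(W \<longlongrightarrow> l) (at_right c)"
  shows "subsingular_left p c W"
  unfolding subsingular_left_def
proof (intro allI impI)
  fix e :: real assume "e > 0"
  have "\<forall>\<^sub>F x in at_right c. W x < l + 1"
    using assms(2) by (rule order_tendstoD) simp
  moreover have "\<forall>\<^sub>F x in at_right c. l + 1 \<le> (x - c) powr (1 - p)"
    using filterlim_negative_powr_at_top[OF assms(1)] by (auto simp: filterlim_at_top)
  ultimately show "\<forall>\<^sub>F x in at_right c. W x - (x - c) powr (1 - p) < e"
    by eventually_elim (use \<open>e > 0\<close> in simp)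
qed

lemma tendsto_imp_subsingular_right:
  assumes "p > 1" "(W \<longlongrightarrow> l) (at_left d)"
  shows "subsingular_right p d W"
proof -
  have "((\<lambda>x. - W (d - x)) \<longlongrightarrow> - l) (at_right (d - d))"
    using assms(2) unfolding at_left_reflect[of d d]
    by (intro tendsto_minus) (simp add: filterlim_filtermap)
  then show ?thesis
    using tendsto_imp_subsingular_left[OF assms(1)] subsingular_left_reflect_iff by blast
qed

lemma subsingular_left_diff_less:
  assumes "subsingular_left p c A" "singular_left p c B" "e > 0"
  shows "\<forall>\<^sub>F x in at_right c. A x - B x < e"
proof -
  have "\<forall>\<^sub>F x in at_right c. A x - (x - c) powr (1 - p) < e / 2"
    using assms(1)[unfolded subsingular_left_def, rule_format, of "e / 2"] assms(3) by simp
  moreover have "\<forall>\<^sub>F x in at_right c. - (e / 2) < B x - (x - c) powr (1 - p)"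
    using assms(2,3) unfolding singular_left_def by (intro order_tendstoD) auto
  ultimately show ?thesis
    by eventually_elim simp
qed

lemma subsingular_right_diff_greater:
  assumes "subsingular_right p d A" "singular_right p d B" "e > 0"
  shows "\<forall>\<^sub>F x in at_left d. - e < A x - B x"
proof -
  have "\<forall>\<^sub>F x in at_left d. - (e / 2) < A x + (d - x) powr (1 - p)"
    using assms(1)[unfolded subsingular_right_def, rule_format, of "e / 2"] assms(3) by simp
  moreover have "\<forall>\<^sub>F x in at_left d. B x + (d - x) powr (1 - p) < e / 2"
    using assms(2,3) unfolding singular_right_def by (intro order_tendstoD) auto
  ultimately show ?thesis
    by eventually_elim simp
qed

lemma continuous_on_bounded_below_left:
  fixes f :: "real \<Rightarrow> real"
  assumes "continuous_on {c<..<d} f" "\<forall>\<^sub>F y in at_right c. m \<le> f y" "x \<in> {c<..<d}"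
  obtains m' where "\<And>y. y \<in> {c<..x} \<Longrightarrow> m' \<le> f y"
proof -
  obtain b where b: "b > c" "\<And>y. y > c \<Longrightarrow> y < b \<Longrightarrow> m \<le> f y"
    using assms(2) unfolding eventually_at_right_field by blast
  have "compact (f ` {min b x..x})"
    using assms(3) b(1) by (intro compact_continuous_image continuous_on_subset[OF assms(1)]) auto
  then have "bdd_below (f ` {min b x..x})"
    by (rule compact_imp_bounded[THEN bounded_imp_bdd_below])
  then obtain l where l: "\<forall>y\<in>{min b x..x}. l \<le> f y"
    by (auto simp: bdd_below_def)
  have "min m l \<le> f y" if "y \<in> {c<..x}" for y
    using b(2)[of y] l that by (cases "y < b") (auto simp: min_le_iff_disj)
  then show thesis
    using that by blast
qed

lemma continuous_on_bounded_above_right: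
  fixes f :: "real \<Rightarrow> real"
  assumes "continuous_on {c<..<d} f" "\<forall>\<^sub>F y in at_left d. f y \<le> m" "x \<in> {c<..<d}"
  obtains m' where "\<And>y. y \<in> {x..<d} \<Longrightarrow> f y \<le> m'"
proof -
  have cont: "continuous_on {- d<..<- c} (\<lambda>y. - f (- y))"
    by (intro continuous_on_minus continuous_on_compose2[OF assms(1)] continuous_intros) auto
  have lower: "\<forall>\<^sub>F y in at_right (- d). - m \<le> - f (- y)"
    using assms(2) unfolding at_left_minus[of d] by (simp add: eventually_filtermap)
  obtain m' where m': "\<And>y. y \<in> {- d<..- x} \<Longrightarrow> m' \<le> - f (- y)"
    using continuous_on_bounded_below_left[OF cont lower, of "- x"] assms(3) by auto
  have "f y \<le> - m'" if "y \<in> {x..<d}" for y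
    using m'[of "- y"] that by simp
  then show thesis
    using that by blast
qed

lemma continuous_on_Ioo_tendsto:
  fixes f :: "real \<Rightarrow> real"
  assumes "continuous_on {c<..<d} f" "x \<in> {c<..<d}"
  shows "(f \<longlongrightarrow> f x) (at_left x)" "(f \<longlongrightarrow> f x) (at_right x)"
proof -
  have "(f \<longlongrightarrow> f x) (at x)"
    using assms by (simp add: continuous_on_eq_continuous_at isCont_def)
  then show "(f \<longlongrightarrow> f x) (at_left x)" "(f \<longlongrightarrow> f x) (at_right x)"
    by (simp_all add: filterlim_at_split)
qed

lemma riccati_diff_deriv_le:
  assumes "p > 1" and A: "riccati p QA c d A" and B: "riccati p QB c d B"
    and Q: "\<forall>\<^sub>F x in cocountable {c<..<d}. QB x \<le> QA x"
  shows "\<forall>\<^sub>F x in cocountable {c<..<d}.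
    \<exists>D'\<le>- ((p - 1) * abs_powr_secant (conjugate p) (A x) (B x)) * (A x - B x).
      ((\<lambda>x. A x - B x) has_real_derivative D') (at x)"
  using riccati_diff_deriv[OF assms(1-3)] Q
proof eventually_elim
  case (elim x)
  let ?s = "abs_powr_secant (conjugate p) (A x) (B x)"
  have "0 \<le> (p - 1) * (QA x - QB x)"
    using \<open>p > 1\<close> elim(2) by simp
  then have "- (p - 1) * (QA x - QB x + ?s * (A x - B x)) \<le> - ((p - 1) * ?s) * (A x - B x)"
    by (simp add: algebra_simps)
  with elim(1) show ?case
    by blast
qed

lemma sturm_le:
  assumes "p > 1" and A: "riccati p QA c d A" and B: "riccati p QB c d B"
    and Q: "\<forall>\<^sub>F x in cocountable {c<..<d}. QB x \<le> QA x"
    and sing: "singular_left p c B" "subsingular_left p c A" and x: "x \<in> {c<..<d}"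
  shows "A x \<le> B x"
proof -
  let ?q = "conjugate p"
  note q = conjugate_exponent(1)[OF \<open>p > 1\<close>]
  have "\<forall>\<^sub>F y in at_right c. 0 \<le> B y"
    using singular_left_at_top[OF \<open>p > 1\<close> sing(1)] by (auto simp: filterlim_at_top)
  then obtain m where m: "\<And>y. y \<in> {c<..x} \<Longrightarrow> m \<le> B y"
    using continuous_on_bounded_below_left[OF riccatiD(1)[OF B] _ x] by blast
  have "A x - B x \<le> 0"
  proof (rule linear_decay_nonpos[of c d "\<lambda>x. A x - B x"])
    show "continuous_on {c<..<d} (\<lambda>x. A x - B x)"
      by (intro continuous_on_diff riccatiD(1)[OF A] riccatiD(1)[OF B])
    show "\<forall>\<^sub>F x in cocountable {c<..<d}. 0 < A x - B x \<longrightarrow>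
        (\<exists>D'\<le>- ((p - 1) * abs_powr_secant ?q (A x) (B x)) * (A x - B x).
          ((\<lambda>x. A x - B x) has_real_derivative D') (at x))"
      using riccati_diff_deriv_le[OF \<open>p > 1\<close> A B Q] by eventually_elim simp
    show "(p - 1) * (?q * signed_pow ?q m) \<le> (p - 1) * abs_powr_secant ?q (A y) (B y)"
      if "y \<in> {c<..x}" "0 < A y - B y" for y
      using m[OF that(1)] that(2) \<open>p > 1\<close> q
      by (intro mult_left_mono abs_powr_secant_ge) auto
    show "\<forall>\<^sub>F y in at_right c. A y - B y < e" if "e > 0" for e
      by (rule subsingular_left_diff_less[OF sing(2,1) that])
  qed (fact x)
  then show ?thesis
    by simp
qed

lemma sturm_le_right:
  assumes "p > 1" and A: "riccati p QA c d A" and B: "riccati p QB c d B"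
    and Q: "\<forall>\<^sub>F x in cocountable {c<..<d}. QB x \<le> QA x"
    and sing: "singular_right p d B" "subsingular_right p d A" and x: "x \<in> {c<..<d}"
  shows "B x \<le> A x"
proof -
  have "- A (0 - (- x)) \<le> - B (0 - (- x))"
  proof (rule sturm_le[OF \<open>p > 1\<close> riccati_reflect[OF A, of 0] riccati_reflect[OF B, of 0]
        eventually_cocountable_reflect[OF Q, of 0]])
    show "singular_left p (0 - d) (\<lambda>x. - B (0 - x))" "subsingular_left p (0 - d) (\<lambda>x. - A (0 - x))"
      using sing by (simp_all only: singular_left_reflect_iff subsingular_left_reflect_iff)
  qed (use x in auto)
  then show ?thesis
    by simp
qed

lemma sturm_eq:
  assumes "p > 1" and A: "riccati p QA c d A" and B: "riccati p QB c d B"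
    and Q: "\<forall>\<^sub>F x in cocountable {c<..<d}. QB x \<le> QA x"
    and sing: "singular_left p c B" "subsingular_left p c A"
    and bound: "\<forall>\<^sub>F x in at_left d. B x \<le> m"
    and lim: "((\<lambda>x. A x - B x) \<longlongrightarrow> 0) (at_left d)" and x: "x \<in> {c<..<d}"
  shows "A x = B x"
proof -
  let ?q = "conjugate p"
  note q = conjugate_exponent(1)[OF \<open>p > 1\<close>]
  have A_le_B: "A y \<le> B y" if "y \<in> {c<..<d}" for y
    by (rule sturm_le[OF \<open>p > 1\<close> A B Q sing that])
  obtain m' where m': "\<And>y. y \<in> {x..<d} \<Longrightarrow> B y \<le> m'"
    using continuous_on_bounded_above_right[OF riccatiD(1)[OF B] bound x] by blast
  have "A x - B x = 0"
  proof (rule linear_decay_eq_0[OF _ riccati_diff_deriv_le[OF \<open>p > 1\<close> A B Q] _ x])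
    show "continuous_on {c<..<d} (\<lambda>x. A x - B x)"
      by (intro continuous_on_diff riccatiD(1)[OF A] riccatiD(1)[OF B])
    show "(p - 1) * abs_powr_secant ?q (A y) (B y) \<le> (p - 1) * (?q * signed_pow ?q m')"
      if "y \<in> {x..<d}" for y
      using m'[OF that] A_le_B[of y] that x \<open>p > 1\<close> q
      by (intro mult_left_mono abs_powr_secant_le) auto
  qed (use A_le_B lim in auto)
  then show ?thesis
    by simp
qed

lemma sturm_less:
  assumes "p > 1" and A: "riccati p QA c d A" and B: "riccati p QB c d B"
    and Q: "\<forall>\<^sub>F x in cocountable {c<..<d}. QB x < QA x"
    and sing: "singular_left p c B" "subsingular_left p c A" and x: "x \<in> {c<..<d}"
  shows "A x < B x"
proof (rule ccontr)
  have Q_le: "\<forall>\<^sub>F x in cocountable {c<..<d}. QB x \<le> QA x"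
    using Q by eventually_elim simp
  assume "\<not> A x < B x"
  then have "A x = B x"
    using sturm_le[OF \<open>p > 1\<close> A B Q_le sing x] by simp
  have A': "riccati p QA c x A" and B': "riccati p QB c x B"
    using x A B by (auto intro: riccati_subinterval)
  note limA = continuous_on_Ioo_tendsto(1)[OF riccatiD(1)[OF A] x]
    and limB = continuous_on_Ioo_tendsto(1)[OF riccatiD(1)[OF B] x]
  have "A y = B y" if "y \<in> {c<..<x}" for y
  proof (rule sturm_eq[OF \<open>p > 1\<close> A' B' _ sing _ _ that])
    show "\<forall>\<^sub>F y in cocountable {c<..<x}. QB y \<le> QA y"
      using Q_le by (rule eventually_cocountable_subset) (use x in auto)
    show "\<forall>\<^sub>F y in at_left x. B y \<le> B x + 1"
      using order_tendstoD(2)[OF limB, of "B x + 1"] by (auto elim: eventually_mono)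
    show "((\<lambda>y. A y - B y) \<longlongrightarrow> 0) (at_left x)"
      using tendsto_diff[OF limA limB] \<open>A x = B x\<close> by simp
  qed
  then have "\<forall>\<^sub>F y in cocountable {c<..<x}. QA y = QB y"
    by (rule riccati_eq_imp_potential_eq[OF \<open>p > 1\<close> A' B'])
  moreover have "\<forall>\<^sub>F y in cocountable {c<..<x}. QB y < QA y"
    using Q by (rule eventually_cocountable_subset) (use x in auto)
  ultimately have "\<forall>\<^sub>F y in cocountable {c<..<x}. False"
    by eventually_elim simp
  then show False
    using x by (auto elim: eventually_cocountable_obtains)
qed

lemma sturm_rigid:
  assumes "p > 1" and A: "riccati p QA c d A" and B: "riccati p QB c d B"
    and Q: "\<forall>\<^sub>F x in cocountable {c<..<d}. QB x \<le> QA x"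
    and B_sing: "singular_left p c B" "singular_right p d B"
    and A_sing: "subsingular_left p c A" "subsingular_right p d A" and x: "x \<in> {c<..<d}"
  shows "A x = B x"
proof (rule sturm_eq[OF \<open>p > 1\<close> A B Q B_sing(1) A_sing(1) _ _ x])
  show "\<forall>\<^sub>F y in at_left d. B y \<le> 0"
    using singular_right_at_bot[OF \<open>p > 1\<close> B_sing(2)] by (auto simp: filterlim_at_bot)
  show "((\<lambda>x. A x - B x) \<longlongrightarrow> 0) (at_left d)"
  proof (rule order_tendstoI)
    show "\<forall>\<^sub>F y in at_left d. l < A y - B y" if "l < 0" for l
      using subsingular_right_diff_greater[OF A_sing(2) B_sing(2), of "- l"] that by simp
    have "A y \<le> B y" if "y \<in> {c<..<d}" for y
      by (rule sturm_le[OF \<open>p > 1\<close> A B Q B_sing(1) A_sing(1) that])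
    then show "\<forall>\<^sub>F y in at_left d. A y - B y < u" if "0 < u" for u
      using that x by (intro eventually_at_leftI[of c]) fastforce+
  qed
qed

section \<open>Nodal intervals\<close>

definition nodal :: "real \<Rightarrow> (real \<Rightarrow> real) \<Rightarrow> real \<Rightarrow> real \<Rightarrow> (real \<Rightarrow> real) \<Rightarrow> bool" where
  "nodal p Q c d W \<longleftrightarrow> riccati p Q c d W \<and> singular_left p c W \<and> singular_right p d W"

definition half_nodal ::
    "real \<Rightarrow> (real \<Rightarrow> real) \<Rightarrow> real \<Rightarrow> real \<Rightarrow> real \<Rightarrow> (real \<Rightarrow> real) \<Rightarrow> bool" where
  "half_nodal p Q c d l W \<longleftrightarrow> riccati p Q c d W \<and> singular_left p c W \<and> (W \<longlongrightarrow> l) (at_left d)"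

definition nodal_interval :: "real \<Rightarrow> (real \<Rightarrow> real) \<Rightarrow> real \<Rightarrow> real \<Rightarrow> bool" where
  "nodal_interval p Q c d \<longleftrightarrow> c < d \<and> (\<exists>W. nodal p Q c d W)"

definition upcrossing :: "real \<Rightarrow> real \<Rightarrow> (real \<Rightarrow> real) \<Rightarrow> (real \<Rightarrow> real) \<Rightarrow> bool" where
  "upcrossing a b f g \<longleftrightarrow> (\<exists>e\<in>{a..b}.
     (\<forall>\<^sub>F x in cocountable {a<..<e}. f x \<le> g x) \<and> (\<forall>\<^sub>F x in cocountable {e<..<b}. g x \<le> f x))"

lemma nodal_cong:
  assumes "nodal p Q c d W" "\<forall>\<^sub>F x in cocountable {c<..<d}. Q x = Q' x"
  shows "nodal p Q' c d W"
  using assms riccati_cong by (auto simp: nodal_def)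

lemma nodal_reflect:
  assumes "nodal p Q c d W"
  shows "nodal p (\<lambda>x. Q (r - x)) (r - d) (r - c) (\<lambda>x. - W (r - x))"
  using assms
  by (simp add: nodal_def riccati_reflect singular_left_reflect_iff singular_right_reflect_iff)

lemma nodal_imp_half_nodal:
  assumes "nodal p Q c d W" "e \<in> {c<..<d}"
  shows "half_nodal p Q c e (W e) W"
  using assms continuous_on_Ioo_tendsto(1)[OF riccatiD(1), of p Q c d W e]
  by (auto simp: nodal_def half_nodal_def intro: riccati_subinterval)

lemma nodal_interval_reflect:
  "nodal_interval p Q c d \<Longrightarrow> nodal_interval p (\<lambda>x. Q (r - x)) (r - d) (r - c)"
  by (auto simp: nodal_interval_def intro: nodal_reflect)

lemma nodal_interval_cong:
  "nodal_interval p Q c d \<Longrightarrow> \<forall>\<^sub>F x in cocountable {c<..<d}. Q x = Q' x \<Longrightarrow> nodal_interval p Q' c d"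
  by (auto simp: nodal_interval_def intro: nodal_cong)

lemma nodal_subsingular:
  assumes "p > 1" "nodal p Q c' d' W" "c' \<le> c" "c < d" "d \<le> d'"
  shows "subsingular_left p c W" "subsingular_right p d W"
proof -
  have W: "continuous_on {c'<..<d'} W" "singular_left p c' W" "singular_right p d' W"
    using assms(2) by (auto simp: nodal_def riccati_def)
  show "subsingular_left p c W"
  proof (cases "c' = c")
    case False
    then have "(W \<longlongrightarrow> W c) (at_right c)"
      using assms(3-5) by (intro continuous_on_Ioo_tendsto(2)[OF W(1)]) auto
    then show ?thesis
      by (rule tendsto_imp_subsingular_left[OF assms(1)])
  qed (use W(2) singular_left_imp_subsingular_left in auto)
  show "subsingular_right p d W"
  proof (cases "d = d'")
    case False
    then have "(W \<longlongrightarrow> W d) (at_left d)"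
      using assms(3-5) by (intro continuous_on_Ioo_tendsto(1)[OF W(1)]) auto
    then show ?thesis
      by (rule tendsto_imp_subsingular_right[OF assms(1)])
  qed (use W(3) singular_right_imp_subsingular_right in auto)
qed

lemma nodal_interval_rigid:
  assumes "p > 1" "nodal_interval p QA c' d'" "nodal_interval p QB c d" and sub: "c' \<le> c" "d \<le> d'"
    and Q: "\<forall>\<^sub>F x in cocountable {c<..<d}. QB x \<le> QA x"
  shows "c' = c" "d' = d" "\<forall>\<^sub>F x in cocountable {c<..<d}. QA x = QB x"
proof -
  obtain A B where A: "nodal p QA c' d' A" and B: "nodal p QB c d B" and "c < d"
    using assms(2,3) by (auto simp: nodal_interval_def)
  have ricA: "riccati p QA c d A" and ricB: "riccati p QB c d B"
    using A B sub by (auto simp: nodal_def intro: riccati_subinterval)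
  have eq: "A x = B x" if "x \<in> {c<..<d}" for x
    using B by (intro sturm_rigid[OF \<open>p > 1\<close> ricA ricB Q _ _ _ _ that]
        nodal_subsingular[OF \<open>p > 1\<close> A sub(1) \<open>c < d\<close> sub(2)]) (auto simp: nodal_def)
  then show "\<forall>\<^sub>F x in cocountable {c<..<d}. QA x = QB x"
    by (rule riccati_eq_imp_potential_eq[OF \<open>p > 1\<close> ricA ricB])
  have contA: "continuous_on {c'<..<d'} A"
    using A by (simp add: nodal_def riccati_def)
  show "c' = c"
  proof (rule ccontr)
    assume "c' \<noteq> c"
    then have "\<not> singular_left p c A"
      using sub \<open>c < d\<close>
      by (intro tendsto_imp_not_singular_left[OF \<open>p > 1\<close> continuous_on_Ioo_tendsto(2)[OF contA]]) auto
    moreover have "\<forall>\<^sub>F x in at_right c. B x - (x - c) powr (1 - p) = A x - (x - c) powr (1 - p)"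
      using eq \<open>c < d\<close> by (intro eventually_at_rightI[of c d]) auto
    then have "singular_left p c A"
      using B unfolding nodal_def singular_left_def by (auto intro: Lim_transform_eventually)
    ultimately show False ..
  qed
  show "d' = d"
  proof (rule ccontr)
    assume "d' \<noteq> d"
    then have "\<not> singular_right p d A"
      using sub \<open>c < d\<close>
      by (intro tendsto_imp_not_singular_right[OF \<open>p > 1\<close> continuous_on_Ioo_tendsto(1)[OF contA]]) auto
    moreover have "\<forall>\<^sub>F x in at_left d. B x + (d - x) powr (1 - p) = A x + (d - x) powr (1 - p)"
      using eq \<open>c < d\<close> by (intro eventually_at_leftI[of c d]) auto
    then have "singular_right p d A"
      using B unfolding nodal_def singular_right_def by (auto intro: Lim_transform_eventually)
    ultimately show False ..
  qed
qed

lemma nodal_interval_eigenvalue_less: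
  assumes "p > 1" "nodal_interval p (\<lambda>x. \<mu> * \<rho> x) c' d'" "nodal_interval p (\<lambda>x. \<nu> * \<rho> x) c d"
    and "c' \<le> c" "d \<le> d'" "c' \<noteq> c \<or> d' \<noteq> d" and pos: "\<forall>\<^sub>F x in cocountable {c<..<d}. \<rho> x > 0"
  shows "\<mu> < \<nu>"
proof (rule ccontr)
  assume "\<not> \<mu> < \<nu>"
  then have "\<forall>\<^sub>F x in cocountable {c<..<d}. \<nu> * \<rho> x \<le> \<mu> * \<rho> x"
    using pos by (auto elim: eventually_mono)
  from nodal_interval_rigid(1,2)[OF assms(1-5) this] assms(6) show False
    by blast
qed

lemma nodal_interval_eigenvalue_unique:
  assumes "p > 1" "nodal_interval p (\<lambda>x. \<mu> * \<rho> x) c d" "nodal_interval p (\<lambda>x. \<nu> * \<rho> x) c d"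
    and pos: "\<forall>\<^sub>F x in cocountable {c<..<d}. \<rho> x > 0"
  shows "\<mu> = \<nu>"
proof -
  have "\<mu> = \<nu>" if "nodal_interval p (\<lambda>x. \<mu> * \<rho> x) c d" "nodal_interval p (\<lambda>x. \<nu> * \<rho> x) c d" "\<nu> \<le> \<mu>" for \<mu> \<nu>
  proof -
    have "\<forall>\<^sub>F x in cocountable {c<..<d}. \<nu> * \<rho> x \<le> \<mu> * \<rho> x"
      using pos that(3) by (auto elim: eventually_mono)
    from nodal_interval_rigid(3)[OF assms(1) that(1,2) order_refl order_refl this] pos
    have "\<forall>\<^sub>F x in cocountable {c<..<d}. \<mu> = \<nu>"
      by eventually_elim simp
    then show ?thesis
      using that(1) by (auto simp: nodal_interval_def elim: eventually_cocountable_obtains)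
  qed
  from this[of \<mu> \<nu>] this[of \<nu> \<mu>] show ?thesis
    using assms(2,3) by linarith
qed

lemma nodal_symmetric_midpoint:
  assumes "p > 1" and W: "nodal p Q c d W" and "c < d"
    and sym: "\<forall>\<^sub>F x in cocountable {c<..<d}. Q (c + d - x) = Q x"
  shows "W ((c + d) / 2) = 0"
proof -
  let ?V = "\<lambda>x. - W (c + d - x)" and ?mid = "(c + d) / 2"
  have "nodal p (\<lambda>x. Q (c + d - x)) c d ?V"
    using nodal_reflect[OF W, of "c + d"] by simp
  then have V: "nodal p Q c d ?V"
    using sym by (rule nodal_cong)
  have "W ?mid = ?V ?mid"
    by (rule sturm_rigid[OF \<open>p > 1\<close>, of Q c d])
      (use W V \<open>c < d\<close> in \<open>auto simp: nodal_def intro: eventually_cocountableI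
        singular_left_imp_subsingular_left singular_right_imp_subsingular_right\<close>)
  then show ?thesis
    by (simp add: field_simps)
qed

lemma nodal_le_of_upcrossing:
  assumes "p > 1" and A: "nodal p QA a b A" and B: "nodal p QB a b B"
    and "upcrossing a b QA QB" and x: "x \<in> {a<..<b}"
  shows "B x \<le> A x"
proof -
  obtain e where e: "e \<in> {a..b}" "\<forall>\<^sub>F x in cocountable {a<..<e}. QA x \<le> QB x"
    "\<forall>\<^sub>F x in cocountable {e<..<b}. QB x \<le> QA x"
    using assms(4) by (auto simp: upcrossing_def)
  have ric: "riccati p QA c d A" "riccati p QB c d B" if "a \<le> c" "d \<le> b" for c d
    using A B that by (auto simp: nodal_def intro: riccati_subinterval)
  have left: "B y \<le> A y" if "y \<in> {a<..<e}" for y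
    by (rule sturm_le[OF \<open>p > 1\<close> ric(2,1) e(2) _ _ that])
      (use A B e(1) in \<open>auto simp: nodal_def intro: singular_left_imp_subsingular_left\<close>)
  have right: "B y \<le> A y" if "y \<in> {e<..<b}" for y
    by (rule sturm_le_right[OF \<open>p > 1\<close> ric e(3) _ _ that])
      (use A B e(1) in \<open>auto simp: nodal_def intro: singular_right_imp_subsingular_right\<close>)
  have "\<forall>\<^sub>F y in cocountable {a<..<b}. B y \<le> A y"
    using left right by (intro eventually_cocountable_split[of _ a e b] eventually_cocountableI)
  then show ?thesis
    by (rule le_of_eventually_cocountable_le)
      (use A B x in \<open>auto simp: nodal_def riccati_def\<close>)
qed

section \<open>Comparison of half nodal intervals\<close>

text \<open>Convexity of \<open>\<bar>w\<bar> powr q\<close> enters here: the secant slope of the pair \<open>A1, B1\<close> dominates that of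
  \<open>A2, B2\<close>, so that \<open>A1 - B1 - k * (A2 - B2)\<close> satisfies a linear differential inequality.\<close>

locale half_nodal_pair =
  fixes p k a b \<alpha> \<beta> :: real and QA1 QB1 QA2 QB2 A1 B1 A2 B2 :: "real \<Rightarrow> real"
  assumes p: "p > 1" and k: "k > 0" and a_less_b: "a < b"
    and half_A1: "half_nodal p QA1 a b \<alpha> A1" and half_B1: "half_nodal p QB1 a b \<beta> B1"
    and nodal_A2: "nodal p QA2 a b A2" and nodal_B2: "nodal p QB2 a b B2"
    and B2_le_A2: "\<And>x. x \<in> {a<..<b} \<Longrightarrow> B2 x \<le> A2 x"
    and QA_le: "\<forall>\<^sub>F x in cocountable {a<..<b}. QA1 x \<le> QA2 x"
    and QB_less: "\<forall>\<^sub>F x in cocountable {a<..<b}. QB1 x < QB2 x"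
    and excess: "\<forall>\<^sub>F x in cocountable {a<..<b}. k * (QA2 x - QB2 x) \<le> QA1 x - QB1 x"
begin

lemmas q = conjugate_exponent(1)[OF p]

lemma riccati_equations:
  "riccati p QA1 a b A1" "riccati p QB1 a b B1" "riccati p QA2 a b A2" "riccati p QB2 a b B2"
  using half_A1 half_B1 nodal_A2 nodal_B2 by (simp_all add: half_nodal_def nodal_def)

lemma singularities:
  "singular_left p a A1" "singular_left p a B1" "singular_left p a A2" "singular_left p a B2"
  "singular_right p b A2" "singular_right p b B2"
  using half_A1 half_B1 nodal_A2 nodal_B2 by (simp_all add: half_nodal_def nodal_def)

definition diff :: "real \<Rightarrow> real" where
  "diff x = A1 x - B1 x - k * (A2 x - B2 x)"

definition slope1 :: "real \<Rightarrow> real" where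
  "slope1 x = abs_powr_secant (conjugate p) (A1 x) (B1 x)"

definition slope2 :: "real \<Rightarrow> real" where
  "slope2 x = abs_powr_secant (conjugate p) (A2 x) (B2 x)"

lemma slope2_less_slope1:
  assumes "x \<in> {a<..<b}"
  shows "slope2 x < slope1 x"
proof -
  have "A2 x \<le> A1 x"
    by (rule sturm_le[OF p riccati_equations(3,1) QA_le])
      (use singularities assms in \<open>auto intro: singular_left_imp_subsingular_left\<close>)
  moreover have "B2 x < B1 x"
    by (rule sturm_less[OF p riccati_equations(4,2) QB_less])
      (use singularities assms in \<open>auto intro: singular_left_imp_subsingular_left\<close>)
  ultimately show ?thesis
    unfolding slope1_def slope2_def by (rule abs_powr_secant_strict_mono[OF q])
qed

lemma continuous_on_diff: "continuous_on {a<..<b} diff"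
  unfolding diff_def by (intro continuous_intros riccati_equations[THEN riccatiD(1)])

definition source :: "real \<Rightarrow> real" where
  "source x = QA1 x - QB1 x - k * (QA2 x - QB2 x) + (slope1 x - slope2 x) * (k * (A2 x - B2 x))"

lemma source_nonneg: "\<forall>\<^sub>F x in cocountable {a<..<b}. 0 \<le> source x"
  using excess eventually_in_cocountable
proof eventually_elim
  case (elim x)
  then have "0 \<le> (slope1 x - slope2 x) * (k * (A2 x - B2 x))"
    using slope2_less_slope1[of x] B2_le_A2[of x] k by simp
  with elim(1) show ?case
    by (simp add: source_def)
qed

lemma diff_deriv:
  "\<forall>\<^sub>F x in cocountable {a<..<b}.
     (diff has_real_derivative - (p - 1) * (source x + slope1 x * diff x)) (at x)"
  using riccati_diff_deriv[OF p riccati_equations(1,2)] riccati_diff_deriv[OF p riccati_equations(3,4)]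
proof eventually_elim
  case (elim x)
  have "((\<lambda>x. A1 x - B1 x - k * (A2 x - B2 x)) has_real_derivative
      - (p - 1) * (QA1 x - QB1 x + slope1 x * (A1 x - B1 x)) -
      k * (- (p - 1) * (QA2 x - QB2 x + slope2 x * (A2 x - B2 x)))) (at x)"
    using DERIV_diff[OF elim(1) DERIV_cmult[OF elim(2), of k]] by (simp add: slope1_def slope2_def)
  then show ?case
    by (simp add: diff_def[abs_def] source_def algebra_simps)
qed

lemma diff_deriv_le:
  "\<forall>\<^sub>F x in cocountable {a<..<b}.
     \<exists>D'\<le>- ((p - 1) * slope1 x) * diff x. (diff has_real_derivative D') (at x)"
  using diff_deriv source_nonneg
proof eventually_elim
  case (elim x)
  have "0 \<le> (p - 1) * source x"
    using elim(2) p by simp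
  then have "- (p - 1) * (source x + slope1 x * diff x) \<le> - ((p - 1) * slope1 x) * diff x"
    by (simp add: algebra_simps)
  with elim(1) show ?case
    by blast
qed

lemma diff_tendsto_left: "(diff \<longlongrightarrow> 0) (at_right a)"
proof -
  let ?s = "\<lambda>x. (x - a) powr (1 - p)"
  have "((\<lambda>x. (A1 x - ?s x) - (B1 x - ?s x) - k * ((A2 x - ?s x) - (B2 x - ?s x))) \<longlongrightarrow>
      0 - 0 - k * (0 - 0)) (at_right a)"
    using singularities by (intro tendsto_intros) (simp_all add: singular_left_def)
  then show ?thesis
    by (simp add: diff_def[abs_def])
qed

lemma diff_tendsto_right: "(diff \<longlongrightarrow> \<alpha> - \<beta>) (at_left b)"
proof -
  let ?s = "\<lambda>x. (b - x) powr (1 - p)"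
  have "((\<lambda>x. A1 x - B1 x - k * ((A2 x + ?s x) - (B2 x + ?s x))) \<longlongrightarrow>
      \<alpha> - \<beta> - k * (0 - 0)) (at_left b)"
    using half_A1 half_B1 singularities by (intro tendsto_intros) (simp_all add: half_nodal_def singular_right_def)
  then show ?thesis
    by (simp add: diff_def[abs_def])
qed

lemma diff_nonpos:
  assumes "x \<in> {a<..<b}"
  shows "diff x \<le> 0"
proof -
  have "\<forall>\<^sub>F y in at_right a. 0 \<le> B1 y"
    using singular_left_at_top[OF p singularities(2)] by (auto simp: filterlim_at_top)
  then obtain m where m: "\<And>y. y \<in> {a<..x} \<Longrightarrow> m \<le> B1 y"
    using continuous_on_bounded_below_left[OF riccatiD(1)[OF riccati_equations(2)] _ assms] by blast
  show ?thesis
  proof (rule linear_decay_nonpos[OF continuous_on_diff _ assms])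
    show "\<forall>\<^sub>F x in cocountable {a<..<b}. 0 < diff x \<longrightarrow>
        (\<exists>D'\<le>- ((p - 1) * slope1 x) * diff x. (diff has_real_derivative D') (at x))"
      using diff_deriv_le by eventually_elim simp
    show "(p - 1) * (conjugate p * signed_pow (conjugate p) m) \<le> (p - 1) * slope1 y"
      if y: "y \<in> {a<..x}" and "0 < diff y" for y
    proof -
      have "0 \<le> k * (A2 y - B2 y)"
        using B2_le_A2[of y] y assms k by auto
      then have "m \<le> A1 y"
        using m[OF y] \<open>0 < diff y\<close> by (simp add: diff_def)
      then show ?thesis
        unfolding slope1_def using m[OF y] p by (intro mult_left_mono abs_powr_secant_ge q) auto
    qed
    show "\<forall>\<^sub>F y in at_right a. diff y < e" if "e > 0" for e
      using order_tendstoD(2)[OF diff_tendsto_left that] .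
  qed
qed

lemma limit_le: "\<alpha> \<le> \<beta>"
proof -
  have "\<forall>\<^sub>F x in at_left b. diff x \<le> 0"
    using diff_nonpos a_less_b by (intro eventually_at_leftI[of a]) auto
  from tendsto_upperbound[OF diff_tendsto_right this] show ?thesis
    by simp
qed

lemma diff_eq_0:
  assumes "\<alpha> = \<beta>" and x: "x \<in> {a<..<b}"
  shows "diff x = 0"
proof -
  have lim: "(A1 \<longlongrightarrow> \<alpha>) (at_left b)" "(B1 \<longlongrightarrow> \<alpha>) (at_left b)"
    using half_A1 half_B1 assms(1) by (auto simp: half_nodal_def)
  have "\<forall>\<^sub>F y in at_left b. A1 y < \<alpha> + 1" "\<forall>\<^sub>F y in at_left b. B1 y < \<alpha> + 1"
    using lim by (auto intro: order_tendstoD)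
  then have "\<forall>\<^sub>F y in at_left b. max (A1 y) (B1 y) \<le> \<alpha> + 1"
    by eventually_elim simp
  moreover have "continuous_on {a<..<b} (\<lambda>y. max (A1 y) (B1 y))"
    by (intro continuous_on_max riccati_equations[THEN riccatiD(1)])
  ultimately obtain m where m: "\<And>y. y \<in> {x..<b} \<Longrightarrow> max (A1 y) (B1 y) \<le> m"
    using continuous_on_bounded_above_right x by blast
  show ?thesis
  proof (rule linear_decay_eq_0[OF continuous_on_diff diff_deriv_le diff_nonpos x])
    show "(p - 1) * slope1 y \<le> (p - 1) * (conjugate p * signed_pow (conjugate p) m)"
      if "y \<in> {x..<b}" for y
      unfolding slope1_def using m[OF that] p by (intro mult_left_mono abs_powr_secant_le q) auto
  qed (use diff_tendsto_right assms(1) in auto)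
qed

lemma potentials_eq:
  assumes "\<alpha> = \<beta>"
  shows "\<forall>\<^sub>F x in cocountable {a<..<b}. QA2 x = QB2 x \<and> QA1 x = QB1 x"
proof -
  have zero: "\<forall>\<^sub>F x in cocountable {a<..<b}. QA1 x - QB1 x = k * (QA2 x - QB2 x) \<and> A2 x = B2 x"
    using diff_deriv excess eventually_in_cocountable
  proof eventually_elim
    case (elim x)
    have "(diff has_real_derivative 0) (at x)"
      by (rule has_field_derivative_transform_within_open[OF DERIV_const open_greaterThanLessThan elim(3)])
        (simp add: diff_eq_0[OF assms])
    from DERIV_unique[OF elim(1) this] have "source x = 0"
      using p diff_eq_0[OF assms elim(3)] by simp
    moreover have "0 \<le> (slope1 x - slope2 x) * (k * (A2 x - B2 x))"
      using slope2_less_slope1[OF elim(3)] B2_le_A2[OF elim(3)] k by simp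
    ultimately have "QA1 x - QB1 x - k * (QA2 x - QB2 x) = 0"
      "(slope1 x - slope2 x) * (k * (A2 x - B2 x)) = 0"
      using elim(2) unfolding source_def by linarith+
    then show ?case
      using slope2_less_slope1[OF elim(3)] k by auto
  qed
  have A2_le_B2: "A2 x \<le> B2 x" if "x \<in> {a<..<b}" for x
  proof (rule le_of_eventually_cocountable_le[OF _ _ _ that])
    show "\<forall>\<^sub>F x in cocountable {a<..<b}. A2 x \<le> B2 x"
      using zero by eventually_elim simp
  qed (intro riccati_equations[THEN riccatiD(1)])+
  have "\<forall>\<^sub>F x in cocountable {a<..<b}. QA2 x = QB2 x"
    by (rule riccati_eq_imp_potential_eq[OF p riccati_equations(3,4)])
      (use A2_le_B2 B2_le_A2 in \<open>auto intro: antisym\<close>)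
  with zero show ?thesis
    by eventually_elim simp
qed

end

lemma half_nodal_le_of_upcrossing:
  fixes \<rho> \<sigma> :: "real \<Rightarrow> real"
  assumes "p > 1" "a < b" and ev: "0 < \<nu>" "\<nu> \<le> \<mu>" "\<mu> \<le> \<kappa>" "\<nu> < \<kappa>"
    and half_A1: "half_nodal p (\<lambda>x. \<mu> * \<rho> x) a b \<alpha> A1" and half_B1: "half_nodal p (\<lambda>x. \<nu> * \<sigma> x) a b \<beta> B1"
    and nodal_A2: "nodal p (\<lambda>x. \<kappa> * \<rho> x) a b A2" and nodal_B2: "nodal p (\<lambda>x. \<kappa> * \<sigma> x) a b B2"
    and pos: "\<forall>\<^sub>F x in cocountable {a<..<b}. 0 < \<rho> x" "\<forall>\<^sub>F x in cocountable {a<..<b}. 0 < \<sigma> x"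
    and cross: "upcrossing a b \<rho> \<sigma>"
  shows "\<alpha> \<le> \<beta>" and "\<alpha> = \<beta> \<Longrightarrow> \<mu> = \<nu> \<and> (\<forall>\<^sub>F x in cocountable {a<..<b}. \<rho> x = \<sigma> x)"
proof -
  have \<kappa>: "0 < \<kappa>" and \<mu>: "0 < \<mu>"
    using ev by auto
  have "upcrossing a b (\<lambda>x. \<kappa> * \<rho> x) (\<lambda>x. \<kappa> * \<sigma> x)"
    using cross \<kappa> by (simp add: upcrossing_def)
  interpret half_nodal_pair p "\<mu> / \<kappa>" a b \<alpha> \<beta> "\<lambda>x. \<mu> * \<rho> x" "\<lambda>x. \<nu> * \<sigma> x"
    "\<lambda>x. \<kappa> * \<rho> x" "\<lambda>x. \<kappa> * \<sigma> x" A1 B1 A2 B2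
  proof
    show "B2 x \<le> A2 x" if "x \<in> {a<..<b}" for x
      by (rule nodal_le_of_upcrossing) fact+
    show "\<forall>\<^sub>F x in cocountable {a<..<b}. \<mu> * \<rho> x \<le> \<kappa> * \<rho> x"
      using pos(1) by eventually_elim (use ev in simp)
    show "\<forall>\<^sub>F x in cocountable {a<..<b}. \<nu> * \<sigma> x < \<kappa> * \<sigma> x"
      using pos(2) by eventually_elim (use ev in simp)
    show "\<forall>\<^sub>F x in cocountable {a<..<b}. \<mu> / \<kappa> * (\<kappa> * \<rho> x - \<kappa> * \<sigma> x) \<le> \<mu> * \<rho> x - \<nu> * \<sigma> x"
      using pos(2) by eventually_elim (use ev \<kappa> in \<open>simp add: right_diff_distrib\<close>)
  qed (use assms \<kappa> \<mu> in auto)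
  show "\<alpha> \<le> \<beta>"
    by (rule limit_le)
  assume "\<alpha> = \<beta>"
  from potentials_eq[OF this] have eq: "\<forall>\<^sub>F x in cocountable {a<..<b}. \<rho> x = \<sigma> x \<and> \<mu> * \<rho> x = \<nu> * \<sigma> x"
    using \<kappa> by (auto elim: eventually_mono)
  from eventually_conj[OF this pos(1)] have "\<mu> = \<nu>"
    using \<open>a < b\<close> by (auto elim: eventually_cocountable_obtains)
  moreover have "\<forall>\<^sub>F x in cocountable {a<..<b}. \<rho> x = \<sigma> x"
    using eq by eventually_elim simp
  ultimately show "\<mu> = \<nu> \<and> (\<forall>\<^sub>F x in cocountable {a<..<b}. \<rho> x = \<sigma> x)" ..
qed

section \<open>From solutions to Riccati functions\<close>

definition regular_solution ::
    "real \<Rightarrow> (real \<Rightarrow> real) \<Rightarrow> real \<Rightarrow> real \<Rightarrow> (real \<Rightarrow> real) \<Rightarrow> (real \<Rightarrow> real) \<Rightarrow> bool" where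
  "regular_solution p Q a b y \<phi> \<longleftrightarrow>
     (\<forall>x\<in>{a..b}. (y has_real_derivative signed_pow (conjugate p) (\<phi> x)) (at x within {a..b})) \<and>
     continuous_on {a..b} \<phi> \<and>
     (\<forall>\<^sub>F x in cocountable {a<..<b}. (\<phi> has_real_derivative - (p - 1) * Q x * signed_pow p (y x)) (at x))"

lemma regular_solutionD:
  assumes "regular_solution p Q a b y \<phi>"
  shows "\<And>x. x \<in> {a..b} \<Longrightarrow> (y has_real_derivative signed_pow (conjugate p) (\<phi> x)) (at x within {a..b})"
    and "\<And>x. x \<in> {a<..<b} \<Longrightarrow> (y has_real_derivative signed_pow (conjugate p) (\<phi> x)) (at x)"
    and "continuous_on {a..b} \<phi>" "continuous_on {a..b} y"
    and "\<forall>\<^sub>F x in cocountable {a<..<b}. (\<phi> has_real_derivative - (p - 1) * Q x * signed_pow p (y x)) (at x)"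
proof -
  show deriv: "(y has_real_derivative signed_pow (conjugate p) (\<phi> x)) (at x within {a..b})"
    if "x \<in> {a..b}" for x
    using assms that by (auto simp: regular_solution_def)
  show "(y has_real_derivative signed_pow (conjugate p) (\<phi> x)) (at x)" if "x \<in> {a<..<b}" for x
    using deriv[of x] that at_within_Icc_at[of a x b] by auto
  show "continuous_on {a..b} y"
    using deriv by (meson DERIV_continuous continuous_on_eq_continuous_within)
qed (use assms in \<open>auto simp: regular_solution_def\<close>)

lemma regular_solution_affine:
  assumes "p > 1" and sol: "regular_solution p Q a b y \<phi>" and "s \<noteq> 0"
    and maps: "\<And>x. x \<in> {c..d} \<Longrightarrow> r + s * x \<in> {a..b}"
  shows "regular_solution p (\<lambda>x. \<bar>s\<bar> powr p * Q (r + s * x)) c d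
    (\<lambda>x. y (r + s * x)) (\<lambda>x. signed_pow p s * \<phi> (r + s * x))"
  unfolding regular_solution_def
proof (intro conjI ballI)
  have affine: "((\<lambda>x. r + s * x) has_real_derivative s) (at x within S)" for x S
    by (auto intro!: derivative_eq_intros)
  have maps_subset: "(\<lambda>x. r + s * x) ` {c..d} \<subseteq> {a..b}"
    using maps by blast
  have interior: "(\<lambda>x. r + s * x) ` {c<..<d} \<subseteq> {a<..<b}"
  proof safe
    fix x assume "x \<in> {c<..<d}"
    then have "s * c < s * x \<and> s * x < s * d \<or> s * d < s * x \<and> s * x < s * c"
      using \<open>s \<noteq> 0\<close> by (cases "s > 0") auto
    then show "r + s * x \<in> {a<..<b}"
      using maps[of c] maps[of d] \<open>x \<in> {c<..<d}\<close> by auto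
  qed
  show "((\<lambda>x. y (r + s * x)) has_real_derivative
      signed_pow (conjugate p) (signed_pow p s * \<phi> (r + s * x))) (at x within {c..d})" if "x \<in> {c..d}" for x
  proof -
    have "(y has_real_derivative signed_pow (conjugate p) (\<phi> (r + s * x)))
        (at (r + s * x) within (\<lambda>x. r + s * x) ` {c..d})"
      by (rule DERIV_subset[OF regular_solutionD(1)[OF sol maps[OF that]] maps_subset])
    from DERIV_image_chain[OF this affine] show ?thesis
      using signed_pow_signed_pow[OF conjugate_exponent(3)[OF \<open>p > 1\<close>], of s]
      by (simp add: o_def signed_pow_mult mult.commute)
  qed
  show "continuous_on {c..d} (\<lambda>x. signed_pow p s * \<phi> (r + s * x))"
    using maps_subset
    by (intro continuous_on_mult_left continuous_on_compose2[OF regular_solutionD(3)[OF sol]] continuous_intros)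
  have "\<forall>\<^sub>F x in cocountable ((\<lambda>x. r + s * x) ` {c<..<d}).
      (\<phi> has_real_derivative - (p - 1) * Q x * signed_pow p (y x)) (at x)"
    using regular_solutionD(5)[OF sol] by (rule eventually_cocountable_subset[OF _ interior])
  then have "\<forall>\<^sub>F x in cocountable {c<..<d}. (\<phi> has_real_derivative
      - (p - 1) * Q (r + s * x) * signed_pow p (y (r + s * x))) (at (r + s * x))"
    using \<open>s \<noteq> 0\<close> by (subst (asm) eventually_cocountable_image) (auto simp: inj_on_def)
  then show "\<forall>\<^sub>F x in cocountable {c<..<d}. ((\<lambda>x. signed_pow p s * \<phi> (r + s * x)) has_real_derivative
      - (p - 1) * (\<bar>s\<bar> powr p * Q (r + s * x)) * signed_pow p (y (r + s * x))) (at x)"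
  proof eventually_elim
    case (elim x)
    from DERIV_cmult[OF DERIV_chain2[OF elim affine], of "signed_pow p s"] show ?case
      by (simp add: mult_signed_pow[symmetric] mult_ac)
  qed
qed

lemma regular_solution_subinterval:
  assumes "p > 1" "regular_solution p Q a b y \<phi>" "a \<le> c" "d \<le> b"
  shows "regular_solution p Q c d y \<phi>"
  using regular_solution_affine[OF assms(1,2), of 1 c d 0] assms(3,4) by (simp add: signed_pow_of_nonneg)

lemma regular_solution_reflect:
  assumes "p > 1" "regular_solution p Q a b y \<phi>"
  shows "regular_solution p (\<lambda>x. Q (r - x)) (r - b) (r - a) (\<lambda>x. y (r - x)) (\<lambda>x. - \<phi> (r - x))"
  using regular_solution_affine[OF assms, of "- 1" "r - b" "r - a" r] by (simp add: signed_pow_of_nonneg)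

lemma regular_solution_energy_deriv:
  assumes "p > 1" and sol: "regular_solution p Q a b y \<phi>"
  shows "\<forall>\<^sub>F x in cocountable {a<..<b}. ((\<lambda>x. \<bar>y x\<bar> powr p + \<bar>\<phi> x\<bar> powr conjugate p) has_real_derivative
    p * ((1 - Q x) * (signed_pow p (y x) * signed_pow (conjugate p) (\<phi> x)))) (at x)"
  using regular_solutionD(5)[OF sol] eventually_in_cocountable
proof eventually_elim
  case (elim x)
  let ?q = "conjugate p"
  have "((\<lambda>x. \<bar>y x\<bar> powr p + \<bar>\<phi> x\<bar> powr ?q) has_real_derivative
      p * signed_pow p (y x) * signed_pow ?q (\<phi> x) +
      ?q * signed_pow ?q (\<phi> x) * (- (p - 1) * Q x * signed_pow p (y x))) (at x)"
    using elim(2)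
    by (intro DERIV_add DERIV_chain2[OF has_real_derivative_abs_powr[OF \<open>p > 1\<close>] regular_solutionD(2)[OF sol]]
        DERIV_chain2[OF has_real_derivative_abs_powr[OF conjugate_exponent(1)[OF \<open>p > 1\<close>]] elim(1)])
  also have "p * signed_pow p (y x) * signed_pow ?q (\<phi> x) +
      ?q * signed_pow ?q (\<phi> x) * (- (p - 1) * Q x * signed_pow p (y x)) =
      p * ((1 - Q x) * (signed_pow p (y x) * signed_pow ?q (\<phi> x)))"
    using \<open>p > 1\<close> by (simp add: field_simps)
  finally show ?case .
qed

lemma regular_solution_eq_0_right:
  assumes "p > 1" and sol: "regular_solution p Q a b y \<phi>"
    and Q: "\<forall>\<^sub>F x in cocountable {a<..<b}. \<bar>Q x\<bar> \<le> C"
    and "a \<le> b" "y a = 0" "\<phi> a = 0"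
  shows "y b = 0 \<and> \<phi> b = 0"
proof -
  let ?q = "conjugate p"
  note q = conjugate_exponent[OF \<open>p > 1\<close>]
  define E where "E x = \<bar>y x\<bar> powr p + \<bar>\<phi> x\<bar> powr ?q" for x
  have "E b + 0 / (p * (1 + \<bar>C\<bar>)) \<le>
      exp (p * (1 + \<bar>C\<bar>) * (b - a)) * (max 0 (E a) + 0 / (p * (1 + \<bar>C\<bar>)))"
  proof (rule gronwall[OF \<open>a \<le> b\<close>])
    show "continuous_on {a..b} E"
      unfolding E_def using \<open>p > 1\<close> q(1) regular_solutionD(3,4)[OF sol]
      by (intro continuous_on_add continuous_on_abs_powr)
    show "\<forall>\<^sub>F x in cocountable {a<..<b}. 0 < E x \<longrightarrow>
        (\<exists>d\<le>p * (1 + \<bar>C\<bar>) * E x + 0. (E has_real_derivative d) (at x))"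
      using regular_solution_energy_deriv[OF \<open>p > 1\<close> sol] Q
    proof eventually_elim
      case (elim x)
      let ?s = "signed_pow p (y x) * signed_pow ?q (\<phi> x)"
      have "(1 - Q x) * ?s \<le> \<bar>1 - Q x\<bar> * \<bar>?s\<bar>"
        by (metis abs_ge_self abs_mult)
      also have "\<dots> \<le> (1 + \<bar>C\<bar>) * E x"
        using elim(2) unfolding E_def by (intro mult_mono abs_signed_pow_mult_le \<open>p > 1\<close>) auto
      finally have "p * ((1 - Q x) * ?s) \<le> p * (1 + \<bar>C\<bar>) * E x"
        using \<open>p > 1\<close> mult_left_mono[of _ _ p] by (simp add: mult.assoc)
      with elim(1) show ?case
        unfolding E_def[abs_def] by auto
    qed
  qed (use \<open>p > 1\<close> in auto)
  then have "\<bar>y b\<bar> powr p + \<bar>\<phi> b\<bar> powr ?q \<le> 0"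
    using assms(5,6) by (simp add: E_def)
  moreover have "\<bar>y b\<bar> powr p \<ge> 0" "\<bar>\<phi> b\<bar> powr ?q \<ge> 0"
    by simp_all
  ultimately have "\<bar>y b\<bar> powr p = 0" "\<bar>\<phi> b\<bar> powr ?q = 0"
    by linarith+
  then show ?thesis
    by simp
qed

lemma regular_solution_eq_0:
  assumes "p > 1" and sol: "regular_solution p Q a b y \<phi>"
    and Q: "\<forall>\<^sub>F x in cocountable {a<..<b}. \<bar>Q x\<bar> \<le> C"
    and c: "c \<in> {a..b}" "y c = 0" "\<phi> c = 0" and x: "x \<in> {a..b}"
  shows "y x = 0 \<and> \<phi> x = 0"
proof (cases "c \<le> x")
  case True
  show ?thesis
    by (rule regular_solution_eq_0_right[OF \<open>p > 1\<close> regular_solution_subinterval[OF \<open>p > 1\<close> sol]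
          eventually_cocountable_subset[OF Q]]) (use True c x in auto)
next
  case False
  have "regular_solution p Q x c y \<phi>"
    by (rule regular_solution_subinterval[OF \<open>p > 1\<close> sol]) (use c x in auto)
  note sol' = regular_solution_reflect[OF \<open>p > 1\<close> this, of 0]
  have "\<forall>\<^sub>F x in cocountable {x<..<c}. \<bar>Q x\<bar> \<le> C"
    by (rule eventually_cocountable_subset[OF Q]) (use c x in auto)
  note Q' = eventually_cocountable_reflect[OF this, of 0]
  have "y (0 - (0 - x)) = 0 \<and> - \<phi> (0 - (0 - x)) = 0"
    by (rule regular_solution_eq_0_right[OF \<open>p > 1\<close> sol' Q']) (use False c in auto)
  then show ?thesis
    by simp
qed

lemma regular_solution_ne_0_right:
  assumes sol: "regular_solution p Q a b y \<phi>" and c: "c \<in> {a..<b}" "y c = 0" "\<phi> c \<noteq> 0"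
  obtains \<delta> where "\<delta> > 0" "\<And>x. x \<in> {c<..<c + \<delta>} \<Longrightarrow> x \<le> b \<Longrightarrow> y x \<noteq> 0"
proof -
  let ?l = "signed_pow (conjugate p) (\<phi> c)"
  have deriv: "(y has_real_derivative ?l) (at c within {a..b})"
    using regular_solutionD(1)[OF sol, of c] c(1) by auto
  have "\<exists>\<delta>>0. \<forall>h>0. c + h \<in> {a..b} \<longrightarrow> h < \<delta> \<longrightarrow> y (c + h) \<noteq> 0"
  proof (cases "?l > 0")
    case True
    from has_real_derivative_pos_inc_right[OF deriv True] c(2) show ?thesis
      by fastforce
  next
    case False
    then have "?l < 0"
      using c(3) by (simp add: linorder_neq_iff)
    from has_real_derivative_neg_dec_right[OF deriv this] c(2) show ?thesis
      by fastforce
  qed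
  then obtain \<delta> where \<delta>: "\<delta> > 0" "\<And>h. h > 0 \<Longrightarrow> c + h \<in> {a..b} \<Longrightarrow> h < \<delta> \<Longrightarrow> y (c + h) \<noteq> 0"
    by blast
  have "y x \<noteq> 0" if "x \<in> {c<..<c + \<delta>}" "x \<le> b" for x
    using \<delta>(2)[of "x - c"] that c(1) by auto
  with \<delta>(1) show thesis
    using that by blast
qed

lemma regular_solution_next_zero:
  assumes sol: "regular_solution p Q a b y \<phi>" and c: "c \<in> {a..<b}" "y c = 0" "\<phi> c \<noteq> 0" and "y b = 0"
  obtains d where "d \<in> {c<..b}" "y d = 0" "\<And>x. x \<in> {c<..<d} \<Longrightarrow> y x \<noteq> 0"
proof -
  obtain \<delta> where \<delta>: "\<delta> > 0" and near: "\<And>x. x \<in> {c<..<c + \<delta>} \<Longrightarrow> x \<le> b \<Longrightarrow> y x \<noteq> 0"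
    using regular_solution_ne_0_right[OF sol c] by blast
  define T where "T = {x \<in> {c + \<delta>..b}. y x = 0}"
  have "b \<in> T"
    using near[of b] c(1) \<open>y b = 0\<close> by (auto simp: T_def not_less[symmetric])
  have "continuous_on {c + \<delta>..b} y"
    by (rule continuous_on_subset[OF regular_solutionD(4)[OF sol]]) (use c(1) \<delta> in auto)
  then have "closed T"
    unfolding T_def using continuous_closed_preimage[of "{c + \<delta>..b}" y "{0}"]
    by (simp add: vimage_def Int_def)
  moreover have bdd: "bdd_below T"
    by (rule bdd_belowI[of _ "c + \<delta>"]) (simp add: T_def)
  ultimately have Inf: "Inf T \<in> T"
    using closed_contains_Inf \<open>b \<in> T\<close> by blast
  show thesis
  proof (rule that)
    show "Inf T \<in> {c<..b}" "y (Inf T) = 0"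
      using Inf \<delta> by (auto simp: T_def)
    show "y x \<noteq> 0" if x: "x \<in> {c<..<Inf T}" for x
    proof (cases "x < c + \<delta>")
      case True
      then show ?thesis
        using near[of x] x Inf by (auto simp: T_def)
    next
      case False
      have "x \<notin> T"
        using cInf_lower[OF _ bdd, of x] x by auto
      then show ?thesis
        using False x Inf by (auto simp: T_def)
    qed
  qed
qed

lemma regular_solution_riccati:
  assumes "p > 1" and sol: "regular_solution p Q a b y \<phi>" and sub: "a \<le> c" "d \<le> b"
    and nz: "\<And>x. x \<in> {c<..<d} \<Longrightarrow> y x \<noteq> 0"
  shows "riccati p Q c d (\<lambda>x. \<phi> x / signed_pow p (y x))"
  unfolding riccati_def
proof
  let ?q = "conjugate p"
  have Icc: "{c<..<d} \<subseteq> {a..b}" and Ioo: "{c<..<d} \<subseteq> {a<..<b}"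
    using sub by auto
  show "continuous_on {c<..<d} (\<lambda>x. \<phi> x / signed_pow p (y x))"
    using \<open>p > 1\<close> nz
    by (intro continuous_intros continuous_on_subset[OF regular_solutionD(3)[OF sol] Icc]
        continuous_on_subset[OF regular_solutionD(4)[OF sol] Icc]) auto
  have "\<forall>\<^sub>F x in cocountable {c<..<d}. (\<phi> has_real_derivative - (p - 1) * Q x * signed_pow p (y x)) (at x)"
    by (rule eventually_cocountable_subset[OF regular_solutionD(5)[OF sol] Ioo])
  then show "\<forall>\<^sub>F x in cocountable {c<..<d}. ((\<lambda>x. \<phi> x / signed_pow p (y x)) has_real_derivative
      - (p - 1) * (Q x + \<bar>\<phi> x / signed_pow p (y x)\<bar> powr ?q)) (at x)"
    using eventually_in_cocountable
  proof eventually_elim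
    case (elim x)
    let ?s = "signed_pow p (y x)"
    note y = nz[OF elim(2)]
    have dy: "(y has_real_derivative signed_pow ?q (\<phi> x)) (at x)"
      using elim(2) Ioo by (intro regular_solutionD(2)[OF sol]) auto
    note deriv = DERIV_divide[OF elim(1) DERIV_chain2[OF has_real_derivative_signed_pow[OF y, of p] dy]]
    have W: "\<bar>\<phi> x / ?s\<bar> powr ?q = \<bar>\<phi> x\<bar> powr ?q / \<bar>y x\<bar> powr p"
      using abs_signed_pow_powr[OF conjugate_exponent(2)[OF \<open>p > 1\<close>], of "y x"]
      by (simp add: abs_divide powr_divide)
    have "(- (p - 1) * Q x * ?s * ?s -
        \<phi> x * ((p - 1) * \<bar>y x\<bar> powr (p - 2) * signed_pow ?q (\<phi> x))) / (?s * ?s) =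
        - (p - 1) * Q x - (p - 1) * (\<bar>y x\<bar> powr (p - 2) * (\<phi> x * signed_pow ?q (\<phi> x))) / (?s * ?s)"
      using y by (simp add: field_simps)
    also have "\<dots> = - (p - 1) * (Q x + \<bar>\<phi> x / ?s\<bar> powr ?q)"
      unfolding mult_signed_pow W signed_pow_sq using y by (simp add: field_simps)
    finally show ?case
      using deriv y by simp
  qed
qed

lemma abs_powr_diff_le_of_close:
  fixes p t v :: real
  assumes "p > 1" "t > 0" "\<bar>v - t\<bar> \<le> t / 2"
  shows "\<bar>v powr (1 - p) - t powr (1 - p)\<bar> \<le> (p - 1) * (t / 2) powr (- p) * \<bar>v - t\<bar>"
proof -
  have "((p - 1) * (t / 2) powr (- p))-lipschitz_on {t / 2..2 * t} (\<lambda>u. u powr (1 - p))"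
  proof (rule lipschitz_on_of_bounded_deriv)
    show "continuous_on {t / 2..2 * t} (\<lambda>u. u powr (1 - p))"
      using assms(2) by (intro continuous_intros) auto
    show "\<forall>\<^sub>F u in cocountable {t / 2<..<2 * t}. \<exists>d. \<bar>d\<bar> \<le> (p - 1) * (t / 2) powr (- p) \<and>
        ((\<lambda>u. u powr (1 - p)) has_real_derivative d) (at u)"
    proof (rule eventually_cocountableI)
      fix u assume "u \<in> {t / 2<..<2 * t}"
      then have u: "u > 0" "t / 2 \<le> u"
        using assms(2) by auto
      have "((\<lambda>u. u powr (1 - p)) has_real_derivative (1 - p) * u powr (- p)) (at u)"
        using u has_real_derivative_powr[of u "1 - p"] by (simp add: diff_diff_eq)
      moreover have "\<bar>(1 - p) * u powr (- p)\<bar> \<le> (p - 1) * (t / 2) powr (- p)"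
        using assms(1,2) u by (simp add: abs_mult mult_left_mono powr_mono2')
      ultimately show "\<exists>d. \<bar>d\<bar> \<le> (p - 1) * (t / 2) powr (- p) \<and>
          ((\<lambda>u. u powr (1 - p)) has_real_derivative d) (at u)"
        by blast
    qed
  qed (use assms(1) in simp)
  moreover have "v \<in> {t / 2..2 * t}" "t \<in> {t / 2..2 * t}"
    using assms(2) abs_le_D1[OF assms(3)] abs_le_D2[OF assms(3)] by auto
  ultimately show ?thesis
    using lipschitz_onD by (fastforce simp: dist_real_def)
qed

lemma abs_powr_diff_le_of_higher_order:
  fixes p t v K :: real
  assumes "p > 1" "t > 0" "\<bar>v - t\<bar> \<le> t / 2" "\<bar>v - t\<bar> \<le> K * (2 * t) powr p * t"
  shows "\<bar>v powr (1 - p) - t powr (1 - p)\<bar> \<le> (p - 1) * K * 4 powr p * t"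
proof -
  have "2 * t = 4 * (t / 2)"
    by simp
  then have "(2 * t) powr p = 4 powr p * (t / 2) powr p"
    by (simp only: powr_mult)
  moreover have "(t / 2) powr (- p) * (t / 2) powr p = 1"
    using assms(2) by (simp add: powr_add[symmetric])
  ultimately have powr_eq: "(t / 2) powr (- p) * (2 * t) powr p = 4 powr p"
    by (simp only: mult.left_commute)
  have "\<bar>v powr (1 - p) - t powr (1 - p)\<bar> \<le> (p - 1) * (t / 2) powr (- p) * \<bar>v - t\<bar>"
    by (rule abs_powr_diff_le_of_close[OF assms(1-3)])
  also have "\<dots> \<le> (p - 1) * (t / 2) powr (- p) * (K * (2 * t) powr p * t)"
    using assms by (intro mult_left_mono) auto
  also have "\<dots> = (p - 1) * K * ((t / 2) powr (- p) * (2 * t) powr p) * t"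
    by (simp only: mult_ac)
  finally show ?thesis
    unfolding powr_eq .
qed

lemma powr_tendsto_of_higher_order:
  fixes V :: "real \<Rightarrow> real"
  assumes "p > 1" and close: "\<forall>\<^sub>F x in at_right a. \<bar>V x - (x - a)\<bar> \<le> K * (2 * (x - a)) powr p * (x - a)"
  shows "\<forall>\<^sub>F x in at_right a. V x > 0"
    and "((\<lambda>x. V x powr (1 - p) - (x - a) powr (1 - p)) \<longlongrightarrow> 0) (at_right a)"
proof -
  have "((\<lambda>x. K * (2 * (x - a)) powr p) \<longlongrightarrow> K * 0 powr p) (at_right a)"
    using \<open>p > 1\<close> by (intro tendsto_intros tendsto_powr') (auto intro!: tendsto_eq_intros simp: eventually_at_filter)
  then have "\<forall>\<^sub>F x in at_right a. K * (2 * (x - a)) powr p < 1 / 2"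
    by (rule order_tendstoD(2)) simp
  moreover have "\<forall>\<^sub>F x in at_right a. a < x"
    by (rule eventually_at_right_less)
  ultimately have half: "\<forall>\<^sub>F x in at_right a. a < x \<and> \<bar>V x - (x - a)\<bar> \<le> (x - a) / 2"
    using close
  proof eventually_elim
    case (elim x)
    have "K * (2 * (x - a)) powr p * (x - a) \<le> 1 / 2 * (x - a)"
      using elim by (intro mult_right_mono) auto
    with elim show ?case
      by linarith
  qed
  then show "\<forall>\<^sub>F x in at_right a. V x > 0"
  proof eventually_elim
    case (elim x)
    have "- (V x - (x - a)) \<le> (x - a) / 2"
      using elim by (intro abs_le_D2) simp
    then show ?case
      using elim by (simp add: field_simps)
  qed
  show "((\<lambda>x. V x powr (1 - p) - (x - a) powr (1 - p)) \<longlongrightarrow> 0) (at_right a)"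
  proof (rule Lim_null_comparison)
    show "\<forall>\<^sub>F x in at_right a. norm (V x powr (1 - p) - (x - a) powr (1 - p)) \<le> (p - 1) * K * 4 powr p * (x - a)"
      using half close
    proof eventually_elim
      case (elim x)
      then show ?case
        using abs_powr_diff_le_of_higher_order[OF \<open>p > 1\<close>, of "x - a" "V x" K] by simp
    qed
    have "((\<lambda>x. (p - 1) * K * 4 powr p * (x - a)) \<longlongrightarrow> (p - 1) * K * 4 powr p * (a - a)) (at_right a)"
      by (intro tendsto_intros)
    then show "((\<lambda>x. (p - 1) * K * 4 powr p * (x - a)) \<longlongrightarrow> 0) (at_right a)"
      by simp
  qed
qed

lemma regular_solution_quotient_deriv:
  assumes "p > 1" and sol: "regular_solution p Q a b y \<phi>"
  defines "V \<equiv> \<lambda>x. y x / signed_pow (conjugate p) (\<phi> x)"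
  shows "\<forall>\<^sub>F x in cocountable {a<..<b}. \<phi> x \<noteq> 0 \<longrightarrow> (V has_real_derivative 1 + Q x * \<bar>V x\<bar> powr p) (at x)"
  using regular_solutionD(5)[OF sol] eventually_in_cocountable
proof eventually_elim
  case (elim x)
  let ?q = "conjugate p" and ?s = "signed_pow (conjugate p) (\<phi> x)"
  note q = conjugate_exponent[OF \<open>p > 1\<close>]
  show ?case
  proof
    assume "\<phi> x \<noteq> 0"
    have V: "\<bar>V x\<bar> powr p = \<bar>y x\<bar> powr p / \<bar>\<phi> x\<bar> powr ?q"
      using abs_signed_pow_powr[of ?q p "\<phi> x"] \<open>p > 1\<close>
      by (simp add: V_def abs_divide powr_divide field_simps)
    have "(?s * ?s - y x * ((?q - 1) * \<bar>\<phi> x\<bar> powr (?q - 2) * (- (p - 1) * Q x * signed_pow p (y x)))) / (?s * ?s) =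
        1 + ((?q - 1) * (p - 1)) * Q x * (\<bar>\<phi> x\<bar> powr (?q - 2) * (y x * signed_pow p (y x))) / (?s * ?s)"
      using \<open>\<phi> x \<noteq> 0\<close> by (simp add: divide_simps) (simp add: algebra_simps)
    also have "\<dots> = 1 + Q x * \<bar>V x\<bar> powr p"
      unfolding mult_signed_pow V signed_pow_sq q(4) using \<open>\<phi> x \<noteq> 0\<close> by simp
    finally show "(V has_real_derivative 1 + Q x * \<bar>V x\<bar> powr p) (at x)"
      using DERIV_divide[OF regular_solutionD(2)[OF sol elim(2)]
          DERIV_chain2[OF has_real_derivative_signed_pow[OF \<open>\<phi> x \<noteq> 0\<close>, of ?q] elim(1)]] \<open>\<phi> x \<noteq> 0\<close>
      unfolding V_def by simp
  qed
qed

lemma regular_solution_quotient_bound: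
  assumes "p > 1" and sol: "regular_solution p Q a b y \<phi>" and "a < b" "y a = 0" "\<phi> a \<noteq> 0"
  defines "V \<equiv> \<lambda>x. y x / signed_pow (conjugate p) (\<phi> x)"
  obtains d where "d \<in> {a<..b}" "\<And>x. x \<in> {a..<d} \<Longrightarrow> \<phi> x \<noteq> 0" "\<And>x. x \<in> {a<..<d} \<Longrightarrow> \<bar>V x\<bar> \<le> 2 * (x - a)"
proof -
  let ?q = "conjugate p"
  have at: "at a within {a..b} = at_right a"
    using \<open>a < b\<close> by (rule at_within_Icc_at_right)
  have nz: "signed_pow ?q (\<phi> a) \<noteq> 0"
    using \<open>\<phi> a \<noteq> 0\<close> by simp
  have lim_\<phi>: "(\<phi> \<longlongrightarrow> \<phi> a) (at_right a)"
    by (rule continuous_on_Icc_at_rightD[OF regular_solutionD(3)[OF sol] \<open>a < b\<close>])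
  have lim_s: "((\<lambda>x. signed_pow ?q (\<phi> x)) \<longlongrightarrow> signed_pow ?q (\<phi> a)) (at_right a)"
    by (rule isCont_tendsto_compose[OF isCont_signed_pow[OF conjugate_exponent(1)[OF \<open>p > 1\<close>]] lim_\<phi>])
  have "((\<lambda>x. (y x - y a) / (x - a)) \<longlongrightarrow> signed_pow ?q (\<phi> a)) (at_right a)"
    using regular_solutionD(1)[OF sol, of a] \<open>a < b\<close> unfolding has_field_derivative_iff by (simp add: at)
  from tendsto_divide[OF this lim_s nz] have "((\<lambda>x. V x / (x - a)) \<longlongrightarrow> 1) (at_right a)"
    using nz by (simp add: V_def \<open>y a = 0\<close> mult.commute)
  then have "\<forall>\<^sub>F x in at_right a. \<bar>V x / (x - a)\<bar> < 2"
    by (intro order_tendstoD(2)[OF tendsto_rabs]) auto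
  moreover have "\<forall>\<^sub>F x in at_right a. \<phi> x \<noteq> 0"
    by (rule tendsto_imp_eventually_ne[OF lim_\<phi> \<open>\<phi> a \<noteq> 0\<close>])
  ultimately have "\<forall>\<^sub>F x in at_right a. \<bar>V x / (x - a)\<bar> < 2 \<and> \<phi> x \<noteq> 0"
    by (rule eventually_conj)
  then obtain d where d: "d > a" "\<And>x. a < x \<Longrightarrow> x < d \<Longrightarrow> \<bar>V x / (x - a)\<bar> < 2 \<and> \<phi> x \<noteq> 0"
    unfolding eventually_at_right_field by blast
  show thesis
  proof (rule that[of "min d b"])
    show "min d b \<in> {a<..b}"
      using d(1) \<open>a < b\<close> by auto
    show "\<phi> x \<noteq> 0" if "x \<in> {a..<min d b}" for x
      using d(2)[of x] \<open>\<phi> a \<noteq> 0\<close> that by (cases "x = a") auto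
    show "\<bar>V x\<bar> \<le> 2 * (x - a)" if "x \<in> {a<..<min d b}" for x
      using d(2)[of x] that by (auto simp: abs_divide divide_less_eq)
  qed
qed

lemma regular_solution_quotient_lipschitz_on:
  assumes "p > 1" and sol: "regular_solution p Q a b y \<phi>"
    and Q: "\<forall>\<^sub>F x in cocountable {a<..<b}. \<bar>Q x\<bar> \<le> C" and "x \<le> b"
  defines "V \<equiv> \<lambda>x. y x / signed_pow (conjugate p) (\<phi> x)"
  assumes nz: "\<And>u. u \<in> {a..x} \<Longrightarrow> \<phi> u \<noteq> 0" and V_le: "\<And>u. u \<in> {a<..<x} \<Longrightarrow> \<bar>V u\<bar> \<le> r"
  shows "(\<bar>C\<bar> * r powr p)-lipschitz_on {a..x} (\<lambda>u. V u - u)"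
proof (rule lipschitz_on_of_bounded_deriv)
  have sub: "{a..x} \<subseteq> {a..b}" "{a<..<x} \<subseteq> {a<..<b}"
    using \<open>x \<le> b\<close> by auto
  show "continuous_on {a..x} (\<lambda>u. V u - u)"
    unfolding V_def using nz \<open>p > 1\<close> conjugate_exponent(1)[OF \<open>p > 1\<close>]
    by (intro continuous_intros continuous_on_subset[OF regular_solutionD(3)[OF sol] sub(1)]
        continuous_on_subset[OF regular_solutionD(4)[OF sol] sub(1)]) auto
  have "\<forall>\<^sub>F u in cocountable {a<..<b}. \<bar>Q u\<bar> \<le> C \<and>
      (\<phi> u \<noteq> 0 \<longrightarrow> (V has_real_derivative 1 + Q u * \<bar>V u\<bar> powr p) (at u))"
    using Q regular_solution_quotient_deriv[OF \<open>p > 1\<close> sol] unfolding V_def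
    by (rule eventually_conj)
  then show "\<forall>\<^sub>F u in cocountable {a<..<x}. \<exists>e. \<bar>e\<bar> \<le> \<bar>C\<bar> * r powr p \<and>
      ((\<lambda>u. V u - u) has_real_derivative e) (at u)"
  proof (rule eventually_cocountable_subset[OF _ sub(2)])
    fix u assume u: "u \<in> {a<..<x}" and "\<bar>Q u\<bar> \<le> C \<and>
      (\<phi> u \<noteq> 0 \<longrightarrow> (V has_real_derivative 1 + Q u * \<bar>V u\<bar> powr p) (at u))"
    then have "\<bar>Q u\<bar> \<le> \<bar>C\<bar>" and deriv: "(V has_real_derivative 1 + Q u * \<bar>V u\<bar> powr p) (at u)"
      using nz[of u] by auto
    moreover have "\<bar>V u\<bar> powr p \<le> r powr p"
      using V_le[OF u] \<open>p > 1\<close> by (intro powr_mono2) auto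
    ultimately have "\<bar>Q u * \<bar>V u\<bar> powr p\<bar> \<le> \<bar>C\<bar> * r powr p"
      by (simp add: abs_mult mult_mono)
    moreover have "((\<lambda>u. V u - u) has_real_derivative Q u * \<bar>V u\<bar> powr p) (at u)"
      using DERIV_diff[OF deriv DERIV_ident] by simp
    ultimately show "\<exists>e. \<bar>e\<bar> \<le> \<bar>C\<bar> * r powr p \<and> ((\<lambda>u. V u - u) has_real_derivative e) (at u)"
      by blast
  qed
qed simp

lemma regular_solution_quotient_asymptotics:
  assumes "p > 1" and sol: "regular_solution p Q a b y \<phi>"
    and Q: "\<forall>\<^sub>F x in cocountable {a<..<b}. \<bar>Q x\<bar> \<le> C" and zero: "a < b" "y a = 0" "\<phi> a \<noteq> 0"
  defines "V \<equiv> \<lambda>x. y x / signed_pow (conjugate p) (\<phi> x)"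
  shows "\<forall>\<^sub>F x in at_right a. \<bar>V x - (x - a)\<bar> \<le> \<bar>C\<bar> * (2 * (x - a)) powr p * (x - a)"
proof -
  obtain d where d: "d \<in> {a<..b}" and nz: "\<And>x. x \<in> {a..<d} \<Longrightarrow> \<phi> x \<noteq> 0"
    and V_le: "\<And>x. x \<in> {a<..<d} \<Longrightarrow> \<bar>V x\<bar> \<le> 2 * (x - a)"
    using regular_solution_quotient_bound[OF \<open>p > 1\<close> sol zero] unfolding V_def by blast
  have "\<bar>V x - (x - a)\<bar> \<le> \<bar>C\<bar> * (2 * (x - a)) powr p * (x - a)" if x: "x \<in> {a<..<d}" for x
  proof -
    have "\<bar>V u\<bar> \<le> 2 * (x - a)" if "u \<in> {a<..<x}" for u
      using V_le[of u] that x by auto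
    then have "(\<bar>C\<bar> * (2 * (x - a)) powr p)-lipschitz_on {a..x} (\<lambda>u. V u - u)"
      unfolding V_def
      by (intro regular_solution_quotient_lipschitz_on[OF \<open>p > 1\<close> sol Q]) (use x d nz in auto)
    from lipschitz_onD[OF this, of x a]
    have "\<bar>(V x - x) - (V a - a)\<bar> \<le> \<bar>C\<bar> * (2 * (x - a)) powr p * \<bar>x - a\<bar>"
      using x by (simp add: dist_real_def)
    then show ?thesis
      using x \<open>y a = 0\<close> by (simp add: V_def)
  qed
  then show ?thesis
    using d by (intro eventually_at_rightI[of a d]) auto
qed

lemma regular_solution_singular_left:
  assumes "p > 1" and sol: "regular_solution p Q a b y \<phi>"
    and Q: "\<forall>\<^sub>F x in cocountable {a<..<b}. \<bar>Q x\<bar> \<le> C" and zero: "a < b" "y a = 0" "\<phi> a \<noteq> 0"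
  shows "singular_left p a (\<lambda>x. \<phi> x / signed_pow p (y x))"
proof -
  let ?q = "conjugate p"
  define V where "V x = y x / signed_pow ?q (\<phi> x)" for x
  have "\<forall>\<^sub>F x in at_right a. \<bar>V x - (x - a)\<bar> \<le> \<bar>C\<bar> * (2 * (x - a)) powr p * (x - a)"
    using regular_solution_quotient_asymptotics[OF \<open>p > 1\<close> sol Q zero] by (simp add: V_def)
  note V_powr = powr_tendsto_of_higher_order[OF \<open>p > 1\<close> this]
  have "\<forall>\<^sub>F x in at_right a. V x powr (1 - p) - (x - a) powr (1 - p) =
      \<phi> x / signed_pow p (y x) - (x - a) powr (1 - p)"
    using V_powr(1)
  proof eventually_elim
    case (elim x)
    then have "\<phi> x \<noteq> 0" "y x = V x * signed_pow ?q (\<phi> x)"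
      by (auto simp: V_def)
    then have "signed_pow p (y x) = V x powr (p - 1) * \<phi> x"
      using elim signed_pow_signed_pow[OF conjugate_exponent(4)[OF \<open>p > 1\<close>], of "\<phi> x"]
      by (simp add: signed_pow_mult signed_pow_of_nonneg)
    then show ?case
      using \<open>\<phi> x \<noteq> 0\<close> powr_minus_divide[of "V x" "p - 1"] by simp
  qed
  with V_powr(2) show ?thesis
    unfolding singular_left_def by (rule Lim_transform_eventually)
qed

lemma regular_solution_nodal_interval:
  assumes "p > 1" and sol: "regular_solution p Q a b y \<phi>"
    and Q: "\<forall>\<^sub>F x in cocountable {a<..<b}. \<bar>Q x\<bar> \<le> C"
    and cd: "a \<le> c" "c < d" "d \<le> b" "y c = 0" "y d = 0" and nz: "\<And>x. x \<in> {c<..<d} \<Longrightarrow> y x \<noteq> 0"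
  shows "nodal_interval p Q c d"
proof -
  let ?W = "\<lambda>x. \<phi> x / signed_pow p (y x)"
  note sol_cd = regular_solution_subinterval[OF \<open>p > 1\<close> sol cd(1,3)]
  have Q_cd: "\<forall>\<^sub>F x in cocountable {c<..<d}. \<bar>Q x\<bar> \<le> C"
    by (rule eventually_cocountable_subset[OF Q]) (use cd in auto)
  have "y ((c + d) / 2) \<noteq> 0"
    using cd(2) by (intro nz) auto
  then have \<phi>_nz: "\<phi> x \<noteq> 0" if "x \<in> {c..d}" "y x = 0" for x
    using regular_solution_eq_0[OF \<open>p > 1\<close> sol_cd Q_cd that, of "(c + d) / 2"] cd(2) by auto
  have "singular_left p c ?W"
    by (rule regular_solution_singular_left[OF \<open>p > 1\<close> sol_cd Q_cd]) (use cd \<phi>_nz[of c] in auto)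
  moreover have "singular_left p (0 - d) (\<lambda>x. - \<phi> (0 - x) / signed_pow p (y (0 - x)))"
    by (rule regular_solution_singular_left[OF \<open>p > 1\<close> regular_solution_reflect[OF \<open>p > 1\<close> sol_cd]
          eventually_cocountable_reflect[OF Q_cd]]) (use cd \<phi>_nz[of d] in auto)
  then have "singular_right p d ?W"
    using singular_left_reflect_iff[of p 0 d ?W] by simp
  ultimately have "nodal p Q c d ?W"
    using regular_solution_riccati[OF \<open>p > 1\<close> sol cd(1,3) nz] by (simp add: nodal_def)
  with cd(2) show ?thesis
    by (auto simp: nodal_interval_def)
qed

section \<open>Absolutely continuous functions\<close>

definition nonoverlapping_intervals :: "real set \<Rightarrow> 'i set \<Rightarrow> ('i \<Rightarrow> real) \<Rightarrow> ('i \<Rightarrow> real) \<Rightarrow> bool" where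
  "nonoverlapping_intervals S I u v \<longleftrightarrow> finite I \<and> (\<forall>i\<in>I. u i \<le> v i \<and> {u i..v i} \<subseteq> S) \<and>
     disjoint_family_on (\<lambda>i. {u i<..<v i}) I"

lemma nonoverlapping_intervals_subset:
  "nonoverlapping_intervals S I u v \<Longrightarrow> J \<subseteq> I \<Longrightarrow> nonoverlapping_intervals S J u v"
  unfolding nonoverlapping_intervals_def
  by (auto intro: finite_subset disjoint_family_on_mono)

lemma abs_continuous_onE:
  assumes "abs_continuous_on S f" "e > 0"
  obtains \<delta> where "\<delta> > 0" "\<And>(I :: 'i set) u v. nonoverlapping_intervals S I u v \<Longrightarrow>
    (\<Sum>i\<in>I. v i - u i) < \<delta> \<Longrightarrow> (\<Sum>i\<in>I. \<bar>f (v i) - f (u i)\<bar>) < e"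
proof -
  obtain \<delta> where \<delta>: "\<delta> > 0" "\<And>(n::nat) a b. (\<forall>i<n. a i \<le> b i \<and> {a i..b i} \<subseteq> S) \<and>
      disjoint_family_on (\<lambda>i. {a i<..<b i}) {..<n} \<and> (\<Sum>i<n. b i - a i) < \<delta> \<Longrightarrow>
      (\<Sum>i<n. \<bar>f (b i) - f (a i)\<bar>) < e"
    using assms unfolding abs_continuous_on_def by meson
  have "(\<Sum>i\<in>I. \<bar>f (v i) - f (u i)\<bar>) < e"
    if fam: "nonoverlapping_intervals S I u v" and small: "(\<Sum>i\<in>I. v i - u i) < \<delta>" for I :: "'i set" and u v
  proof -
    obtain g where g: "bij_betw g {..<card I} I"
      using fam ex_bij_betw_nat_finite[of I] by (auto simp: nonoverlapping_intervals_def atLeast0LessThan)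
    have "disjoint_family_on (\<lambda>i. {u (g i)<..<v (g i)}) {..<card I}"
      using fam g unfolding nonoverlapping_intervals_def disjoint_family_on_def bij_betw_def inj_on_def
      by (metis image_eqI)
    moreover have "\<forall>i<card I. u (g i) \<le> v (g i) \<and> {u (g i)..v (g i)} \<subseteq> S"
      using fam bij_betwE[OF g] by (auto simp: nonoverlapping_intervals_def)
    ultimately have "(\<Sum>i<card I. \<bar>f (v (g i)) - f (u (g i))\<bar>) < e"
      using small by (intro \<delta>(2)) (simp add: sum.reindex_bij_betw[OF g, of "\<lambda>i. v i - u i"])
    then show ?thesis
      by (simp add: sum.reindex_bij_betw[OF g, of "\<lambda>i. \<bar>f (v i) - f (u i)\<bar>"])
  qed
  with \<delta>(1) show thesis
    using that by blast
qed

lemma abs_continuous_onI: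
  assumes "\<And>e. e > 0 \<Longrightarrow> \<exists>\<delta>>0. \<forall>(I :: nat set) u v. nonoverlapping_intervals S I u v \<longrightarrow>
    (\<Sum>i\<in>I. v i - u i) < \<delta> \<longrightarrow> (\<Sum>i\<in>I. \<bar>f (v i) - f (u i)\<bar>) < e"
  shows "abs_continuous_on S f"
  unfolding abs_continuous_on_def
proof (intro allI impI)
  fix e :: real assume "e > 0"
  from assms[OF this] obtain \<delta> where "\<delta> > 0" "\<And>(I :: nat set) u v. nonoverlapping_intervals S I u v \<Longrightarrow>
      (\<Sum>i\<in>I. v i - u i) < \<delta> \<Longrightarrow> (\<Sum>i\<in>I. \<bar>f (v i) - f (u i)\<bar>) < e"
    by blast
  then show "\<exists>\<delta>>0. \<forall>(n::nat) a b. (\<forall>i<n. a i \<le> b i \<and> {a i..b i} \<subseteq> S) \<and>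
      disjoint_family_on (\<lambda>i. {a i<..<b i}) {..<n} \<and> (\<Sum>i<n. b i - a i) < \<delta> \<longrightarrow>
      (\<Sum>i<n. \<bar>f (b i) - f (a i)\<bar>) < e"
    by (intro exI[of _ \<delta>]) (simp add: nonoverlapping_intervals_def)
qed

lemma lipschitz_on_imp_abs_continuous_on:
  assumes "M-lipschitz_on S f"
  shows "abs_continuous_on S f"
proof (rule abs_continuous_onI)
  fix e :: real assume "e > 0"
  have M: "M \<ge> 0"
    by (rule lipschitz_on_nonneg[OF assms])
  have "(\<Sum>i\<in>I. \<bar>f (v i) - f (u i)\<bar>) < e"
    if fam: "nonoverlapping_intervals S I u v" and small: "(\<Sum>i\<in>I. v i - u i) < e / (M + 1)"
    for I :: "nat set" and u v
  proof -
    have "(\<Sum>i\<in>I. \<bar>f (v i) - f (u i)\<bar>) \<le> (\<Sum>i\<in>I. (M + 1) * (v i - u i))"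
    proof (rule sum_mono)
      fix i assume "i \<in> I"
      then have i: "u i \<le> v i" "u i \<in> S" "v i \<in> S"
        using fam by (auto simp: nonoverlapping_intervals_def subset_eq)
      have "\<bar>f (v i) - f (u i)\<bar> \<le> M * \<bar>v i - u i\<bar>"
        using lipschitz_onD[OF assms i(3,2)] by (simp add: dist_real_def)
      also have "\<dots> \<le> (M + 1) * (v i - u i)"
        using i M by (simp add: mult_right_mono)
      finally show "\<bar>f (v i) - f (u i)\<bar> \<le> (M + 1) * (v i - u i)" .
    qed
    also have "\<dots> = (M + 1) * (\<Sum>i\<in>I. v i - u i)"
      by (simp add: sum_distrib_left)
    also have "\<dots> < e"
      using small M by (simp add: less_divide_eq mult.commute)
    finally show ?thesis .
  qed
  then show "\<exists>\<delta>>0. \<forall>(I :: nat set) u v. nonoverlapping_intervals S I u v \<longrightarrow>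
      (\<Sum>i\<in>I. v i - u i) < \<delta> \<longrightarrow> (\<Sum>i\<in>I. \<bar>f (v i) - f (u i)\<bar>) < e"
    using \<open>e > 0\<close> M by (intro exI[of _ "e / (M + 1)"]) auto
qed

lemma abs_continuous_on_diff:
  assumes "abs_continuous_on S f" "abs_continuous_on S g"
  shows "abs_continuous_on S (\<lambda>x. f x - g x)"
proof (rule abs_continuous_onI)
  fix e :: real assume "e > 0"
  then have "e / 2 > 0"
    by simp
  obtain d1 where d1: "d1 > 0" "\<And>(I :: nat set) u v. nonoverlapping_intervals S I u v \<Longrightarrow>
      (\<Sum>i\<in>I. v i - u i) < d1 \<Longrightarrow> (\<Sum>i\<in>I. \<bar>f (v i) - f (u i)\<bar>) < e / 2"
    using abs_continuous_onE[OF assms(1) \<open>e / 2 > 0\<close>] by blast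
  obtain d2 where d2: "d2 > 0" "\<And>(I :: nat set) u v. nonoverlapping_intervals S I u v \<Longrightarrow>
      (\<Sum>i\<in>I. v i - u i) < d2 \<Longrightarrow> (\<Sum>i\<in>I. \<bar>g (v i) - g (u i)\<bar>) < e / 2"
    using abs_continuous_onE[OF assms(2) \<open>e / 2 > 0\<close>] by blast
  have "(\<Sum>i\<in>I. \<bar>(f (v i) - g (v i)) - (f (u i) - g (u i))\<bar>) < e"
    if "nonoverlapping_intervals S I u v" "(\<Sum>i\<in>I. v i - u i) < min d1 d2" for I :: "nat set" and u v
  proof -
    have "(\<Sum>i\<in>I. \<bar>(f (v i) - g (v i)) - (f (u i) - g (u i))\<bar>) \<le>
        (\<Sum>i\<in>I. \<bar>f (v i) - f (u i)\<bar> + \<bar>g (v i) - g (u i)\<bar>)"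
      by (intro sum_mono) auto
    also have "\<dots> < e"
      using d1(2)[of I u v] d2(2)[of I u v] that by (simp add: sum.distrib)
    finally show ?thesis .
  qed
  then show "\<exists>\<delta>>0. \<forall>(I :: nat set) u v. nonoverlapping_intervals S I u v \<longrightarrow> (\<Sum>i\<in>I. v i - u i) < \<delta> \<longrightarrow>
      (\<Sum>i\<in>I. \<bar>(f (v i) - g (v i)) - (f (u i) - g (u i))\<bar>) < e"
    using d1(1) d2(1) by (intro exI[of _ "min d1 d2"]) simp
qed

lemma abs_continuous_on_subset:
  assumes "abs_continuous_on S f" "T \<subseteq> S"
  shows "abs_continuous_on T f"
  using assms unfolding abs_continuous_on_def by (meson order_trans)

lemma abs_continuous_on_imp_continuous_on:
  assumes "abs_continuous_on {a..b} f"
  shows "continuous_on {a..b} f"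
  unfolding continuous_on_iff
proof (intro ballI allI impI)
  fix x e :: real assume x: "x \<in> {a..b}" and "e > 0"
  obtain d where d: "d > 0" "\<And>(I :: unit set) u v. nonoverlapping_intervals {a..b} I u v \<Longrightarrow>
      (\<Sum>i\<in>I. v i - u i) < d \<Longrightarrow> (\<Sum>i\<in>I. \<bar>f (v i) - f (u i)\<bar>) < e"
    using abs_continuous_onE[OF assms \<open>e > 0\<close>] by blast
  have "dist (f y) (f x) < e" if "y \<in> {a..b}" "dist y x < d" for y
  proof (cases "x \<le> y")
    case True
    then show ?thesis
      using d(2)[of UNIV "\<lambda>_. x" "\<lambda>_. y"] x that
      by (simp add: nonoverlapping_intervals_def disjoint_family_on_def dist_real_def UNIV_unit)
  next
    case False
    then show ?thesis
      using d(2)[of UNIV "\<lambda>_. y" "\<lambda>_. x"] x that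
      by (simp add: nonoverlapping_intervals_def disjoint_family_on_def dist_real_def UNIV_unit
          abs_minus_commute)
  qed
  then show "\<exists>d>0. \<forall>y\<in>{a..b}. dist y x < d \<longrightarrow> dist (f y) (f x) < e"
    using d(1) by blast
qed

lemma nonoverlapping_intervals_sum_le_measure:
  assumes fam: "nonoverlapping_intervals S I u v" and U: "U \<in> lmeasurable" "\<And>i. i \<in> I \<Longrightarrow> {u i<..<v i} \<subseteq> U"
  shows "(\<Sum>i\<in>I. v i - u i) \<le> measure lebesgue U"
proof -
  have "(\<Sum>i\<in>I. v i - u i) = (\<Sum>i\<in>I. measure lebesgue {u i<..<v i})"
    using fam by (intro sum.cong) (auto simp: nonoverlapping_intervals_def)
  also have "\<dots> = measure lebesgue (\<Union>i\<in>I. {u i<..<v i})"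
    using fam by (intro measure_UNION'[symmetric])
      (auto simp: nonoverlapping_intervals_def disjoint_family_on_def pairwise_def disjnt_def)
  also have "\<dots> \<le> measure lebesgue U"
    using U by (intro measure_mono_fmeasurable) (auto intro!: sets.finite_UN simp: assms(1)[unfolded nonoverlapping_intervals_def])
  finally show ?thesis .
qed

lemma null_set_outer_open:
  assumes N: "N \<in> null_sets lebesgue" and "\<delta> > 0"
  obtains U where "open U" "N \<subseteq> U" "U \<in> lmeasurable" "measure lebesgue U < \<delta>"
proof -
  have "N \<in> sets lebesgue"
    using N by auto
  then obtain U where U: "open U" "N \<subseteq> U" "emeasure lebesgue (U - N) < ennreal \<delta>"
    using \<open>\<delta> > 0\<close> by (rule sets_lebesgue_outer_open)
  have U_sets: "U \<in> sets lebesgue"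
    using U(1) by simp
  have less: "emeasure lebesgue U < ennreal \<delta>"
    using U(3) emeasure_Diff_null_set[OF N U_sets] by simp
  then have U_fm: "U \<in> lmeasurable"
    using U_sets order_less_trans[OF less ennreal_less_top] by (intro fmeasurableI) (auto simp: less_top)
  moreover have "measure lebesgue U < \<delta>"
    using less \<open>\<delta> > 0\<close> emeasure_eq_measure2[OF U_fm] by (simp add: ennreal_less_iff)
  ultimately show thesis
    using that U(1,2) by blast
qed

lemma abs_continuous_on_small_near_null_set:
  assumes "abs_continuous_on S f" "N \<in> null_sets lebesgue" "e > 0"
  obtains U where "open U" "N \<subseteq> U" "\<And>(I :: 'i set) u v. nonoverlapping_intervals S I u v \<Longrightarrow>
    (\<And>i. i \<in> I \<Longrightarrow> {u i<..<v i} \<subseteq> U) \<Longrightarrow> (\<Sum>i\<in>I. \<bar>f (v i) - f (u i)\<bar>) < e"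
proof -
  obtain \<delta> where \<delta>: "\<delta> > 0" "\<And>(I :: 'i set) u v. nonoverlapping_intervals S I u v \<Longrightarrow>
      (\<Sum>i\<in>I. v i - u i) < \<delta> \<Longrightarrow> (\<Sum>i\<in>I. \<bar>f (v i) - f (u i)\<bar>) < e"
    using abs_continuous_onE[OF assms(1,3)] by blast
  obtain U where U: "open U" "N \<subseteq> U" "U \<in> lmeasurable" "measure lebesgue U < \<delta>"
    using null_set_outer_open[OF assms(2) \<delta>(1)] .
  have "(\<Sum>i\<in>I. \<bar>f (v i) - f (u i)\<bar>) < e"
    if "nonoverlapping_intervals S I u v" "\<And>i. i \<in> I \<Longrightarrow> {u i<..<v i} \<subseteq> U" for I :: "'i set" and u v
    using nonoverlapping_intervals_sum_le_measure[OF that(1) U(3) that(2)] U(4) by (intro \<delta>(2) that(1)) simp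
  with U(1,2) show thesis
    using that by blast
qed

lemma zero_deriv_straddle:
  fixes h :: "real \<Rightarrow> real"
  assumes "(h has_real_derivative 0) (at x)" "e > 0"
  obtains \<delta> where "\<delta> > 0"
    "\<And>u v. u \<le> x \<Longrightarrow> x \<le> v \<Longrightarrow> u \<in> ball x \<delta> \<Longrightarrow> v \<in> ball x \<delta> \<Longrightarrow> \<bar>h v - h u\<bar> \<le> e * (v - u)"
proof -
  have "(h has_derivative (\<lambda>t. 0 * t)) (at x)"
    using assms(1) unfolding has_field_derivative_def .
  from this[unfolded has_derivative_at_alt, THEN conjunct2, rule_format, OF \<open>e > 0\<close>]
  obtain \<delta> where \<delta>: "\<delta> > 0" "\<And>y. \<bar>y - x\<bar> < \<delta> \<Longrightarrow> \<bar>h y - h x\<bar> \<le> e * \<bar>y - x\<bar>"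
    by auto
  have "\<bar>h v - h u\<bar> \<le> e * (v - u)" if "u \<le> x" "x \<le> v" "u \<in> ball x \<delta>" "v \<in> ball x \<delta>" for u v
    using \<delta>(2)[of u] \<delta>(2)[of v] that by (simp add: dist_real_def algebra_simps)
  with \<delta>(1) show thesis
    using that by blast
qed

lemma tagged_division_of_Icc_element:
  assumes P: "P tagged_division_of {a..b::real}" and "xK \<in> P"
  shows "{Inf (snd xK)..Sup (snd xK)} = snd xK" "Inf (snd xK) \<le> fst xK" "fst xK \<le> Sup (snd xK)"
    "snd xK \<subseteq> {a..b}"
proof -
  have xK: "(fst xK, snd xK) \<in> P"
    using assms(2) by simp
  obtain u v where "snd xK = {u..v}"
    using tagged_division_ofD(4)[OF P xK] by auto
  moreover have "fst xK \<in> snd xK"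
    by (rule tagged_division_ofD(2)[OF P xK])
  ultimately show "{Inf (snd xK)..Sup (snd xK)} = snd xK" "Inf (snd xK) \<le> fst xK" "fst xK \<le> Sup (snd xK)"
    by auto
  show "snd xK \<subseteq> {a..b}"
    by (rule tagged_division_ofD(3)[OF P xK])
qed

lemma tagged_division_of_Icc_nonoverlapping:
  assumes P: "P tagged_division_of {a..b::real}"
  shows "nonoverlapping_intervals {a..b} P (\<lambda>xK. Inf (snd xK)) (\<lambda>xK. Sup (snd xK))"
  unfolding nonoverlapping_intervals_def disjoint_family_on_def
proof (intro conjI ballI impI)
  note elem = tagged_division_of_Icc_element[OF P]
  show "finite P"
    using P by (rule tagged_division_of_finite)
  show "Inf (snd xK) \<le> Sup (snd xK)" "{Inf (snd xK)..Sup (snd xK)} \<subseteq> {a..b}" if "xK \<in> P" for xK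
    using elem[OF that] by simp_all
  fix xK yL assume "xK \<in> P" "yL \<in> P" "xK \<noteq> yL"
  then have "interior (snd xK) \<inter> interior (snd yL) = {}"
    using tagged_division_ofD(5)[OF P, of "fst xK" "snd xK" "fst yL" "snd yL"] by (auto simp: prod_eq_iff)
  moreover have "interior (snd xK) = {Inf (snd xK)<..<Sup (snd xK)}" if "xK \<in> P" for xK
    using interior_atLeastAtMost_real[of "Inf (snd xK)" "Sup (snd xK)"] unfolding elem(1)[OF that] .
  ultimately show "{Inf (snd xK)<..<Sup (snd xK)} \<inter> {Inf (snd yL)<..<Sup (snd yL)} = {}"
    using \<open>xK \<in> P\<close> \<open>yL \<in> P\<close> by metis
qed

lemma zero_deriv_gauge:
  fixes h :: "real \<Rightarrow> real"
  assumes U: "open U" "N \<subseteq> U" and deriv: "\<And>x. x \<in> S - N \<Longrightarrow> (h has_real_derivative 0) (at x)" and "e > 0"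
  obtains g :: "real \<Rightarrow> real" where "\<And>x. g x > 0" "\<And>x. x \<in> N \<Longrightarrow> ball x (g x) \<subseteq> U"
    "\<And>x u v. x \<in> S - N \<Longrightarrow> u \<le> x \<Longrightarrow> x \<le> v \<Longrightarrow> u \<in> ball x (g x) \<Longrightarrow> v \<in> ball x (g x) \<Longrightarrow>
      \<bar>h v - h u\<bar> \<le> e * (v - u)"
proof -
  have "\<exists>\<delta>>0. (x \<in> N \<longrightarrow> ball x \<delta> \<subseteq> U) \<and> (x \<in> S - N \<longrightarrow>
      (\<forall>u v. u \<le> x \<longrightarrow> x \<le> v \<longrightarrow> u \<in> ball x \<delta> \<longrightarrow> v \<in> ball x \<delta> \<longrightarrow> \<bar>h v - h u\<bar> \<le> e * (v - u)))" for x
  proof -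
    consider "x \<in> N" | "x \<in> S - N" | "x \<notin> S" "x \<notin> N"
      by blast
    then show ?thesis
    proof cases
      case 1
      then show ?thesis
        using U by (meson DiffD2 openE subsetD)
    next
      case 2
      then obtain \<delta> where "\<delta> > 0" "\<And>u v. u \<le> x \<Longrightarrow> x \<le> v \<Longrightarrow> u \<in> ball x \<delta> \<Longrightarrow> v \<in> ball x \<delta> \<Longrightarrow>
          \<bar>h v - h u\<bar> \<le> e * (v - u)"
        using zero_deriv_straddle[OF deriv \<open>e > 0\<close>, of x] by blast
      with 2 show ?thesis
        by blast
    qed (auto intro: exI[of _ 1])
  qed
  then show thesis
    using that by metis
qed

lemma tagged_division_of_Icc_increments:
  fixes f :: "real \<Rightarrow> real"
  assumes "a \<le> b" "P tagged_division_of {a..b}"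
  shows "(\<Sum>xK\<in>P. f (Sup (snd xK)) - f (Inf (snd xK))) = f b - f a"
  using additive_tagged_division_1[OF assms, of f] by (simp add: case_prod_unfold)

lemma tagged_division_of_Icc_variation_le:
  fixes h :: "real \<Rightarrow> real"
  assumes "a \<le> b" and P: "P tagged_division_of {a..b}" and "T \<subseteq> P" "0 \<le> e"
    and increment: "\<And>xK. xK \<in> T \<Longrightarrow>
      \<bar>h (Sup (snd xK)) - h (Inf (snd xK))\<bar> \<le> e * (Sup (snd xK) - Inf (snd xK))"
  shows "(\<Sum>xK\<in>T. \<bar>h (Sup (snd xK)) - h (Inf (snd xK))\<bar>) \<le> e * (b - a)"
proof -
  have "(\<Sum>xK\<in>T. \<bar>h (Sup (snd xK)) - h (Inf (snd xK))\<bar>) \<le> (\<Sum>xK\<in>T. e * (Sup (snd xK) - Inf (snd xK)))"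
    by (rule sum_mono[OF increment])
  also have "\<dots> \<le> (\<Sum>xK\<in>P. e * (Sup (snd xK) - Inf (snd xK)))"
    using tagged_division_of_Icc_nonoverlapping[OF P] \<open>T \<subseteq> P\<close> \<open>0 \<le> e\<close>
    by (intro sum_mono2) (auto simp: nonoverlapping_intervals_def)
  also have "\<dots> = e * (b - a)"
    using tagged_division_of_Icc_increments[OF \<open>a \<le> b\<close> P, of "\<lambda>x. x"]
    by (simp add: sum_distrib_left[symmetric])
  finally show ?thesis .
qed

lemma abs_continuous_on_zero_deriv_imp_small:
  assumes "a \<le> b" and ac: "abs_continuous_on {a..b} h" and N: "N \<in> null_sets lebesgue"
    and deriv: "\<And>x. x \<in> {a..b} - N \<Longrightarrow> (h has_real_derivative 0) (at x)" and "e > 0"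
  shows "\<bar>h b - h a\<bar> \<le> e * (b - a) + e"
proof -
  obtain U where U: "open U" "N \<subseteq> U"
    and small: "\<And>(I :: (real \<times> real set) set) u v. nonoverlapping_intervals {a..b} I u v \<Longrightarrow>
      (\<And>i. i \<in> I \<Longrightarrow> {u i<..<v i} \<subseteq> U) \<Longrightarrow> (\<Sum>i\<in>I. \<bar>h (v i) - h (u i)\<bar>) < e"
    using abs_continuous_on_small_near_null_set[OF ac N \<open>e > 0\<close>] by blast
  obtain g where g: "\<And>x. g x > 0" "\<And>x. x \<in> N \<Longrightarrow> ball x (g x) \<subseteq> U"
    "\<And>x u v. x \<in> {a..b} - N \<Longrightarrow> u \<le> x \<Longrightarrow> x \<le> v \<Longrightarrow> u \<in> ball x (g x) \<Longrightarrow> v \<in> ball x (g x) \<Longrightarrow>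
      \<bar>h v - h u\<bar> \<le> e * (v - u)"
    by (rule zero_deriv_gauge[OF U deriv \<open>e > 0\<close>]) blast+
  have "gauge (\<lambda>x. ball x (g x))"
    using g(1) by (auto simp: gauge_def)
  then obtain P where P: "P tagged_division_of {a..b}" "(\<lambda>x. ball x (g x)) fine P"
    using fine_division_exists_real by blast
  note elem = tagged_division_of_Icc_element[OF P(1)]
  note fam = tagged_division_of_Icc_nonoverlapping[OF P(1)]
  let ?u = "\<lambda>xK :: real \<times> real set. Inf (snd xK)" and ?v = "\<lambda>xK :: real \<times> real set. Sup (snd xK)"
  let ?var = "\<lambda>xK. \<bar>h (?v xK) - h (?u xK)\<bar>"
  have in_ball: "snd xK \<subseteq> ball (fst xK) (g (fst xK))" if "xK \<in> P" for xK
    using P(2) that by (simp add: fine_def case_prod_unfold)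
  have regular_tags: "sum ?var {xK \<in> P. fst xK \<notin> N} \<le> e * (b - a)"
  proof (rule tagged_division_of_Icc_variation_le[OF \<open>a \<le> b\<close> P(1)])
    fix xK assume xK: "xK \<in> {xK \<in> P. fst xK \<notin> N}"
    then have "xK \<in> P"
      by simp
    have "?u xK \<in> snd xK" "?v xK \<in> snd xK" "fst xK \<in> snd xK"
      using elem(2,3)[OF \<open>xK \<in> P\<close>] by (auto intro!: subsetD[OF equalityD1[OF elem(1)[OF \<open>xK \<in> P\<close>]]])
    then show "?var xK \<le> e * (?v xK - ?u xK)"
      using xK elem(2-4)[OF \<open>xK \<in> P\<close>] in_ball[OF \<open>xK \<in> P\<close>] by (intro g(3)[of "fst xK"]) auto
  qed (use \<open>e > 0\<close> in auto)
  have null_tags: "sum ?var {xK \<in> P. fst xK \<in> N} < e"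
  proof (rule small[OF nonoverlapping_intervals_subset[OF fam]])
    fix xK assume xK: "xK \<in> {xK \<in> P. fst xK \<in> N}"
    then have "{?u xK<..<?v xK} \<subseteq> snd xK"
      by (intro order_trans[OF _ equalityD1[OF elem(1)]]) auto
    then show "{?u xK<..<?v xK} \<subseteq> U"
      using xK in_ball[of xK] g(2)[of "fst xK"] by blast
  qed auto
  have "\<bar>h b - h a\<bar> \<le> sum ?var P"
    unfolding tagged_division_of_Icc_increments[OF \<open>a \<le> b\<close> P(1), of h, symmetric] by (rule sum_abs)
  also have "sum ?var P = sum ?var {xK \<in> P. fst xK \<notin> N} + sum ?var {xK \<in> P. fst xK \<in> N}"
    using fam by (subst sum.union_disjoint[symmetric]) (auto simp: nonoverlapping_intervals_def intro!: sum.cong)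
  finally show ?thesis
    using regular_tags null_tags by linarith
qed

lemma abs_continuous_on_zero_deriv_imp_eq:
  assumes "a \<le> b" and ac: "abs_continuous_on {a..b} h"
    and ae: "AE x\<in>{a<..<b} in lebesgue. (h has_real_derivative 0) (at x)"
  shows "h b = h a"
proof -
  obtain N where N: "{x \<in> space lebesgue. \<not> (x \<in> {a<..<b} \<longrightarrow> (h has_real_derivative 0) (at x))} \<subseteq> N"
    "emeasure lebesgue N = 0" "N \<in> sets lebesgue"
    using ae by (rule AE_E)
  have "N \<in> null_sets lebesgue"
    using N(2,3) by auto
  then have null: "insert a (insert b N) \<in> null_sets lebesgue"
    by (simp flip: negligible_iff_null_sets)
  have deriv: "(h has_real_derivative 0) (at x)" if "x \<in> {a..b} - insert a (insert b N)" for x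
    using N(1) that by (force simp: order_less_le)
  have "\<bar>h b - h a\<bar> \<le> 0 + e" if "e > 0" for e
  proof -
    have "e / (b - a + 1) > 0"
      using \<open>e > 0\<close> \<open>a \<le> b\<close> by simp
    from abs_continuous_on_zero_deriv_imp_small[OF \<open>a \<le> b\<close> ac null deriv this]
    have "\<bar>h b - h a\<bar> \<le> e / (b - a + 1) * (b - a + 1)"
      by (simp only: distrib_left mult_1_right)
    then show ?thesis
      using \<open>a \<le> b\<close> by simp
  qed
  then have "\<bar>h b - h a\<bar> \<le> 0"
    by (rule field_le_epsilon)
  then show ?thesis
    by simp
qed

section \<open>Dirichlet problems with regular densities\<close>

lemma countable_imp_null_set_lebesgue: "countable S \<Longrightarrow> S \<in> null_sets lebesgue" for S :: "real set"
  by (intro null_sets_completionI countable_imp_null_set_lborel)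

lemma AE_of_eventually_cocountable:
  assumes "eventually P (cocountable {a<..<b::real})"
  shows "AE x\<in>{a<..<b} in lebesgue. P x"
  by (rule AE_I'[OF countable_imp_null_set_lebesgue[OF assms[unfolded eventually_cocountable]]]) auto

lemma absolutely_integrable_of_isCont:
  fixes f :: "real \<Rightarrow> real"
  assumes bound: "\<And>x. x \<in> {a..b} \<Longrightarrow> \<bar>f x\<bar> \<le> M" and cont: "\<forall>\<^sub>F x in cocountable {a<..<b}. isCont f x"
  shows "f absolutely_integrable_on {a..b}"
proof -
  define T where "T = {x \<in> {a<..<b}. isCont f x}"
  have "countable (insert a (insert b {x \<in> {a<..<b}. \<not> isCont f x}))"
    using cont by (simp add: eventually_cocountable)
  then have "countable ({a..b} - T)"
    by (rule countable_subset[rotated]) (auto simp: T_def)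
  then have null: "{a..b} - T \<in> null_sets lebesgue"
    by (rule countable_imp_null_set_lebesgue)
  have "{a..b} - ({a..b} - T) \<in> sets lebesgue"
    using null_setsD2[OF null] by (rule sets.Diff[rotated]) simp
  moreover have "{a..b} - ({a..b} - T) = T"
    by (auto simp: T_def)
  moreover have "bounded T"
    by (rule bounded_subset[OF bounded_closed_interval[of a b]]) (auto simp: T_def)
  ultimately have T: "T \<in> lmeasurable"
    by (simp add: bounded_set_imp_lmeasurable)
  have "continuous_on T f"
    by (intro continuous_at_imp_continuous_on) (simp add: T_def)
  then have "f absolutely_integrable_on T"
    using bound T
    by (intro measurable_bounded_by_integrable_imp_absolutely_integrable[where g = "\<lambda>_. M"]
        continuous_imp_measurable_on_sets_lebesgue integrable_on_const) (auto simp: T_def)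
  moreover have "negligible {x \<in> T - {a..b}. f x \<noteq> 0}"
    by (rule negligible_subset[OF negligible_empty]) (auto simp: T_def)
  moreover have "negligible {x \<in> {a..b} - T. f x \<noteq> 0}"
    using null unfolding negligible_iff_null_sets[symmetric] by (rule negligible_subset) auto
  ultimately show ?thesis
    using absolutely_integrable_spike_set_eq by blast
qed

lemma has_real_derivative_indefinite_integral:
  fixes f :: "real \<Rightarrow> real"
  assumes bound: "\<And>x. x \<in> {a..b} \<Longrightarrow> \<bar>f x\<bar> \<le> M" and cont: "\<forall>\<^sub>F x in cocountable {a<..<b}. isCont f x"
  shows "continuous_on {a..b} (\<lambda>x. integral {a..x} f)"
    and "\<forall>\<^sub>F x in cocountable {a<..<b}. ((\<lambda>x. integral {a..x} f) has_real_derivative f x) (at x)"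
proof -
  have int: "f integrable_on {a..b}"
    using absolutely_integrable_of_isCont[OF bound cont] by (simp add: absolutely_integrable_on_def)
  then show "continuous_on {a..b} (\<lambda>x. integral {a..x} f)"
    by (rule indefinite_integral_continuous_1)
  show "\<forall>\<^sub>F x in cocountable {a<..<b}. ((\<lambda>x. integral {a..x} f) has_real_derivative f x) (at x)"
    using cont eventually_in_cocountable
  proof eventually_elim
    case (elim x)
    have "((\<lambda>u. integral {a..u} f) has_vector_derivative f x) (at x within ({a..b} - {}))"
      using elim by (intro integral_has_vector_derivative_continuous_at[OF int])
        (auto intro: continuous_at_imp_continuous_at_within)
    then show ?case
      using elim(2) at_within_Icc_at[of a x b] by (simp add: has_real_derivative_iff_has_vector_derivative)
  qed
qed

lemma abs_continuous_on_deriv_cocountable: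
  assumes "a \<le> b" and ac: "abs_continuous_on {a..b} \<phi>"
    and ae: "AE x\<in>{a<..<b} in lebesgue. (\<phi> has_real_derivative f x) (at x)"
    and bound: "\<And>x. x \<in> {a..b} \<Longrightarrow> \<bar>f x\<bar> \<le> M"
    and cont: "\<forall>\<^sub>F x in cocountable {a<..<b}. isCont f x"
  shows "\<forall>\<^sub>F x in cocountable {a<..<b}. (\<phi> has_real_derivative f x) (at x)"
proof -
  define F where "F x = integral {a..x} f" for x
  have F_cont: "continuous_on {a..b} F"
    and F_deriv: "\<forall>\<^sub>F x in cocountable {a<..<b}. (F has_real_derivative f x) (at x)"
    unfolding F_def using has_real_derivative_indefinite_integral[OF bound cont] by blast+
  have "0 \<le> M"
    using bound[of a] \<open>a \<le> b\<close> by auto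
  have "\<forall>\<^sub>F x in cocountable {a<..<b}. \<exists>d. \<bar>d\<bar> \<le> M \<and> (F has_real_derivative d) (at x)"
    using F_deriv eventually_in_cocountable
  proof eventually_elim
    case (elim x)
    with bound[of x] show ?case
      by (intro exI[of _ "f x"]) simp
  qed
  then have "abs_continuous_on {a..b} F"
    by (rule lipschitz_on_imp_abs_continuous_on[OF lipschitz_on_of_bounded_deriv[OF \<open>0 \<le> M\<close> F_cont]])
  then have diff_ac: "abs_continuous_on {a..b} (\<lambda>x. \<phi> x - F x)"
    by (rule abs_continuous_on_diff[OF ac])
  have diff_deriv: "AE x\<in>{a<..<b} in lebesgue. ((\<lambda>x. \<phi> x - F x) has_real_derivative 0) (at x)"
    using ae AE_of_eventually_cocountable[OF F_deriv]
    by eventually_elim (use DERIV_diff[of \<phi> _ _ UNIV F] in force)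
  have eq: "F x + (\<phi> a - F a) = \<phi> x" if x: "x \<in> {a<..<b}" for x
  proof -
    have "AE t\<in>{a<..<x} in lebesgue. ((\<lambda>x. \<phi> x - F x) has_real_derivative 0) (at t)"
      using diff_deriv by eventually_elim (use x in auto)
    then have "\<phi> x - F x = \<phi> a - F a"
      using x by (intro abs_continuous_on_zero_deriv_imp_eq abs_continuous_on_subset[OF diff_ac]) auto
    then show ?thesis
      by simp
  qed
  show ?thesis
    using F_deriv eventually_in_cocountable
  proof eventually_elim
    case (elim x)
    then have "((\<lambda>x. F x + (\<phi> a - F a)) has_real_derivative f x) (at x)"
      by (auto intro!: derivative_eq_intros)
    then show ?case
      by (rule has_field_derivative_transform_within_open[OF _ open_greaterThanLessThan elim(2) eq])
  qed
qed

definition regular_density :: "real \<Rightarrow> (real \<Rightarrow> real) \<Rightarrow> bool" where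
  "regular_density H \<rho> \<longleftrightarrow> (\<exists>B. \<forall>x\<in>{0..H}. \<bar>\<rho> x\<bar> \<le> B) \<and>
     (\<forall>\<^sub>F x in cocountable {0<..<H}. isCont \<rho> x) \<and> (\<forall>\<^sub>F x in cocountable {0<..<H}. 0 < \<rho> x)"

lemma regular_densityD:
  assumes "regular_density H \<rho>"
  shows "\<forall>\<^sub>F x in cocountable {0<..<H}. isCont \<rho> x" "\<forall>\<^sub>F x in cocountable {0<..<H}. 0 < \<rho> x"
  using assms by (auto simp: regular_density_def)

lemma regular_densityE:
  assumes "regular_density H \<rho>"
  obtains B where "B \<ge> 0" "\<And>x. x \<in> {0..H} \<Longrightarrow> \<bar>\<rho> x\<bar> \<le> B"
proof -
  obtain B where "\<forall>x\<in>{0..H}. \<bar>\<rho> x\<bar> \<le> B"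
    using assms by (auto simp: regular_density_def)
  then show thesis
    by (intro that[of "\<bar>B\<bar>"]) (auto intro: order_trans[OF _ abs_ge_self])
qed

lemma dirichlet_solution_imp_regular_solution:
  assumes "p > 1" and \<rho>: "regular_density (pi_hat p) \<rho>" and "pi_hat p > 0"
    and sol: "dirichlet_solution p \<rho> \<mu> y"
  obtains \<phi> where "regular_solution p (\<lambda>x. \<mu> * \<rho> x) 0 (pi_hat p) y \<phi>"
proof -
  let ?H = "pi_hat p"
  obtain dy where dy: "\<forall>x\<in>{0..?H}. (y has_real_derivative dy x) (at x within {0..?H})"
    "abs_continuous_on {0..?H} (\<lambda>x. signed_pow p (dy x))"
    "AE x\<in>{0<..<?H} in lebesgue. ((\<lambda>t. signed_pow p (dy t)) has_real_derivative
       - (p - 1) * \<mu> * \<rho> x * signed_pow p (y x)) (at x)"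
    using sol by (auto simp: dirichlet_solution_def)
  define \<phi> where "\<phi> x = signed_pow p (dy x)" for x
  define g where "g x = - (p - 1) * \<mu> * signed_pow p (y x)" for x
  have "continuous_on {0..?H} y"
    using dy(1) by (meson DERIV_continuous continuous_on_eq_continuous_within)
  then have g_cont: "continuous_on {0..?H} g"
    unfolding g_def using \<open>p > 1\<close> by (intro continuous_intros)
  then obtain G where G: "\<And>x. x \<in> {0..?H} \<Longrightarrow> \<bar>g x\<bar> \<le> G"
    by (rule continuous_on_compact_bound[OF compact_Icc]) auto
  obtain B where B: "B \<ge> 0" "\<And>x. x \<in> {0..?H} \<Longrightarrow> \<bar>\<rho> x\<bar> \<le> B"
    using regular_densityE[OF \<rho>] by blast
  have "\<forall>\<^sub>F x in cocountable {0<..<?H}. (\<phi> has_real_derivative g x * \<rho> x) (at x)"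
  proof (rule abs_continuous_on_deriv_cocountable)
    show "abs_continuous_on {0..?H} \<phi>"
      using dy(2) by (simp add: \<phi>_def[abs_def])
    show "AE x\<in>{0<..<?H} in lebesgue. (\<phi> has_real_derivative g x * \<rho> x) (at x)"
      using dy(3) by (simp add: \<phi>_def[abs_def] g_def mult_ac)
    show "\<bar>g x * \<rho> x\<bar> \<le> G * B" if "x \<in> {0..?H}" for x
      unfolding abs_mult using G[OF that] B(2)[OF that] by (intro mult_mono) auto
    show "\<forall>\<^sub>F x in cocountable {0<..<?H}. isCont (\<lambda>x. g x * \<rho> x) x"
      using regular_densityD(1)[OF \<rho>] eventually_in_cocountable
      by eventually_elim (use continuous_on_interior[OF g_cont] in \<open>auto intro!: continuous_intros\<close>)
  qed (use \<open>pi_hat p > 0\<close> in simp)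
  moreover have "continuous_on {0..?H} \<phi>"
    unfolding \<phi>_def using dy(2) by (rule abs_continuous_on_imp_continuous_on)
  moreover have "signed_pow (conjugate p) (\<phi> x) = dy x" for x
    unfolding \<phi>_def by (rule signed_pow_signed_pow[OF conjugate_exponent(3)[OF \<open>p > 1\<close>]])
  ultimately have "regular_solution p (\<lambda>x. \<mu> * \<rho> x) 0 ?H y \<phi>"
    using dy(1) by (simp add: regular_solution_def g_def mult_ac)
  then show thesis
    by (rule that)
qed

lemma regular_solution_imp_dirichlet_solution:
  assumes "p > 1" and \<rho>: "regular_density (pi_hat p) \<rho>"
    and sol: "regular_solution p (\<lambda>x. \<mu> * \<rho> x) 0 (pi_hat p) y \<phi>" and "y 0 = 0" "y (pi_hat p) = 0"
  shows "dirichlet_solution p \<rho> \<mu> y"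
proof -
  let ?H = "pi_hat p" and ?q = "conjugate p"
  note q = conjugate_exponent[OF \<open>p > 1\<close>]
  note solD = regular_solutionD[OF sol]
  have inverse: "signed_pow p (signed_pow ?q (\<phi> x)) = \<phi> x" for x
    by (rule signed_pow_signed_pow[OF q(4)])
  obtain B where B: "B \<ge> 0" "\<And>x. x \<in> {0..?H} \<Longrightarrow> \<bar>\<rho> x\<bar> \<le> B"
    using regular_densityE[OF \<rho>] by blast
  have "continuous_on {0..?H} (\<lambda>x. signed_pow ?q (\<phi> x))"
    using solD(3) q(1) by (intro continuous_intros)
  then obtain M1 where M1: "M1 \<ge> 0" "\<And>x. x \<in> {0..?H} \<Longrightarrow> \<bar>signed_pow ?q (\<phi> x)\<bar> \<le> M1"
    by (rule continuous_on_compact_bound[OF compact_Icc]) auto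
  have "continuous_on {0..?H} (\<lambda>x. - (p - 1) * \<mu> * signed_pow p (y x))"
    using solD(4) \<open>p > 1\<close> by (intro continuous_intros)
  then obtain M2 where M2: "M2 \<ge> 0" "\<And>x. x \<in> {0..?H} \<Longrightarrow> \<bar>- (p - 1) * \<mu> * signed_pow p (y x)\<bar> \<le> M2"
    by (rule continuous_on_compact_bound[OF compact_Icc]) auto
  have "M1-lipschitz_on {0..?H} y"
  proof (intro lipschitz_on_of_bounded_deriv M1(1) solD(4) eventually_cocountableI exI conjI)
    show "\<bar>signed_pow ?q (\<phi> x)\<bar> \<le> M1" "(y has_real_derivative signed_pow ?q (\<phi> x)) (at x)"
      if "x \<in> {0<..<?H}" for x
      using M1(2)[of x] solD(2)[OF that] that by auto
  qed
  moreover have "(M2 * B)-lipschitz_on {0..?H} \<phi>"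
  proof (rule lipschitz_on_of_bounded_deriv[OF _ solD(3)])
    show "\<forall>\<^sub>F x in cocountable {0<..<?H}. \<exists>d. \<bar>d\<bar> \<le> M2 * B \<and> (\<phi> has_real_derivative d) (at x)"
      using solD(5) eventually_in_cocountable
    proof eventually_elim
      case (elim x)
      have "\<bar>(- (p - 1) * \<mu> * signed_pow p (y x)) * \<rho> x\<bar> \<le> M2 * B"
        unfolding abs_mult[of _ "\<rho> x"] using M2(2)[of x] B(2)[of x] M2(1) elim(2) by (intro mult_mono) auto
      with elim(1) show ?case
        by (intro exI[of _ "(- (p - 1) * \<mu> * signed_pow p (y x)) * \<rho> x"]) (simp add: mult_ac)
    qed
  qed (use M2(1) B(1) in simp)
  moreover have "AE x\<in>{0<..<?H} in lebesgue.
      (\<phi> has_real_derivative - (p - 1) * \<mu> * \<rho> x * signed_pow p (y x)) (at x)"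
    using AE_of_eventually_cocountable[OF solD(5)] by (simp add: mult.assoc)
  ultimately show ?thesis
    unfolding dirichlet_solution_def using assms(4,5) solD(1) lipschitz_on_imp_abs_continuous_on
    by (intro conjI exI[of _ "\<lambda>x. signed_pow ?q (\<phi> x)"]) (auto simp: inverse)
qed

section \<open>Differential equations with Lipschitz right-hand side\<close>

locale lipschitz_field =
  fixes H M \<Lambda> :: real and f :: "real \<Rightarrow> real \<Rightarrow> real"
  assumes H: "0 < H"
    and bound: "\<And>t \<theta>. t \<in> {0..H} \<Longrightarrow> \<bar>f t \<theta>\<bar> \<le> M"
    and lipschitz: "\<And>t. t \<in> {0..H} \<Longrightarrow> \<Lambda>-lipschitz_on UNIV (f t)"
    and isCont: "\<And>\<beta>. continuous_on {0..H} \<beta> \<Longrightarrow> \<forall>\<^sub>F t in cocountable {0<..<H}. isCont (\<lambda>t. f t (\<beta> t)) t"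
begin

lemma lipschitz_nonneg: "0 \<le> \<Lambda>"
  using lipschitz_on_nonneg[OF lipschitz[of 0]] H by simp

lemma lipschitz_le: "t \<in> {0..H} \<Longrightarrow> \<bar>f t \<theta> - f t \<eta>\<bar> \<le> \<Lambda> * \<bar>\<theta> - \<eta>\<bar>"
  using lipschitz_onD[OF lipschitz] by (simp add: dist_real_def)

lemma integrable:
  assumes "continuous_on {0..H} \<beta>" "x \<in> {0..H}"
  shows "(\<lambda>t. f t (\<beta> t)) integrable_on {0..x}"
proof (rule integrable_subinterval_real)
  show "(\<lambda>t. f t (\<beta> t)) integrable_on {0..H}"
    using absolutely_integrable_of_isCont[OF bound isCont[OF assms(1)]]
    by (simp add: absolutely_integrable_on_def)
qed (use assms(2) in auto)

lemma integral_continuous_on: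
  "continuous_on {0..H} \<beta> \<Longrightarrow> continuous_on {0..H} (\<lambda>x. integral {0..x} (\<lambda>t. f t (\<beta> t)))"
  by (rule has_real_derivative_indefinite_integral(1)[OF bound isCont])

lemma integral_deriv:
  "continuous_on {0..H} \<beta> \<Longrightarrow> \<forall>\<^sub>F x in cocountable {0<..<H}.
     ((\<lambda>x. integral {0..x} (\<lambda>t. f t (\<beta> t))) has_real_derivative f x (\<beta> x)) (at x)"
  by (rule has_real_derivative_indefinite_integral(2)[OF bound isCont])

lemma exponential_contraction:
  assumes \<beta>: "continuous_on {0..H} \<beta>" and \<gamma>: "continuous_on {0..H} \<gamma>" and x: "x \<in> {0..H}" and "0 < K" "0 \<le> D"
    and close: "\<And>t. t \<in> {0..H} \<Longrightarrow> \<bar>\<beta> t - \<gamma> t\<bar> \<le> exp (K * t) * D"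
  shows "\<bar>integral {0..x} (\<lambda>t. f t (\<beta> t)) - integral {0..x} (\<lambda>t. f t (\<gamma> t))\<bar> \<le> \<Lambda> * D * exp (K * x) / K"
proof -
  have exp_int: "((\<lambda>t. \<Lambda> * D * exp (K * t)) has_integral
      (\<Lambda> * D * exp (K * x) / K - \<Lambda> * D * exp (K * 0) / K)) {0..x}"
  proof (rule fundamental_theorem_of_calculus)
    show "((\<lambda>t. \<Lambda> * D * exp (K * t) / K) has_vector_derivative \<Lambda> * D * exp (K * t)) (at t within {0..x})" for t
      unfolding has_real_derivative_iff_has_vector_derivative[symmetric]
      using \<open>0 < K\<close> by (auto intro!: derivative_eq_intros)
  qed (use x in simp)
  note int = integrable[OF \<beta> x] integrable[OF \<gamma> x]
  have "\<bar>integral {0..x} (\<lambda>t. f t (\<beta> t)) - integral {0..x} (\<lambda>t. f t (\<gamma> t))\<bar> =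
      norm (integral {0..x} (\<lambda>t. f t (\<beta> t) - f t (\<gamma> t)))"
    by (simp add: integral_diff[OF int])
  also have "\<dots> \<le> integral {0..x} (\<lambda>t. \<Lambda> * D * exp (K * t))"
  proof (rule integral_norm_bound_integral)
    show "(\<lambda>t. f t (\<beta> t) - f t (\<gamma> t)) integrable_on {0..x}"
      by (intro integrable_diff int)
    show "(\<lambda>t. \<Lambda> * D * exp (K * t)) integrable_on {0..x}"
      using exp_int by blast
    fix t assume "t \<in> {0..x}"
    then have t: "t \<in> {0..H}"
      using x by auto
    have "\<bar>f t (\<beta> t) - f t (\<gamma> t)\<bar> \<le> \<Lambda> * \<bar>\<beta> t - \<gamma> t\<bar>"
      by (rule lipschitz_le[OF t])
    also have "\<dots> \<le> \<Lambda> * (exp (K * t) * D)"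
      by (intro mult_left_mono close t lipschitz_nonneg)
    finally show "norm (f t (\<beta> t) - f t (\<gamma> t)) \<le> \<Lambda> * D * exp (K * t)"
      by (simp add: mult_ac)
  qed
  also have "\<dots> \<le> \<Lambda> * D * exp (K * x) / K"
    unfolding integral_unique[OF exp_int] using \<open>0 < K\<close> \<open>0 \<le> D\<close> lipschitz_nonneg by simp
  finally show ?thesis .
qed

text \<open>The exponential weight makes the Picard operator a contraction on the whole interval.\<close>

definition weighted_picard :: "real \<Rightarrow> real \<Rightarrow> (real \<Rightarrow> real) \<Rightarrow> real \<Rightarrow> real" where
  "weighted_picard K \<theta>0 \<beta> x = exp (- K * x) * (\<theta>0 + integral {0..x} (\<lambda>t. f t (exp (K * t) * \<beta> t)))"

lemma weighted_picard_continuous_on: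
  assumes "continuous_on {0..H} \<beta>"
  shows "continuous_on {0..H} (weighted_picard K \<theta>0 \<beta>)"
  unfolding weighted_picard_def by (intro continuous_intros integral_continuous_on assms)

lemma weighted_picard_contraction:
  assumes "continuous_on {0..H} \<beta>" "continuous_on {0..H} \<gamma>" and x: "x \<in> {0..H}" and "0 < K" "0 \<le> D"
    and close: "\<And>t. t \<in> {0..H} \<Longrightarrow> \<bar>\<beta> t - \<gamma> t\<bar> \<le> D"
  shows "\<bar>weighted_picard K \<theta>0 \<beta> x - weighted_picard K \<theta>0 \<gamma> x\<bar> \<le> \<Lambda> * D / K"
proof -
  let ?I = "\<lambda>\<beta>. integral {0..x} (\<lambda>t. f t (exp (K * t) * \<beta> t))"
  have "\<bar>?I \<beta> - ?I \<gamma>\<bar> \<le> \<Lambda> * D * exp (K * x) / K"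
  proof (rule exponential_contraction[OF _ _ x \<open>0 < K\<close> \<open>0 \<le> D\<close>])
    show "\<bar>exp (K * t) * \<beta> t - exp (K * t) * \<gamma> t\<bar> \<le> exp (K * t) * D" if "t \<in> {0..H}" for t
      using close[OF that] by (simp add: right_diff_distrib[symmetric] abs_mult)
  qed (intro continuous_intros assms(1,2))+
  then have "exp (- K * x) * \<bar>?I \<beta> - ?I \<gamma>\<bar> \<le> exp (- K * x) * (\<Lambda> * D * exp (K * x) / K)"
    by (intro mult_left_mono) auto
  also have "\<dots> = \<Lambda> * D / K"
    by (simp add: exp_minus)
  finally show ?thesis
    by (simp add: weighted_picard_def right_diff_distrib[symmetric] abs_mult)
qed

lemma integral_equation_solvable:
  obtains \<alpha> where "continuous_on {0..H} \<alpha>"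
    "\<And>x. x \<in> {0..H} \<Longrightarrow> \<alpha> x = \<theta>0 + integral {0..x} (\<lambda>t. f t (\<alpha> t))"
proof -
  define K where "K = 2 * \<Lambda> + 1"
  have "0 < K"
    using lipschitz_nonneg by (simp add: K_def)
  have "\<exists>g :: real \<Rightarrow>\<^sub>C real. \<forall>x. apply_bcontfun g x = weighted_picard K \<theta>0 (apply_bcontfun \<beta>) (clamp 0 H x)"
    for \<beta> :: "real \<Rightarrow>\<^sub>C real"
  proof -
    have "continuous_on (cbox 0 H) (weighted_picard K \<theta>0 (apply_bcontfun \<beta>))"
      using weighted_picard_continuous_on[OF continuous_on_apply_bcontfun] by simp
    then show ?thesis
      by (rule continuous_on_cbox_bcontfunE) blast
  qed
  then obtain T :: "(real \<Rightarrow>\<^sub>C real) \<Rightarrow> real \<Rightarrow>\<^sub>C real"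
    where T: "\<And>\<beta> x. T \<beta> x = weighted_picard K \<theta>0 (apply_bcontfun \<beta>) (clamp 0 H x)"
    by metis
  have "dist (T \<beta>) (T \<gamma>) \<le> 1 / 2 * dist \<beta> \<gamma>" for \<beta> \<gamma>
  proof (rule dist_bound)
    fix x
    have "clamp 0 H x \<in> {0..H}"
      using clamp_in_interval[of 0 H x] H by simp
    then have "dist (T \<beta> x) (T \<gamma> x) \<le> \<Lambda> * dist \<beta> \<gamma> / K"
      unfolding T dist_real_def using \<open>0 < K\<close> dist_bounded[of \<beta> _ \<gamma>]
      by (intro weighted_picard_contraction continuous_on_apply_bcontfun) (simp_all add: dist_real_def)
    also have "\<dots> \<le> 1 / 2 * dist \<beta> \<gamma>"
      using \<open>0 < K\<close> by (simp add: K_def field_simps)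
    finally show "dist (T \<beta> x) (T \<gamma> x) \<le> 1 / 2 * dist \<beta> \<gamma>" .
  qed
  then obtain \<beta> where fixpoint: "T \<beta> = \<beta>"
    using banach_fix_type[of "1 / 2" T] by auto
  define \<alpha> where "\<alpha> x = exp (K * x) * apply_bcontfun \<beta> x" for x
  have "\<alpha> x = \<theta>0 + integral {0..x} (\<lambda>t. f t (\<alpha> t))" if "x \<in> {0..H}" for x
  proof -
    have "\<alpha> x = exp (K * x) * weighted_picard K \<theta>0 (apply_bcontfun \<beta>) x"
      using T[of \<beta> x] that by (simp add: \<alpha>_def fixpoint)
    then show ?thesis
      by (simp add: weighted_picard_def \<alpha>_def[abs_def] exp_minus)
  qed
  moreover have "continuous_on {0..H} \<alpha>"
    unfolding \<alpha>_def by (intro continuous_intros continuous_on_apply_bcontfun)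
  ultimately show thesis
    using that by blast
qed

lemma solution_exists:
  obtains \<alpha> where "continuous_on {0..H} \<alpha>" "\<alpha> 0 = \<theta>0"
    "\<forall>\<^sub>F x in cocountable {0<..<H}. (\<alpha> has_real_derivative f x (\<alpha> x)) (at x)"
proof -
  obtain \<alpha> where \<alpha>: "continuous_on {0..H} \<alpha>"
    "\<And>x. x \<in> {0..H} \<Longrightarrow> \<alpha> x = \<theta>0 + integral {0..x} (\<lambda>t. f t (\<alpha> t))"
    using integral_equation_solvable by blast
  have "\<forall>\<^sub>F x in cocountable {0<..<H}. (\<alpha> has_real_derivative f x (\<alpha> x)) (at x)"
    using integral_deriv[OF \<alpha>(1)] eventually_in_cocountable
  proof eventually_elim
    case (elim x)
    have "((\<lambda>x. \<theta>0 + integral {0..x} (\<lambda>t. f t (\<alpha> t))) has_real_derivative f x (\<alpha> x)) (at x)"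
      using elim(1) by (auto intro!: derivative_eq_intros)
    then show ?case
      by (rule has_field_derivative_transform_within_open[OF _ open_greaterThanLessThan elim(2)])
        (simp add: \<alpha>(2)[symmetric])
  qed
  moreover have "\<alpha> 0 = \<theta>0"
    using \<alpha>(2)[of 0] H by simp
  ultimately show thesis
    using that \<alpha>(1) by blast
qed

end

lemma solution_diff_le:
  fixes \<alpha> \<beta> F G :: "real \<Rightarrow> real"
  assumes "0 \<le> H" "0 \<le> \<Lambda>" "0 \<le> k" and cont: "continuous_on {0..H} \<alpha>" "continuous_on {0..H} \<beta>" and "\<alpha> 0 = \<beta> 0"
    and \<alpha>: "\<forall>\<^sub>F x in cocountable {0<..<H}. (\<alpha> has_real_derivative F x) (at x)"
    and \<beta>: "\<forall>\<^sub>F x in cocountable {0<..<H}. (\<beta> has_real_derivative G x) (at x)"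
    and close: "\<And>x. x \<in> {0<..<H} \<Longrightarrow> \<bar>F x - G x\<bar> \<le> \<Lambda> * \<bar>\<alpha> x - \<beta> x\<bar> + k"
  shows "\<alpha> H - \<beta> H \<le> exp ((\<Lambda> + 1) * H) * k"
proof -
  have "(\<alpha> H - \<beta> H) + k / (\<Lambda> + 1) \<le> exp ((\<Lambda> + 1) * (H - 0)) * (max 0 (\<alpha> 0 - \<beta> 0) + k / (\<Lambda> + 1))"
  proof (rule gronwall[of _ _ _ _ "\<lambda>x. \<alpha> x - \<beta> x"])
    show "continuous_on {0..H} (\<lambda>x. \<alpha> x - \<beta> x)"
      by (intro continuous_on_diff cont)
    show "\<forall>\<^sub>F x in cocountable {0<..<H}. 0 < \<alpha> x - \<beta> x \<longrightarrow>
        (\<exists>d\<le>(\<Lambda> + 1) * (\<alpha> x - \<beta> x) + k. ((\<lambda>x. \<alpha> x - \<beta> x) has_real_derivative d) (at x))"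
      using \<alpha> \<beta> eventually_in_cocountable
    proof eventually_elim
      case (elim x)
      show ?case
        using close[OF elim(3)] DERIV_diff[OF elim(1,2)]
        by (intro impI exI[of _ "F x - G x"]) (auto simp: algebra_simps)
    qed
  qed (use assms in auto)
  also have "\<dots> = exp ((\<Lambda> + 1) * H) * (k / (\<Lambda> + 1))"
    using \<open>\<alpha> 0 = \<beta> 0\<close> by simp
  also have "\<dots> \<le> exp ((\<Lambda> + 1) * H) * k"
    using assms(2,3) by (intro mult_left_mono) (auto simp: divide_le_eq mult_le_cancel_left1)
  finally show ?thesis
    using assms(2,3) by (smt (verit) divide_nonneg_nonneg)
qed

context lipschitz_field
begin

lemma lipschitz_field_scale: "lipschitz_field H (\<bar>m\<bar> * M) (\<bar>m\<bar> * \<Lambda>) (\<lambda>t \<theta>. m * f t \<theta>)"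
proof
  show "\<bar>m * f t \<theta>\<bar> \<le> \<bar>m\<bar> * M" if "t \<in> {0..H}" for t \<theta>
    unfolding abs_mult by (intro mult_left_mono bound that) simp
  show "(\<bar>m\<bar> * \<Lambda>)-lipschitz_on UNIV (\<lambda>\<theta>. m * f t \<theta>)" if "t \<in> {0..H}" for t
    by (rule lipschitz_on_cmult_real[OF lipschitz[OF that]])
  show "\<forall>\<^sub>F t in cocountable {0<..<H}. isCont (\<lambda>t. m * f t (\<beta> t)) t" if "continuous_on {0..H} \<beta>" for \<beta>
    using isCont[OF that] by eventually_elim (intro continuous_intros)
qed (rule H)

definition scaled_flow :: "real \<Rightarrow> real \<Rightarrow> (real \<Rightarrow> real) \<Rightarrow> bool" where
  "scaled_flow \<theta>0 m \<alpha> \<longleftrightarrow> continuous_on {0..H} \<alpha> \<and> \<alpha> 0 = \<theta>0 \<and>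
     (\<forall>\<^sub>F x in cocountable {0<..<H}. (\<alpha> has_real_derivative m * f x (\<alpha> x)) (at x))"

lemma scaled_flow_exists: "\<exists>\<alpha>. scaled_flow \<theta>0 m \<alpha>"
  using lipschitz_field.solution_exists[OF lipschitz_field_scale, of \<theta>0 m] unfolding scaled_flow_def by blast

lemma scaled_flow_end_diff_le:
  assumes \<alpha>: "scaled_flow \<theta>0 m \<alpha>" and \<beta>: "scaled_flow \<theta>0 m' \<beta>"
  shows "\<bar>\<beta> H - \<alpha> H\<bar> \<le> exp ((\<bar>m\<bar> * \<Lambda> + 1) * H) * (M * \<bar>m' - m\<bar>)"
proof -
  have M: "0 \<le> M"
    using bound[of 0 0] H by auto
  have close: "\<bar>m' * f x (\<beta> x) - m * f x (\<alpha> x)\<bar> \<le> \<bar>m\<bar> * \<Lambda> * \<bar>\<beta> x - \<alpha> x\<bar> + M * \<bar>m' - m\<bar>"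
    if "x \<in> {0<..<H}" for x
  proof -
    have x: "x \<in> {0..H}"
      using that by auto
    have "m' * f x (\<beta> x) - m * f x (\<alpha> x) = m * (f x (\<beta> x) - f x (\<alpha> x)) + (m' - m) * f x (\<beta> x)"
      by (simp add: algebra_simps)
    also have "\<bar>\<dots>\<bar> \<le> \<bar>m\<bar> * \<bar>f x (\<beta> x) - f x (\<alpha> x)\<bar> + \<bar>m' - m\<bar> * \<bar>f x (\<beta> x)\<bar>"
      by (rule order_trans[OF abs_triangle_ineq]) (simp add: abs_mult)
    also have "\<dots> \<le> \<bar>m\<bar> * (\<Lambda> * \<bar>\<beta> x - \<alpha> x\<bar>) + \<bar>m' - m\<bar> * M"
      by (intro add_mono mult_left_mono lipschitz_le[OF x] bound[OF x]) auto
    finally show ?thesis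
      by (simp add: mult_ac)
  qed
  have "\<beta> H - \<alpha> H \<le> exp ((\<bar>m\<bar> * \<Lambda> + 1) * H) * (M * \<bar>m' - m\<bar>)"
    by (rule solution_diff_le[where \<alpha> = \<beta> and \<beta> = \<alpha>])
      (use \<alpha> \<beta> H M lipschitz_nonneg close in \<open>auto simp: scaled_flow_def\<close>)
  moreover have "\<alpha> H - \<beta> H \<le> exp ((\<bar>m\<bar> * \<Lambda> + 1) * H) * (M * \<bar>m' - m\<bar>)"
    by (rule solution_diff_le[where \<alpha> = \<alpha> and \<beta> = \<beta>])
      (use \<alpha> \<beta> H M lipschitz_nonneg close in \<open>auto simp: scaled_flow_def abs_minus_commute\<close>)
  ultimately show ?thesis
    by (simp add: abs_le_iff)
qed

lemma scaled_flow_end_continuous: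
  assumes \<alpha>: "\<And>m. scaled_flow \<theta>0 m (\<alpha> m)"
  shows "continuous_on S (\<lambda>m. \<alpha> m H)"
proof (intro continuous_at_imp_continuous_on ballI)
  fix m
  have "((\<lambda>m'. \<alpha> m' H - \<alpha> m H) \<longlongrightarrow> 0) (at m)"
  proof (rule Lim_null_comparison)
    show "\<forall>\<^sub>F m' in at m. norm (\<alpha> m' H - \<alpha> m H) \<le> exp ((\<bar>m\<bar> * \<Lambda> + 1) * H) * (M * \<bar>m' - m\<bar>)"
      using scaled_flow_end_diff_le[OF \<alpha> \<alpha>] by simp
    have "((\<lambda>m'. exp ((\<bar>m\<bar> * \<Lambda> + 1) * H) * (M * \<bar>m' - m\<bar>)) \<longlongrightarrow>
        exp ((\<bar>m\<bar> * \<Lambda> + 1) * H) * (M * \<bar>m - m\<bar>)) (at m)"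
      by (intro tendsto_intros)
    then show "((\<lambda>m'. exp ((\<bar>m\<bar> * \<Lambda> + 1) * H) * (M * \<bar>m' - m\<bar>)) \<longlongrightarrow> 0) (at m)"
      by simp
  qed
  then show "isCont (\<lambda>m. \<alpha> m H) m"
    unfolding isCont_def using Lim_null by blast
qed

lemma scaled_flow_growth:
  assumes \<alpha>: "scaled_flow \<theta>0 m \<alpha>" and "0 \<le> m"
    and nonneg: "\<forall>\<^sub>F t in cocountable {0<..<H}. \<forall>\<theta>. 0 \<le> f t \<theta>"
    and lower: "0 \<le> l" "l \<le> r" "r \<le> H" "\<And>t \<theta>. t \<in> {l<..<r} \<Longrightarrow> c \<le> f t \<theta>"
  shows "\<theta>0 + m * c * (r - l) \<le> \<alpha> H"
proof -
  have cont: "continuous_on {u..v} \<alpha>" and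
    deriv: "\<forall>\<^sub>F x in cocountable {u<..<v}. (\<alpha> has_real_derivative m * f x (\<alpha> x)) (at x)"
    if "0 \<le> u" "v \<le> H" for u v
  proof -
    have "{u..v} \<subseteq> {0..H}" "{u<..<v} \<subseteq> {0<..<H}"
      using that by auto
    then show "continuous_on {u..v} \<alpha>"
      "\<forall>\<^sub>F x in cocountable {u<..<v}. (\<alpha> has_real_derivative m * f x (\<alpha> x)) (at x)"
      using \<alpha> unfolding scaled_flow_def by (auto intro: continuous_on_subset eventually_cocountable_subset)
  qed
  have mono: "\<alpha> u \<le> \<alpha> v" if uv: "0 \<le> u" "u \<le> v" "v \<le> H" for u v
  proof (rule le_of_nonneg_deriv[OF uv(2) cont[OF uv(1,3)]])
    have "\<forall>\<^sub>F x in cocountable {u<..<v}. \<forall>\<theta>. 0 \<le> f x \<theta>"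
      by (rule eventually_cocountable_subset[OF nonneg]) (use uv in auto)
    then show "\<forall>\<^sub>F x in cocountable {u<..<v}. \<exists>d\<ge>0. (\<alpha> has_real_derivative d) (at x)"
      using deriv[OF uv(1,3)] by eventually_elim (use \<open>0 \<le> m\<close> in \<open>auto intro: mult_nonneg_nonneg\<close>)
  qed
  let ?g = "\<lambda>x. \<alpha> x - m * c * x"
  have "?g l \<le> ?g r"
  proof (rule le_of_nonneg_deriv[OF lower(2)])
    show "continuous_on {l..r} ?g"
      by (intro continuous_intros cont lower)
    show "\<forall>\<^sub>F x in cocountable {l<..<r}. \<exists>d\<ge>0. (?g has_real_derivative d) (at x)"
      using deriv[OF lower(1,3)] eventually_in_cocountable
    proof eventually_elim
      case (elim x)
      have "(?g has_real_derivative m * f x (\<alpha> x) - m * c) (at x)"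
        using elim(1) by (auto intro!: derivative_eq_intros)
      moreover have "m * c \<le> m * f x (\<alpha> x)"
        using lower(4)[OF elim(2)] \<open>0 \<le> m\<close> by (intro mult_left_mono)
      ultimately show ?case
        by (intro exI[of _ "m * f x (\<alpha> x) - m * c"]) simp
    qed
  qed
  moreover have "\<alpha> 0 \<le> \<alpha> l" "\<alpha> r \<le> \<alpha> H" "\<alpha> 0 = \<theta>0"
    using \<alpha> lower by (auto intro!: mono simp: scaled_flow_def)
  ultimately show ?thesis
    by (simp add: algebra_simps)
qed

lemma scaled_flow_reaches:
  assumes "\<theta>0 < \<theta>1" and nonneg: "\<forall>\<^sub>F t in cocountable {0<..<H}. \<forall>\<theta>. 0 \<le> f t \<theta>"
    and lower: "0 \<le> l" "l < r" "r \<le> H" "0 < c" "\<And>t \<theta>. t \<in> {l<..<r} \<Longrightarrow> c \<le> f t \<theta>"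
  obtains m \<alpha> where "0 < m" "scaled_flow \<theta>0 m \<alpha>" "\<alpha> H = \<theta>1"
proof -
  obtain \<alpha> where \<alpha>: "\<And>m. scaled_flow \<theta>0 m (\<alpha> m)"
    using scaled_flow_exists by metis
  have "\<alpha> 0 H = \<theta>0"
  proof -
    have "0-lipschitz_on {0..H} (\<alpha> 0)"
      using \<alpha>[of 0] by (intro lipschitz_on_of_bounded_deriv) (auto simp: scaled_flow_def elim: eventually_mono)
    from lipschitz_onD[OF this, of H 0] show ?thesis
      using H \<alpha>[of 0] by (simp add: scaled_flow_def dist_real_def)
  qed
  define m1 where "m1 = (\<theta>1 - \<theta>0) / (c * (r - l))"
  have "0 < m1"
    using assms(1) lower by (simp add: m1_def)
  then have "\<theta>0 + m1 * c * (r - l) \<le> \<alpha> m1 H"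
    using lower by (intro scaled_flow_growth[OF \<alpha> _ nonneg]) auto
  then have "\<theta>1 \<le> \<alpha> m1 H"
    using lower by (simp add: m1_def)
  then obtain m where "0 \<le> m" "\<alpha> m H = \<theta>1"
    using IVT'[of "\<lambda>m. \<alpha> m H" 0 \<theta>1 m1] \<open>\<alpha> 0 H = \<theta>0\<close> assms(1) \<open>0 < m1\<close> scaled_flow_end_continuous[OF \<alpha>] by auto
  moreover from this have "m \<noteq> 0"
    using \<open>\<alpha> 0 H = \<theta>0\<close> assms(1) by auto
  ultimately show thesis
    using that \<alpha> by (auto simp: order_less_le)
qed

end

section \<open>A Pruefer angle along the boundary of a square\<close>

text \<open>The pair \<open>(square_y p, square_w p)\<close> runs around the boundary of \<open>[- 1, 1]\<^sup>2\<close> as the angle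
  increases from \<open>- 2 * q\<close> to \<open>2 * q\<close>, where \<open>q = p / (p - 1)\<close>: with speed \<open>1\<close> along \<open>w = 1\<close> and
  \<open>w = - 1\<close>, and with speed \<open>p - 1\<close> along \<open>y = 1\<close> and \<open>y = - 1\<close>. These are the speeds for which the
  equation of the angle has a Lipschitz continuous right-hand side.\<close>

definition square_y :: "real \<Rightarrow> real \<Rightarrow> real" where
  "square_y p \<theta> = clamp (- 1) 1 (\<bar>\<theta> + conjugate p\<bar> - \<bar>\<theta> - conjugate p\<bar> - \<theta>)"

definition square_w :: "real \<Rightarrow> real \<Rightarrow> real" where
  "square_w p \<theta> = clamp (- 1) 1 ((p - 1) * (conjugate p - \<bar>\<theta>\<bar>))"

definition square_y' :: "real \<Rightarrow> real \<Rightarrow> real" where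
  "square_y' p \<theta> = (if \<bar>square_y p \<theta>\<bar> = 1 then 0 else square_w p \<theta>)"

definition square_w' :: "real \<Rightarrow> real \<Rightarrow> real" where
  "square_w' p \<theta> = (if \<bar>square_y p \<theta>\<bar> = 1 then - (p - 1) * square_y p \<theta> else 0)"

lemma clamp_unit: "clamp (- 1) 1 x = max (- 1) (min 1 x)" for x :: real
  unfolding clamp_def Basis_real_def by (auto simp: min_def max_def)

lemma clamp_unit_lipschitz_on: "1-lipschitz_on S (clamp (- 1) (1::real))"
  by (rule lipschitz_onI) (simp_all add: dist_clamps_le_dist_args)

lemma square_abs_le: "\<bar>square_y p \<theta>\<bar> \<le> 1" "\<bar>square_w p \<theta>\<bar> \<le> 1"
  by (auto simp: square_y_def square_w_def clamp_unit)

lemma square_w_eq: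
  assumes "p > 1"
  shows "\<bar>\<theta>\<bar> \<le> 1 \<Longrightarrow> square_w p \<theta> = 1"
    and "1 \<le> \<bar>\<theta>\<bar> \<Longrightarrow> \<bar>\<theta>\<bar> \<le> 2 * conjugate p - 1 \<Longrightarrow> square_w p \<theta> = (p - 1) * (conjugate p - \<bar>\<theta>\<bar>)"
    and "2 * conjugate p - 1 \<le> \<bar>\<theta>\<bar> \<Longrightarrow> square_w p \<theta> = - 1"
proof -
  note q = conjugate_exponent(3)[OF assms]
  have mono: "(p - 1) * u \<le> (p - 1) * v" if "u \<le> v" for u v
    using that assms by simp
  have neg: "(p - 1) * - (conjugate p - 1) = - 1"
    using q by (simp only: mult_minus_right)
  show "square_w p \<theta> = 1" if "\<bar>\<theta>\<bar> \<le> 1"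
    using mono[of "conjugate p - 1" "conjugate p - \<bar>\<theta>\<bar>"] that
    unfolding q by (simp add: square_w_def clamp_unit)
  show "square_w p \<theta> = (p - 1) * (conjugate p - \<bar>\<theta>\<bar>)" if "1 \<le> \<bar>\<theta>\<bar>" "\<bar>\<theta>\<bar> \<le> 2 * conjugate p - 1"
    using mono[of "conjugate p - \<bar>\<theta>\<bar>" "conjugate p - 1"] mono[of "- (conjugate p - 1)" "conjugate p - \<bar>\<theta>\<bar>"] that
    unfolding q neg by (simp add: square_w_def clamp_unit)
  show "square_w p \<theta> = - 1" if "2 * conjugate p - 1 \<le> \<bar>\<theta>\<bar>"
    using mono[of "conjugate p - \<bar>\<theta>\<bar>" "- (conjugate p - 1)"] that
    unfolding neg by (simp add: square_w_def clamp_unit)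
qed

lemma square_y_eq:
  assumes "p > 1"
  shows "\<bar>\<theta>\<bar> \<le> 1 \<Longrightarrow> square_y p \<theta> = \<theta>"
    and "1 \<le> \<bar>\<theta>\<bar> \<Longrightarrow> \<bar>\<theta>\<bar> \<le> 2 * conjugate p - 1 \<Longrightarrow> square_y p \<theta> = sgn \<theta>"
    and "2 * conjugate p - 1 \<le> \<bar>\<theta>\<bar> \<Longrightarrow> \<bar>\<theta>\<bar> \<le> 2 * conjugate p \<Longrightarrow> square_y p \<theta> = sgn \<theta> * (2 * conjugate p - \<bar>\<theta>\<bar>)"
proof -
  define q where "q = conjugate p"
  have q: "q > 1"
    unfolding q_def by (rule conjugate_exponent(1)[OF assms])
  have eq: "square_y p \<theta> = max (- 1) (min 1 (\<bar>\<theta> + q\<bar> - \<bar>\<theta> - q\<bar> - \<theta>))"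
    by (simp only: square_y_def clamp_unit q_def)
  show "square_y p \<theta> = \<theta>" if "\<bar>\<theta>\<bar> \<le> 1"
    unfolding eq using that q by (simp add: abs_if min_def max_def split: if_splits)
  show "square_y p \<theta> = sgn \<theta>" if "1 \<le> \<bar>\<theta>\<bar>" "\<bar>\<theta>\<bar> \<le> 2 * conjugate p - 1"
    unfolding eq using that[folded q_def] q by (auto simp: abs_if sgn_if min_def max_def split: if_splits)
  show "square_y p \<theta> = sgn \<theta> * (2 * conjugate p - \<bar>\<theta>\<bar>)"
    if "2 * conjugate p - 1 \<le> \<bar>\<theta>\<bar>" "\<bar>\<theta>\<bar> \<le> 2 * conjugate p"
    unfolding eq q_def[symmetric] using that[folded q_def] q
    by (auto simp: abs_if sgn_if min_def max_def split: if_splits)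
qed

lemma square_max:
  assumes "p > 1"
  shows "\<bar>square_y p \<theta>\<bar> = 1 \<or> \<bar>square_w p \<theta>\<bar> = 1"
proof -
  consider "\<bar>\<theta>\<bar> \<le> 1" | "1 \<le> \<bar>\<theta>\<bar>" "\<bar>\<theta>\<bar> \<le> 2 * conjugate p - 1" | "2 * conjugate p - 1 \<le> \<bar>\<theta>\<bar>"
    by linarith
  then show ?thesis
  proof cases
    case 2
    then have "\<theta> \<noteq> 0"
      by auto
    then show ?thesis
      by (simp add: square_y_eq(2)[OF assms 2] abs_sgn_eq)
  qed (simp_all add: square_w_eq[OF assms])
qed

lemma abs_square_y_eq_1_iff:
  assumes "p > 1" "\<bar>\<theta>\<bar> < 2 * conjugate p"
  shows "\<bar>square_y p \<theta>\<bar> = 1 \<longleftrightarrow> 1 \<le> \<bar>\<theta>\<bar> \<and> \<bar>\<theta>\<bar> \<le> 2 * conjugate p - 1"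
proof -
  consider "\<bar>\<theta>\<bar> < 1" | "1 \<le> \<bar>\<theta>\<bar>" "\<bar>\<theta>\<bar> \<le> 2 * conjugate p - 1" | "2 * conjugate p - 1 < \<bar>\<theta>\<bar>"
    by linarith
  then show ?thesis
    by cases (use assms(2) conjugate_exponent(1)[OF assms(1)] in
        \<open>auto simp: square_y_eq[OF assms(1)] abs_mult abs_sgn_eq\<close>)
qed

lemma square_y_eq_0_iff:
  assumes "p > 1" "\<bar>\<theta>\<bar> \<le> 2 * conjugate p"
  shows "square_y p \<theta> = 0 \<longleftrightarrow> \<theta> \<in> {- 2 * conjugate p, 0, 2 * conjugate p}"
proof -
  define q where "q = conjugate p"
  have q: "q > 1" "\<bar>\<theta>\<bar> \<le> 2 * q"
    using conjugate_exponent(1)[OF assms(1)] assms(2) by (simp_all only: q_def)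
  note eq = square_y_eq[OF assms(1), of \<theta>, folded q_def]
  have "square_y p \<theta> = 0 \<longleftrightarrow> \<theta> \<in> {- 2 * q, 0, 2 * q}"
  proof (cases "\<bar>\<theta>\<bar> \<le> 2 * q - 1")
    case True
    then show ?thesis
      using eq(1,2) q by (cases "\<bar>\<theta>\<bar> \<le> 1") (auto simp: sgn_eq_0_iff)
  next
    case False
    then have "square_y p \<theta> = sgn \<theta> * (2 * q - \<bar>\<theta>\<bar>)"
      using eq(3) q(2) by simp
    then show ?thesis
      using False q by (auto simp: sgn_eq_0_iff)
  qed
  then show ?thesis
    by (simp only: q_def)
qed

lemma square_lipschitz_on:
  assumes "p > 1"
  shows "3-lipschitz_on UNIV (square_y p)" "(p - 1)-lipschitz_on UNIV (square_w p)"
proof -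
  let ?f = "\<lambda>\<theta>. \<bar>\<theta> + conjugate p\<bar> - \<bar>\<theta> - conjugate p\<bar> - \<theta>" and ?g = "\<lambda>\<theta>. (p - 1) * (conjugate p - \<bar>\<theta>\<bar>)"
  have "(1 + 1 + 1)-lipschitz_on UNIV ?f"
    by (intro lipschitz_on_diff) (rule lipschitz_onI; auto simp: dist_real_def)+
  then have "3-lipschitz_on UNIV ?f"
    by simp
  from lipschitz_on_compose2[OF this clamp_unit_lipschitz_on] show "3-lipschitz_on UNIV (square_y p)"
    by (simp add: square_y_def[abs_def])
  have "1-lipschitz_on UNIV (\<lambda>\<theta>. conjugate p - \<bar>\<theta>\<bar>)"
    by (rule lipschitz_onI) (auto simp: dist_real_def)
  from lipschitz_on_cmult_real[OF this, of "p - 1"] have "(p - 1)-lipschitz_on UNIV ?g"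
    using assms by simp
  from lipschitz_on_compose2[OF this clamp_unit_lipschitz_on] show "(p - 1)-lipschitz_on UNIV (square_w p)"
    by (simp add: square_w_def[abs_def])
qed

lemma square_continuous_on:
  assumes "p > 1"
  shows "continuous_on S (square_y p)" "continuous_on S (square_w p)"
  using square_lipschitz_on[OF assms] continuous_on_subset[OF lipschitz_on_continuous_on] by blast+

lemma square_abs_powr_lipschitz_on:
  assumes "p > 1"
  shows "(p * 3)-lipschitz_on UNIV (\<lambda>\<theta>. \<bar>square_y p \<theta>\<bar> powr p)"
    and "p-lipschitz_on UNIV (\<lambda>\<theta>. \<bar>square_w p \<theta>\<bar> powr conjugate p)"
proof -
  have range: "range (square_y p) \<subseteq> {- 1..1}" "range (square_w p) \<subseteq> {- 1..1}"
    using square_abs_le by (auto simp: abs_le_iff minus_le_iff)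
  show "(p * 3)-lipschitz_on UNIV (\<lambda>\<theta>. \<bar>square_y p \<theta>\<bar> powr p)"
    by (rule lipschitz_on_compose2[OF square_lipschitz_on(1)[OF assms]
          lipschitz_on_subset[OF abs_powr_lipschitz_on_unit[OF assms] range(1)]])
  have "(conjugate p * (p - 1))-lipschitz_on UNIV (\<lambda>\<theta>. \<bar>square_w p \<theta>\<bar> powr conjugate p)"
    by (rule lipschitz_on_compose2[OF square_lipschitz_on(2)[OF assms]
          lipschitz_on_subset[OF abs_powr_lipschitz_on_unit[OF conjugate_exponent(1)[OF assms]] range(2)]])
  then show "p-lipschitz_on UNIV (\<lambda>\<theta>. \<bar>square_w p \<theta>\<bar> powr conjugate p)"
    using assms by simp
qed

lemma has_real_derivative_of_affine:
  fixes f :: "real \<Rightarrow> real"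
  assumes "\<And>x. x \<in> {l<..<r} \<Longrightarrow> f x = a + b * x" "x \<in> {l<..<r}"
  shows "(f has_real_derivative b) (at x)"
proof -
  have "((\<lambda>x. a + b * x) has_real_derivative b) (at x)"
    by (auto intro!: derivative_eq_intros)
  then show ?thesis
    by (rule has_field_derivative_transform_within_open[OF _ open_greaterThanLessThan assms(2)])
      (simp add: assms(1))
qed

lemma square_deriv:
  assumes "p > 1" and \<theta>: "\<bar>\<theta>\<bar> < 2 * conjugate p" "\<bar>\<theta>\<bar> \<noteq> 1" "\<bar>\<theta>\<bar> \<noteq> 2 * conjugate p - 1"
  shows "(square_y p has_real_derivative square_y' p \<theta>) (at \<theta>) \<and>
    (square_w p has_real_derivative square_w' p \<theta>) (at \<theta>)"
proof -
  let ?q = "conjugate p"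
  note eq = square_y_eq[OF \<open>p > 1\<close>] square_w_eq[OF \<open>p > 1\<close>]
  have affine: ?thesis
    if "\<theta> \<in> {l<..<r}" "\<And>x. x \<in> {l<..<r} \<Longrightarrow> square_y p x = a + b * x"
      "\<And>x. x \<in> {l<..<r} \<Longrightarrow> square_w p x = c + d * x" "square_y' p \<theta> = b" "square_w' p \<theta> = d" for l r a b c d
    using has_real_derivative_of_affine[OF that(2,1)] has_real_derivative_of_affine[OF that(3,1)] that(4,5)
    by simp
  consider "\<theta> \<in> {- 1<..<1}" | "\<theta> \<in> {1<..<2 * ?q - 1}" | "\<theta> \<in> {2 * ?q - 1<..<2 * ?q}"
    | "\<theta> \<in> {1 - 2 * ?q<..<- 1}" | "\<theta> \<in> {- 2 * ?q<..<1 - 2 * ?q}"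
    using \<theta> by (fastforce simp: abs_if split: if_splits)
  then show ?thesis
  proof cases
    case 1
    then show ?thesis
      by (intro affine[OF 1, of 0 1 1 0]) (auto simp: square_y'_def square_w'_def eq)
  next
    case 2
    then show ?thesis
      by (intro affine[OF 2, of 1 0 "(p - 1) * ?q" "- (p - 1)"])
        (auto simp: square_y'_def square_w'_def eq algebra_simps)
  next
    case 3
    then show ?thesis
      using conjugate_exponent(1)[OF \<open>p > 1\<close>]
      by (intro affine[OF 3, of "2 * ?q" "- 1" "- 1" 0]) (auto simp: square_y'_def square_w'_def eq)
  next
    case 4
    then show ?thesis
      by (intro affine[OF 4, of "- 1" 0 "(p - 1) * ?q" "p - 1"])
        (auto simp: square_y'_def square_w'_def eq distrib_left)
  next
    case 5
    then show ?thesis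
      using conjugate_exponent(1)[OF \<open>p > 1\<close>]
      by (intro affine[OF 5, of "- 2 * ?q" "- 1" "- 1" 0]) (auto simp: square_y'_def square_w'_def eq)
  qed
qed

lemma square_deriv_cross:
  assumes "p > 1"
  shows "(p - 1) * (square_w p \<theta> * square_y' p \<theta>) - square_y p \<theta> * square_w' p \<theta> = p - 1"
proof (cases "\<bar>square_y p \<theta>\<bar> = 1")
  case True
  then have "square_y p \<theta> * square_y p \<theta> = 1"
    by (metis abs_mult_self_eq mult_1)
  then show ?thesis
    using True by (simp add: square_y'_def square_w'_def algebra_simps)
next
  case False
  then have "square_w p \<theta> * square_w p \<theta> = 1"
    using square_max[OF assms] by (metis abs_mult_self_eq mult_1)
  then show ?thesis
    using False by (simp add: square_y'_def square_w'_def)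
qed

lemma square_edge_neighbourhood:
  assumes "p > 1" and \<theta>: "\<bar>\<theta>\<bar> < 2 * conjugate p" "\<bar>\<theta>\<bar> \<noteq> 1" "\<bar>\<theta>\<bar> \<noteq> 2 * conjugate p - 1"
  obtains S where "open S" "\<theta> \<in> S" "\<And>\<eta>. \<eta> \<in> S \<Longrightarrow> \<bar>square_y p \<eta>\<bar> = 1 \<longleftrightarrow> \<bar>square_y p \<theta>\<bar> = 1"
proof -
  have open_abs: "open {\<eta>. a < \<bar>\<eta>\<bar> \<and> \<bar>\<eta>\<bar> < b}" for a b :: real
    by (intro open_Collect_conj open_Collect_less continuous_intros)
  note iff = abs_square_y_eq_1_iff[OF \<open>p > 1\<close>]
  have q: "conjugate p > 1"
    by (rule conjugate_exponent(1)[OF \<open>p > 1\<close>])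
  consider "\<bar>\<theta>\<bar> < 1" | "1 < \<bar>\<theta>\<bar>" "\<bar>\<theta>\<bar> < 2 * conjugate p - 1" | "2 * conjugate p - 1 < \<bar>\<theta>\<bar>"
    using \<theta> by linarith
  then show thesis
  proof cases
    case 1
    then show ?thesis
      using q by (intro that[OF open_abs[of "- 1" 1]]) (auto simp: iff)
  next
    case 2
    then show ?thesis
      using q by (intro that[OF open_abs[of 1 "2 * conjugate p - 1"]]) (auto simp: iff)
  next
    case 3
    then show ?thesis
      using q \<theta>(1) by (intro that[OF open_abs[of "2 * conjugate p - 1" "2 * conjugate p"]]) (auto simp: iff)
  qed
qed

lemma polar_velocity:
  fixes p r y w y' w' a b g :: real
  assumes "p > 1" and cross: "(p - 1) * (w * y') - y * w' = p - 1"
    and g: "(p - 1) * g = - (a * w' + (p - 1) * (r * (b * y')))"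
  shows "g * y + y' * (w * a + r * (y * b)) = a"
    and "(p - 1) * g * w + w' * (w * a + r * (y * b)) = - (p - 1) * (r * b)"
proof -
  have "(p - 1) * (g * y + y' * (w * a + r * (y * b))) = ((p - 1) * g) * y + (p - 1) * (y' * (w * a + r * (y * b)))"
    by (simp only: distrib_left mult_ac)
  also have "\<dots> = a * ((p - 1) * (w * y') - y * w')"
    unfolding g by (simp add: algebra_simps)
  finally show "g * y + y' * (w * a + r * (y * b)) = a"
    using \<open>p > 1\<close> unfolding cross by (simp add: mult.commute)
  have "(p - 1) * g * w + w' * (w * a + r * (y * b)) = - r * b * ((p - 1) * (w * y') - y * w')"
    unfolding g by (simp add: algebra_simps)
  then show "(p - 1) * g * w + w' * (w * a + r * (y * b)) = - (p - 1) * (r * b)"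
    unfolding cross by (simp add: algebra_simps)
qed

lemma polar_deriv:
  fixes s \<alpha> Y w :: "real \<Rightarrow> real"
  assumes "p > 1" "m > 0" "s x > 0"
    and s: "(s has_real_derivative m * g * s x) (at x)"
    and \<alpha>: "(\<alpha> has_real_derivative m * (\<bar>w (\<alpha> x)\<bar> powr conjugate p + r * \<bar>Y (\<alpha> x)\<bar> powr p)) (at x)"
    and Y: "(Y has_real_derivative Y') (at (\<alpha> x))" and w: "(w has_real_derivative w') (at (\<alpha> x))"
    and cross: "(p - 1) * (w (\<alpha> x) * Y') - Y (\<alpha> x) * w' = p - 1"
    and g: "(p - 1) * g = - (signed_pow (conjugate p) (w (\<alpha> x)) * w' + (p - 1) * (r * (signed_pow p (Y (\<alpha> x)) * Y')))"
  shows "((\<lambda>x. s x * Y (\<alpha> x)) has_real_derivative m * s x * signed_pow (conjugate p) (w (\<alpha> x))) (at x)"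
    and "((\<lambda>x. (m * s x) powr (p - 1) * w (\<alpha> x)) has_real_derivative
      - (p - 1) * (m powr p * r) * signed_pow p (s x * Y (\<alpha> x))) (at x)"
proof -
  note velocity = polar_velocity[OF \<open>p > 1\<close> cross g]
  have \<alpha>: "(\<alpha> has_real_derivative
      m * (w (\<alpha> x) * signed_pow (conjugate p) (w (\<alpha> x)) + r * (Y (\<alpha> x) * signed_pow p (Y (\<alpha> x))))) (at x)"
    (is "(\<alpha> has_real_derivative m * ?N) (at x)")
    using \<alpha> by (simp add: mult_signed_pow)
  have "((\<lambda>x. s x * Y (\<alpha> x)) has_real_derivative m * g * s x * Y (\<alpha> x) + Y' * (m * ?N) * s x) (at x)"
    by (rule DERIV_mult[OF s DERIV_chain2[OF Y \<alpha>]])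
  also have "m * g * s x * Y (\<alpha> x) + Y' * (m * ?N) * s x = m * s x * (g * Y (\<alpha> x) + Y' * ?N)"
    by (simp add: algebra_simps)
  finally show "((\<lambda>x. s x * Y (\<alpha> x)) has_real_derivative m * s x * signed_pow (conjugate p) (w (\<alpha> x))) (at x)"
    unfolding velocity(1) .
  have ms: "m * s x > 0"
    using assms(2,3) by simp
  let ?P = "(m * s x) powr (p - 1)"
  have "((\<lambda>x. (m * s x) powr (p - 1)) has_real_derivative
      (p - 1) * (m * s x) powr (p - 1 - 1) * (m * (m * g * s x))) (at x)"
    by (rule DERIV_chain2[OF has_real_derivative_powr[OF ms] DERIV_cmult[OF s]])
  also have "(p - 1) * (m * s x) powr (p - 1 - 1) * (m * (m * g * s x)) = (p - 1) * g * m * ?P"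
    using powr_mult_base[of "m * s x" "p - 1 - 1"] ms by (simp add: mult_ac)
  finally have "((\<lambda>x. (m * s x) powr (p - 1) * w (\<alpha> x)) has_real_derivative
      (p - 1) * g * m * ?P * w (\<alpha> x) + w' * (m * ?N) * ?P) (at x)"
    by (rule DERIV_mult[OF _ DERIV_chain2[OF w \<alpha>]])
  also have "(p - 1) * g * m * ?P * w (\<alpha> x) + w' * (m * ?N) * ?P = m * ?P * ((p - 1) * g * w (\<alpha> x) + w' * ?N)"
    by (simp add: algebra_simps)
  also have "\<dots> = - (p - 1) * (m powr p * r) * signed_pow p (s x * Y (\<alpha> x))"
    unfolding velocity(2) using assms(2,3) powr_mult_base[of m "p - 1"]
    by (simp add: powr_mult signed_pow_mult signed_pow_of_nonneg flip: mult.assoc)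
  finally show "((\<lambda>x. (m * s x) powr (p - 1) * w (\<alpha> x)) has_real_derivative
      - (p - 1) * (m powr p * r) * signed_pow p (s x * Y (\<alpha> x))) (at x)" .
qed

locale pruefer_angle =
  fixes p H m :: real and \<rho> \<alpha> :: "real \<Rightarrow> real"
  assumes p: "p > 1" and H: "H > 0" and m: "m > 0" and \<rho>: "regular_density H \<rho>"
    and \<alpha>_cont: "continuous_on {0..H} \<alpha>"
    and \<alpha>_ends: "- 2 * conjugate p \<le> \<alpha> 0" "\<alpha> H \<le> 2 * conjugate p"
    and \<alpha>_deriv: "\<forall>\<^sub>F x in cocountable {0<..<H}. (\<alpha> has_real_derivative
      m * (\<bar>square_w p (\<alpha> x)\<bar> powr conjugate p + \<rho> x * \<bar>square_y p (\<alpha> x)\<bar> powr p)) (at x)"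
begin

lemmas q = conjugate_exponent[OF p]

lemma \<alpha>_deriv_pos: "\<forall>\<^sub>F x in cocountable {0<..<H}. \<exists>d>0. (\<alpha> has_real_derivative d) (at x)"
  using \<alpha>_deriv regular_densityD(2)[OF \<rho>]
proof eventually_elim
  case (elim x)
  have "0 < \<bar>square_w p (\<alpha> x)\<bar> powr conjugate p + \<rho> x * \<bar>square_y p (\<alpha> x)\<bar> powr p"
    using square_max[OF p, of "\<alpha> x"] elim(2) by (auto simp: add_nonneg_pos add_pos_nonneg)
  with elim(1) m show ?case
    by (meson mult_pos_pos)
qed

lemma \<alpha>_less:
  assumes "0 \<le> x" "x < y" "y \<le> H"
  shows "\<alpha> x < \<alpha> y"
proof (rule less_of_pos_deriv[OF assms(2)])
  have "{x..y} \<subseteq> {0..H}" "{x<..<y} \<subseteq> {0<..<H}"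
    using assms by auto
  then show "continuous_on {x..y} \<alpha>"
    "\<forall>\<^sub>F x in cocountable {x<..<y}. \<exists>d>0. (\<alpha> has_real_derivative d) (at x)"
    using \<alpha>_cont \<alpha>_deriv_pos by (auto intro: continuous_on_subset eventually_cocountable_subset)
qed

lemma \<alpha>_strict_mono: "strict_mono_on {0..H} \<alpha>"
  by (rule strict_mono_onI) (use \<alpha>_less in auto)

lemma abs_\<alpha>_le: "x \<in> {0..H} \<Longrightarrow> \<bar>\<alpha> x\<bar> \<le> 2 * conjugate p"
  using strict_mono_on_leD[OF \<alpha>_strict_mono, of 0 x] strict_mono_on_leD[OF \<alpha>_strict_mono, of x H] \<alpha>_ends H
  by (auto simp: abs_le_iff)

lemma abs_\<alpha>_less: "x \<in> {0<..<H} \<Longrightarrow> \<bar>\<alpha> x\<bar> < 2 * conjugate p"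
  using \<alpha>_less[of 0 x] \<alpha>_less[of x H] \<alpha>_ends by (auto simp: abs_less_iff)

lemma off_corners: "\<forall>\<^sub>F x in cocountable {0<..<H}. \<bar>\<alpha> x\<bar> \<noteq> 1 \<and> \<bar>\<alpha> x\<bar> \<noteq> 2 * conjugate p - 1"
proof -
  have "finite (\<alpha> -` {1, - 1, 2 * conjugate p - 1, 1 - 2 * conjugate p} \<inter> {0..H})"
    by (intro finite_vimage_IntI strict_mono_on_imp_inj_on[OF \<alpha>_strict_mono]) simp
  then have "countable (\<alpha> -` {1, - 1, 2 * conjugate p - 1, 1 - 2 * conjugate p} \<inter> {0..H})"
    by (rule countable_finite)
  then show ?thesis
    unfolding eventually_cocountable
    by (rule countable_subset[rotated]) (auto simp: abs_if split: if_splits)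
qed

definition growth :: "real \<Rightarrow> real" where
  "growth x = (if \<bar>square_y p (\<alpha> x)\<bar> = 1
     then signed_pow (conjugate p) (square_w p (\<alpha> x)) * square_y p (\<alpha> x)
     else - \<rho> x * (signed_pow p (square_y p (\<alpha> x)) * square_w p (\<alpha> x)))"

lemma growth_bounded:
  obtains C where "\<And>x. x \<in> {0..H} \<Longrightarrow> \<bar>growth x\<bar> \<le> C"
proof -
  obtain B where B: "B \<ge> 0" "\<And>x. x \<in> {0..H} \<Longrightarrow> \<bar>\<rho> x\<bar> \<le> B"
    using regular_densityE[OF \<rho>] by blast
  have "\<bar>growth x\<bar> \<le> 1 + B" if "x \<in> {0..H}" for x
  proof -
    have "\<bar>signed_pow (conjugate p) (square_w p (\<alpha> x)) * square_y p (\<alpha> x)\<bar> \<le> 1 * 1"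
      unfolding abs_mult by (intro mult_mono abs_signed_pow_le_one q(1) square_abs_le) auto
    moreover have "\<bar>\<rho> x\<bar> * (\<bar>signed_pow p (square_y p (\<alpha> x))\<bar> * \<bar>square_w p (\<alpha> x)\<bar>) \<le> B * (1 * 1)"
      using B that by (intro mult_mono abs_signed_pow_le_one p square_abs_le) auto
    ultimately show ?thesis
      using B(1) by (auto simp: growth_def abs_mult)
  qed
  then show thesis
    using that by blast
qed

lemma \<alpha>_isCont: "x \<in> {0<..<H} \<Longrightarrow> isCont \<alpha> x"
  using continuous_on_interior[OF \<alpha>_cont] by simp

lemma square_\<alpha>_isCont:
  assumes "x \<in> {0<..<H}"
  shows "isCont (\<lambda>x. square_y p (\<alpha> x)) x" "isCont (\<lambda>x. square_w p (\<alpha> x)) x"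
  using isCont_o2[OF \<alpha>_isCont[OF assms]] square_continuous_on[OF p, of UNIV]
  by (auto simp: continuous_on_eq_continuous_at)

lemma growth_isCont: "\<forall>\<^sub>F x in cocountable {0<..<H}. isCont growth x"
  using regular_densityD(1)[OF \<rho>] off_corners eventually_in_cocountable
proof eventually_elim
  case (elim x)
  obtain S where S: "open S" "\<alpha> x \<in> S"
    "\<And>\<eta>. \<eta> \<in> S \<Longrightarrow> \<bar>square_y p \<eta>\<bar> = 1 \<longleftrightarrow> \<bar>square_y p (\<alpha> x)\<bar> = 1"
    using square_edge_neighbourhood[OF p abs_\<alpha>_less[OF elim(3)]] elim(2) by blast
  have near: "\<forall>\<^sub>F t in nhds x. \<alpha> t \<in> S"
    using \<alpha>_isCont[OF elim(3)] S(1,2) by (intro topological_tendstoD) (simp_all add: isCont_def tendsto_at_iff_tendsto_nhds)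
  note cont = square_\<alpha>_isCont[OF elim(3)]
  have pow: "isCont (\<lambda>x. signed_pow r (h x)) x" if "r > 1" "isCont h x" for r and h :: "real \<Rightarrow> real"
    by (rule isCont_o2[OF that(2) isCont_signed_pow[OF that(1)]])
  show ?case
  proof (cases "\<bar>square_y p (\<alpha> x)\<bar> = 1")
    case True
    have "\<forall>\<^sub>F t in nhds x. growth t = signed_pow (conjugate p) (square_w p (\<alpha> t)) * square_y p (\<alpha> t)"
      using near by eventually_elim (use S(3) True in \<open>simp add: growth_def\<close>)
    then show ?thesis
      using isCont_cong by (fastforce intro!: continuous_intros pow q(1) cont)
  next
    case False
    have "\<forall>\<^sub>F t in nhds x. growth t = - \<rho> t * (signed_pow p (square_y p (\<alpha> t)) * square_w p (\<alpha> t))"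
      using near by eventually_elim (use S(3) False in \<open>simp add: growth_def\<close>)
    then show ?thesis
      using isCont_cong by (fastforce intro!: continuous_intros pow p cont elim(1))
  qed
qed

definition radius :: "real \<Rightarrow> real" where
  "radius x = exp (m * integral {0..x} growth)"

lemma radius_pos: "radius x > 0"
  by (simp add: radius_def)

lemma radius_continuous_on: "continuous_on {0..H} radius"
  and radius_deriv: "\<forall>\<^sub>F x in cocountable {0<..<H}. (radius has_real_derivative m * growth x * radius x) (at x)"
proof -
  obtain C where C: "\<And>x. x \<in> {0..H} \<Longrightarrow> \<bar>growth x\<bar> \<le> C"
    using growth_bounded by blast
  have cont: "continuous_on {0..H} (\<lambda>x. integral {0..x} growth)"
    by (rule has_real_derivative_indefinite_integral(1)[OF C growth_isCont])
  have deriv: "\<forall>\<^sub>F x in cocountable {0<..<H}. ((\<lambda>x. integral {0..x} growth) has_real_derivative growth x) (at x)"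
    by (rule has_real_derivative_indefinite_integral(2)[OF C growth_isCont])
  show "continuous_on {0..H} radius"
    unfolding radius_def by (intro continuous_intros cont)
  show "\<forall>\<^sub>F x in cocountable {0<..<H}. (radius has_real_derivative m * growth x * radius x) (at x)"
    using deriv
  proof eventually_elim
    case (elim x)
    from DERIV_chain2[OF DERIV_exp DERIV_cmult[OF elim, of m]] show ?case
      by (simp add: radius_def[abs_def] mult_ac)
  qed
qed

definition sol_y :: "real \<Rightarrow> real" where
  "sol_y x = radius x * square_y p (\<alpha> x)"

definition sol_\<phi> :: "real \<Rightarrow> real" where
  "sol_\<phi> x = (m * radius x) powr (p - 1) * square_w p (\<alpha> x)"

lemma signed_pow_sol_\<phi>:
  "signed_pow (conjugate p) (sol_\<phi> x) = m * radius x * signed_pow (conjugate p) (square_w p (\<alpha> x))"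
proof -
  have "(m * radius x) powr (p - 1) = signed_pow p (m * radius x)"
    using m radius_pos by (simp add: signed_pow_of_nonneg less_imp_le)
  then show ?thesis
    using signed_pow_signed_pow[OF q(3), of "m * radius x"] by (simp add: sol_\<phi>_def signed_pow_mult)
qed

lemma sol_deriv:
  "\<forall>\<^sub>F x in cocountable {0<..<H}. (sol_y has_real_derivative signed_pow (conjugate p) (sol_\<phi> x)) (at x) \<and>
     (sol_\<phi> has_real_derivative - (p - 1) * (m powr p * \<rho> x) * signed_pow p (sol_y x)) (at x)"
  using radius_deriv \<alpha>_deriv off_corners eventually_in_cocountable
proof eventually_elim
  case (elim x)
  let ?a = "signed_pow (conjugate p) (square_w p (\<alpha> x))" and ?b = "signed_pow p (square_y p (\<alpha> x))"
  have deriv: "(square_y p has_real_derivative square_y' p (\<alpha> x)) (at (\<alpha> x))"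
    "(square_w p has_real_derivative square_w' p (\<alpha> x)) (at (\<alpha> x))"
    using square_deriv[OF p abs_\<alpha>_less[OF elim(4)]] elim(3) by auto
  have "(p - 1) * growth x = - (?a * square_w' p (\<alpha> x) + (p - 1) * (\<rho> x * (?b * square_y' p (\<alpha> x))))"
    by (simp add: growth_def square_y'_def square_w'_def algebra_simps)
  note polar_deriv[OF p m radius_pos elim(1,2) deriv square_deriv_cross[OF p] this]
  then show ?case
    unfolding signed_pow_sol_\<phi> by (simp add: sol_y_def[abs_def] sol_\<phi>_def[abs_def])
qed

lemma regular_solution: "regular_solution p (\<lambda>x. m powr p * \<rho> x) 0 H sol_y sol_\<phi>"
proof -
  have square_cont: "continuous_on {0..H} (\<lambda>x. square_y p (\<alpha> x))" "continuous_on {0..H} (\<lambda>x. square_w p (\<alpha> x))"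
    by (intro continuous_on_compose2[OF square_continuous_on(1)[OF p] \<alpha>_cont subset_UNIV]
        continuous_on_compose2[OF square_continuous_on(2)[OF p] \<alpha>_cont subset_UNIV])+
  have y_cont: "continuous_on {0..H} sol_y"
    unfolding sol_y_def by (intro continuous_intros radius_continuous_on square_cont)
  have \<phi>_cont: "continuous_on {0..H} sol_\<phi>"
    unfolding sol_\<phi>_def using m radius_pos[THEN less_imp_neq]
    by (intro continuous_intros radius_continuous_on square_cont) auto
  have "(sol_y has_real_derivative signed_pow (conjugate p) (sol_\<phi> x)) (at x within {0..H})" if "x \<in> {0..H}" for x
    by (rule has_real_derivative_of_continuous_deriv[OF y_cont _ _ that])
      (use sol_deriv q(1) \<phi>_cont in \<open>auto intro!: continuous_on_signed_pow elim: eventually_mono\<close>)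
  then show ?thesis
    unfolding regular_solution_def using \<phi>_cont sol_deriv by (auto elim: eventually_mono)
qed

lemma sol_y_eq_0_iff: "x \<in> {0..H} \<Longrightarrow> sol_y x = 0 \<longleftrightarrow> \<alpha> x \<in> {- 2 * conjugate p, 0, 2 * conjugate p}"
  using square_y_eq_0_iff[OF p abs_\<alpha>_le] radius_pos[of x] by (simp add: sol_y_def)

end

lemma regular_density_lower_bound:
  assumes "H > 0" "regular_density H \<rho>"
  obtains l r c where "0 \<le> l" "l < r" "r \<le> H" "0 < c" "\<And>x. x \<in> {l<..<r} \<Longrightarrow> c \<le> \<rho> x"
proof -
  obtain x where x: "x \<in> {0<..<H}" "isCont \<rho> x" "0 < \<rho> x"
    using eventually_cocountable_obtains[OF eventually_conj[OF regular_densityD[OF assms(2)]] assms(1)] by blast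
  have "\<forall>\<^sub>F t in nhds x. \<rho> x / 2 < \<rho> t"
    using x(2,3) by (intro order_tendstoD(1)[of \<rho> "\<rho> x"]) (simp_all add: isCont_def tendsto_at_iff_tendsto_nhds)
  then obtain d where d: "d > 0" "\<And>t. dist t x < d \<Longrightarrow> \<rho> x / 2 < \<rho> t"
    by (auto simp: eventually_nhds_metric)
  show thesis
  proof (rule that[of x "min H (x + d)" "\<rho> x / 2"])
    show "\<rho> x / 2 \<le> \<rho> t" if "t \<in> {x<..<min H (x + d)}" for t
      using d(2)[of t] that by (auto simp: dist_real_def)
  qed (use x d(1) in auto)
qed

lemma pruefer_lipschitz_field:
  assumes "p > 1" "H > 0" and \<rho>: "regular_density H \<rho>"
  obtains M \<Lambda> where
    "lipschitz_field H M \<Lambda> (\<lambda>t \<theta>. \<bar>square_w p \<theta>\<bar> powr conjugate p + \<rho> t * \<bar>square_y p \<theta>\<bar> powr p)"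
proof -
  let ?u = "\<lambda>\<theta>. \<bar>square_w p \<theta>\<bar> powr conjugate p" and ?v = "\<lambda>\<theta>. \<bar>square_y p \<theta>\<bar> powr p"
  note q = conjugate_exponent(1)[OF \<open>p > 1\<close>]
  obtain B where B: "B \<ge> 0" "\<And>x. x \<in> {0..H} \<Longrightarrow> \<bar>\<rho> x\<bar> \<le> B"
    using regular_densityE[OF \<rho>] by blast
  have unit: "0 \<le> ?u \<theta>" "?u \<theta> \<le> 1" "0 \<le> ?v \<theta>" "?v \<theta> \<le> 1" for \<theta>
    using powr_mono2[of "conjugate p" "\<bar>square_w p \<theta>\<bar>" 1] powr_mono2[of p "\<bar>square_y p \<theta>\<bar>" 1]
      square_abs_le[where p = p and \<theta> = \<theta>] q \<open>p > 1\<close> by auto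
  note lip = square_abs_powr_lipschitz_on[OF \<open>p > 1\<close>]
  have "lipschitz_field H (1 + B) (p + B * (p * 3)) (\<lambda>t \<theta>. ?u \<theta> + \<rho> t * ?v \<theta>)"
  proof
    show "\<bar>?u \<theta> + \<rho> t * ?v \<theta>\<bar> \<le> 1 + B" if "t \<in> {0..H}" for t \<theta>
    proof -
      have "\<bar>\<rho> t * ?v \<theta>\<bar> \<le> B * 1"
        unfolding abs_mult using B that unit(3,4) by (intro mult_mono) auto
      then show ?thesis
        using unit(1,2)[of \<theta>] by linarith
    qed
    show "(p + B * (p * 3))-lipschitz_on UNIV (\<lambda>\<theta>. ?u \<theta> + \<rho> t * ?v \<theta>)" if "t \<in> {0..H}" for t
    proof (rule lipschitz_on_mono[OF lipschitz_on_add[OF lip(2) lipschitz_on_cmult_real[OF lip(1)]] order_refl])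
      show "p + \<bar>\<rho> t\<bar> * (p * 3) \<le> p + B * (p * 3)"
        using B(2)[OF that] \<open>p > 1\<close> by (intro add_left_mono mult_right_mono) auto
    qed
    fix \<beta> :: "real \<Rightarrow> real" assume \<beta>: "continuous_on {0..H} \<beta>"
    show "\<forall>\<^sub>F t in cocountable {0<..<H}. isCont (\<lambda>t. ?u (\<beta> t) + \<rho> t * ?v (\<beta> t)) t"
      using regular_densityD(1)[OF \<rho>] eventually_in_cocountable
    proof eventually_elim
      case (elim t)
      have "isCont \<beta> t"
        using continuous_on_interior[OF \<beta>] elim(2) by simp
      have "isCont ?u (\<beta> t)" "isCont ?v (\<beta> t)"
        using lip[THEN lipschitz_on_continuous_on] by (simp_all add: continuous_on_eq_continuous_at)
      note comp = this[THEN isCont_o2[OF \<open>isCont \<beta> t\<close>]]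
      show ?case
        by (rule isCont_add[OF comp(1) isCont_mult[OF elim(1) comp(2)]])
    qed
  qed fact
  then show thesis
    by (rule that)
qed

lemma regular_solution_with_angle:
  assumes "p > 1" "H > 0" and \<rho>: "regular_density H \<rho>"
    and ends: "- 2 * conjugate p \<le> \<theta>0" "\<theta>0 < \<theta>1" "\<theta>1 \<le> 2 * conjugate p"
  obtains \<mu> y \<phi> \<alpha> where "\<mu> > 0" "regular_solution p (\<lambda>x. \<mu> * \<rho> x) 0 H y \<phi>"
    "continuous_on {0..H} \<alpha>" "strict_mono_on {0..H} \<alpha>" "\<alpha> 0 = \<theta>0" "\<alpha> H = \<theta>1"
    "\<And>x. x \<in> {0..H} \<Longrightarrow> y x = 0 \<longleftrightarrow> \<alpha> x \<in> {- 2 * conjugate p, 0, 2 * conjugate p}"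
proof -
  let ?u = "\<lambda>\<theta>. \<bar>square_w p \<theta>\<bar> powr conjugate p" and ?v = "\<lambda>\<theta>. \<bar>square_y p \<theta>\<bar> powr p"
  obtain M \<Lambda> where "lipschitz_field H M \<Lambda> (\<lambda>t \<theta>. ?u \<theta> + \<rho> t * ?v \<theta>)"
    using pruefer_lipschitz_field[OF assms(1-3)] .
  then interpret lipschitz_field H M \<Lambda> "\<lambda>t \<theta>. ?u \<theta> + \<rho> t * ?v \<theta>" .
  obtain l r c where lrc: "0 \<le> l" "l < r" "r \<le> H" "0 < c" "\<And>x. x \<in> {l<..<r} \<Longrightarrow> c \<le> \<rho> x"
    using regular_density_lower_bound[OF assms(2,3)] by blast
  have nonneg: "\<forall>\<^sub>F t in cocountable {0<..<H}. \<forall>\<theta>. 0 \<le> ?u \<theta> + \<rho> t * ?v \<theta>"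
    using regular_densityD(2)[OF \<rho>] by eventually_elim simp
  have lower: "min 1 c \<le> ?u \<theta> + \<rho> t * ?v \<theta>" if t: "t \<in> {l<..<r}" for t \<theta>
    using square_max[OF \<open>p > 1\<close>, of \<theta>] lrc(4) lrc(5)[OF t]
    by (auto simp: min_le_iff_disj add_increasing)
  obtain m \<alpha> where m: "0 < m" and flow: "scaled_flow \<theta>0 m \<alpha>" and end1: "\<alpha> H = \<theta>1"
    by (rule scaled_flow_reaches[OF ends(2) nonneg lrc(1-3) _ lower]) (use lrc(4) in auto)
  have "\<alpha> 0 = \<theta>0"
    using flow by (simp add: scaled_flow_def)
  interpret angle: pruefer_angle p H m \<rho> \<alpha>
    by unfold_locales (use assms(1-3) ends m flow end1 in \<open>auto simp: scaled_flow_def\<close>)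
  show thesis
    by (rule that[OF _ angle.regular_solution angle.\<alpha>_cont angle.\<alpha>_strict_mono \<open>\<alpha> 0 = \<theta>0\<close> end1
          angle.sol_y_eq_0_iff]) (use m in auto)
qed

lemma first_eigenfunction:
  assumes "p > 1" "H > 0" "regular_density H \<rho>"
  obtains \<mu> y \<phi> where "\<mu> > 0" "regular_solution p (\<lambda>x. \<mu> * \<rho> x) 0 H y \<phi>" "y 0 = 0" "y H = 0"
    "\<And>x. x \<in> {0<..<H} \<Longrightarrow> y x \<noteq> 0"
proof -
  have q: "conjugate p > 1"
    by (rule conjugate_exponent(1)[OF assms(1)])
  obtain \<mu> y \<phi> \<alpha> where sol: "\<mu> > 0" "regular_solution p (\<lambda>x. \<mu> * \<rho> x) 0 H y \<phi>"
    and \<alpha>: "strict_mono_on {0..H} \<alpha>" "\<alpha> 0 = 0" "\<alpha> H = 2 * conjugate p"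
    and zero: "\<And>x. x \<in> {0..H} \<Longrightarrow> y x = 0 \<longleftrightarrow> \<alpha> x \<in> {- 2 * conjugate p, 0, 2 * conjugate p}"
    by (rule regular_solution_with_angle[OF assms, of 0 "2 * conjugate p"]) (use q in auto)
  show thesis
  proof (rule that[OF sol])
    show "y x \<noteq> 0" if "x \<in> {0<..<H}" for x
      using zero[of x] strict_mono_onD[OF \<alpha>(1), of 0 x] strict_mono_onD[OF \<alpha>(1), of x H] \<alpha>(2,3) that q by auto
  qed (use zero \<alpha>(2,3) assms(2) in auto)
qed

lemma second_eigenfunction:
  assumes "p > 1" "H > 0" "regular_density H \<rho>"
  obtains \<mu> y \<phi> z where "\<mu> > 0" "regular_solution p (\<lambda>x. \<mu> * \<rho> x) 0 H y \<phi>" "z \<in> {0<..<H}"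
    "y 0 = 0" "y z = 0" "y H = 0" "\<forall>x\<in>{0<..<H} - {z}. y x \<noteq> 0"
proof -
  have q: "conjugate p > 1"
    by (rule conjugate_exponent(1)[OF assms(1)])
  obtain \<mu> y \<phi> \<alpha> where sol: "\<mu> > 0" "regular_solution p (\<lambda>x. \<mu> * \<rho> x) 0 H y \<phi>" and cont: "continuous_on {0..H} \<alpha>"
    and \<alpha>: "strict_mono_on {0..H} \<alpha>" "\<alpha> 0 = - 2 * conjugate p" "\<alpha> H = 2 * conjugate p"
    and zero: "\<And>x. x \<in> {0..H} \<Longrightarrow> y x = 0 \<longleftrightarrow> \<alpha> x \<in> {- 2 * conjugate p, 0, 2 * conjugate p}"
    by (rule regular_solution_with_angle[OF assms, of "- 2 * conjugate p" "2 * conjugate p"]) (use q in auto)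
  obtain z where z: "0 \<le> z" "z \<le> H" "\<alpha> z = 0"
    using IVT'[of \<alpha> 0 0 H] cont \<alpha>(2,3) q assms(2) by auto
  then have "z \<in> {0<..<H}"
    using \<alpha>(2,3) q by (auto simp: order_less_le)
  show thesis
  proof (rule that[OF sol \<open>z \<in> {0<..<H}\<close>])
    show "\<forall>x\<in>{0<..<H} - {z}. y x \<noteq> 0"
    proof
      fix x assume "x \<in> {0<..<H} - {z}"
      then have "x \<in> {0<..<H}" "x \<noteq> z"
        by auto
      then have "\<alpha> x \<noteq> \<alpha> z" "\<alpha> 0 < \<alpha> x" "\<alpha> x < \<alpha> H"
        using z strict_mono_onD[OF \<alpha>(1), of 0 x] strict_mono_onD[OF \<alpha>(1), of x H]
          inj_onD[OF strict_mono_on_imp_inj_on[OF \<alpha>(1)], of x z] by auto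
      then show "y x \<noteq> 0"
        using zero[of x] \<alpha>(2,3) z(3) \<open>x \<in> {0<..<H}\<close> by auto
    qed
  qed (use zero[of 0] zero[of z] zero[of H] \<alpha>(2,3) z assms(2) in auto)
qed

section \<open>The first two eigenvalues\<close>

locale first_two_eigenvalues =
  fixes p H :: real and \<rho> :: "real \<Rightarrow> real" and \<mu>1 \<mu>2 z :: real
  assumes p: "p > 1" and z: "0 < z" "z < H" and \<mu>1_pos: "0 < \<mu>1"
    and pos: "\<forall>\<^sub>F x in cocountable {0<..<H}. 0 < \<rho> x"
    and first: "nodal_interval p (\<lambda>x. \<mu>1 * \<rho> x) 0 H"
    and second: "nodal_interval p (\<lambda>x. \<mu>2 * \<rho> x) 0 z" "nodal_interval p (\<lambda>x. \<mu>2 * \<rho> x) z H"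
begin

lemma pos_subset: "0 \<le> c \<Longrightarrow> d \<le> H \<Longrightarrow> \<forall>\<^sub>F x in cocountable {c<..<d}. 0 < \<rho> x"
  by (rule eventually_cocountable_subset[OF pos]) auto

lemma \<mu>1_less_\<mu>2: "\<mu>1 < \<mu>2"
  by (rule nodal_interval_eigenvalue_less[OF p first second(1)]) (use z pos_subset in auto)

lemma \<mu>2_pos: "0 < \<mu>2"
  using \<mu>1_pos \<mu>1_less_\<mu>2 by simp

lemma reflect: "first_two_eigenvalues p H (\<lambda>x. \<rho> (H - x)) \<mu>1 \<mu>2 (H - z)"
  using p z \<mu>1_pos eventually_cocountable_reflect[OF pos, of H] nodal_interval_reflect[OF first, of H]
    second[THEN nodal_interval_reflect, of H]
  by unfold_locales simp_all

text \<open>Unless its first positive zero is \<open>H\<close> or \<open>z\<close>, an eigenfunction has a nodal interval strictly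
  inside \<open>(0, z)\<close> or \<open>(z, H)\<close>.\<close>

lemma eigenvalue_classification:
  assumes sol: "regular_solution p (\<lambda>x. \<nu> * \<rho> x) 0 H y \<phi>" "y 0 = 0" "y H = 0"
    and bound: "\<forall>\<^sub>F x in cocountable {0<..<H}. \<bar>\<nu> * \<rho> x\<bar> \<le> C"
    and nontrivial: "x0 \<in> {0..H}" "y x0 \<noteq> 0"
  shows "\<nu> = \<mu>1 \<or> \<nu> = \<mu>2 \<or> \<mu>2 < \<nu>"
proof -
  have \<phi>: "\<phi> c \<noteq> 0" if "c \<in> {0..H}" "y c = 0" for c
    using regular_solution_eq_0[OF p sol(1) bound that _ nontrivial(1)] nontrivial(2) by blast
  note nodal = regular_solution_nodal_interval[OF p sol(1) bound]
  have "0 \<in> {0..<H}" "0 \<in> {0..H}"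
    using z by auto
  from regular_solution_next_zero[OF sol(1) this(1) sol(2) \<phi>[OF this(2) sol(2)] sol(3)]
  obtain c where c: "c \<in> {0<..H}" "y c = 0" "\<And>x. x \<in> {0<..<c} \<Longrightarrow> y x \<noteq> 0"
    by blast
  then have left: "nodal_interval p (\<lambda>x. \<nu> * \<rho> x) 0 c"
    by (intro nodal) (use sol(2) in auto)
  consider "c = H" | "c = z" | "c < z" | "z < c" "c < H"
    using c(1) by fastforce
  then show ?thesis
  proof cases
    case 1
    then show ?thesis
      using nodal_interval_eigenvalue_unique[OF p left[unfolded 1] first pos] by simp
  next
    case 2
    then show ?thesis
      using nodal_interval_eigenvalue_unique[OF p left[unfolded 2] second(1) pos_subset] z by simp
  next
    case 3
    then show ?thesis
      using nodal_interval_eigenvalue_less[OF p second(1) left] pos_subset[of 0 c] z by simp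
  next
    case 4
    then have "c \<in> {0..<H}" "c \<in> {0..H}"
      using c(1) by auto
    from regular_solution_next_zero[OF sol(1) this(1) c(2) \<phi>[OF this(2) c(2)] sol(3)]
    obtain d where d: "d \<in> {c<..H}" "y d = 0" "\<And>x. x \<in> {c<..<d} \<Longrightarrow> y x \<noteq> 0"
      by blast
    then have "nodal_interval p (\<lambda>x. \<nu> * \<rho> x) c d"
      by (intro nodal) (use c in auto)
    then show ?thesis
      using nodal_interval_eigenvalue_less[OF p second(2)] pos_subset[of c d] 4 d(1) c(1) by simp
  qed
qed

end

lemma pi_hat_pos: "p > 1 \<Longrightarrow> pi_hat p > 0"
  unfolding pi_hat_def by (intro divide_pos_pos mult_pos_pos sin_gt_zero) (auto simp: field_simps)

lemma eigenvalue_eqI: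
  assumes "is_eigenvalue p \<rho> \<mu>" "finite {\<nu>. is_eigenvalue p \<rho> \<nu> \<and> \<nu> < \<mu>}"
    and "card {\<nu>. is_eigenvalue p \<rho> \<nu> \<and> \<nu> < \<mu>} = n"
  shows "eigenvalue p \<rho> (Suc n) = \<mu>"
proof -
  let ?below = "\<lambda>\<mu>. {\<nu>. is_eigenvalue p \<rho> \<nu> \<and> \<nu> < \<mu>}"
  have card_less: "card (?below \<nu>) < card (?below \<nu>')"
    if "is_eigenvalue p \<rho> \<nu>" "finite (?below \<nu>')" "\<nu> < \<nu>'" for \<nu> \<nu>'
    by (rule psubset_card_mono) (use that in auto)
  show ?thesis
    unfolding eigenvalue_def
  proof (rule the_equality)
    fix \<nu> assume \<nu>: "is_eigenvalue p \<rho> \<nu> \<and> finite (?below \<nu>) \<and> Suc (card (?below \<nu>)) = Suc n"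
    show "\<nu> = \<mu>"
      using card_less[of \<nu> \<mu>] card_less[of \<mu> \<nu>] assms \<nu> by (cases \<nu> \<mu> rule: linorder_cases) simp_all
  qed (use assms in simp)
qed

lemma eigenvalue_1_2_eqI:
  assumes ev: "is_eigenvalue p \<rho> \<mu>1" "is_eigenvalue p \<rho> \<mu>2" and "\<mu>1 < \<mu>2"
    and classification: "\<And>\<nu>. is_eigenvalue p \<rho> \<nu> \<Longrightarrow> \<nu> = \<mu>1 \<or> \<nu> = \<mu>2 \<or> \<mu>2 < \<nu>"
  shows "eigenvalue p \<rho> 1 = \<mu>1" "eigenvalue p \<rho> 2 = \<mu>2"
proof -
  have below: "{\<nu>. is_eigenvalue p \<rho> \<nu> \<and> \<nu> < \<mu>1} = {}" "{\<nu>. is_eigenvalue p \<rho> \<nu> \<and> \<nu> < \<mu>2} = {\<mu>1}"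
    using classification assms(1-3) by force+
  show "eigenvalue p \<rho> 1 = \<mu>1"
    unfolding One_nat_def by (rule eigenvalue_eqI[OF ev(1)]; unfold below) simp_all
  show "eigenvalue p \<rho> 2 = \<mu>2"
    unfolding numeral_2_eq_2 by (rule eigenvalue_eqI[OF ev(2)]; unfold below) simp_all
qed

lemma regular_density_scaled_bound:
  assumes "regular_density H \<rho>"
  obtains C where "\<forall>\<^sub>F x in cocountable {0<..<H}. \<bar>\<mu> * \<rho> x\<bar> \<le> C"
proof -
  obtain B where "B \<ge> 0" and B: "\<And>x. x \<in> {0..H} \<Longrightarrow> \<bar>\<rho> x\<bar> \<le> B"
    using regular_densityE[OF assms] by blast
  have "\<forall>\<^sub>F x in cocountable {0<..<H}. \<bar>\<mu> * \<rho> x\<bar> \<le> \<bar>\<mu>\<bar> * B"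
    by (rule eventually_cocountableI) (use B in \<open>auto simp: abs_mult intro: mult_left_mono\<close>)
  then show thesis
    by (rule that)
qed

lemma regular_solution_imp_is_eigenvalue:
  assumes "p > 1" "regular_density (pi_hat p) \<rho>" "regular_solution p (\<lambda>x. \<mu> * \<rho> x) 0 (pi_hat p) y \<phi>"
    and "y 0 = 0" "y (pi_hat p) = 0" "x \<in> {0..pi_hat p}" "y x \<noteq> 0"
  shows "is_eigenvalue p \<rho> \<mu>"
  using regular_solution_imp_dirichlet_solution[OF assms(1-5)] assms(6,7) unfolding is_eigenvalue_def by blast

lemma first_two_eigenvalues_of_eigenfunctions:
  assumes "p > 1" "0 < H" and \<rho>: "regular_density H \<rho>"
    and y1: "0 < \<mu>1" "regular_solution p (\<lambda>x. \<mu>1 * \<rho> x) 0 H y1 \<phi>1" "y1 0 = 0" "y1 H = 0"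
      "\<And>x. x \<in> {0<..<H} \<Longrightarrow> y1 x \<noteq> 0"
    and y2: "regular_solution p (\<lambda>x. \<mu>2 * \<rho> x) 0 H y2 \<phi>2" "z \<in> {0<..<H}" "y2 0 = 0" "y2 z = 0" "y2 H = 0"
      "\<forall>x\<in>{0<..<H} - {z}. y2 x \<noteq> 0"
  shows "first_two_eigenvalues p H \<rho> \<mu>1 \<mu>2 z"
proof -
  obtain C1 C2 where C: "\<forall>\<^sub>F x in cocountable {0<..<H}. \<bar>\<mu>1 * \<rho> x\<bar> \<le> C1"
      "\<forall>\<^sub>F x in cocountable {0<..<H}. \<bar>\<mu>2 * \<rho> x\<bar> \<le> C2"
    using regular_density_scaled_bound[OF \<rho>, of \<mu>1] regular_density_scaled_bound[OF \<rho>, of \<mu>2] by metis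
  show ?thesis
  proof
    show "nodal_interval p (\<lambda>x. \<mu>1 * \<rho> x) 0 H"
      by (rule regular_solution_nodal_interval[OF \<open>p > 1\<close> y1(2) C(1)]) (use y1 \<open>0 < H\<close> in auto)
    show "nodal_interval p (\<lambda>x. \<mu>2 * \<rho> x) 0 z" "nodal_interval p (\<lambda>x. \<mu>2 * \<rho> x) z H"
      by (rule regular_solution_nodal_interval[OF \<open>p > 1\<close> y2(1) C(2)]; use y2 in auto)+
  qed (use \<open>p > 1\<close> y1(1) y2(2) regular_densityD(2)[OF \<rho>] in auto)
qed

lemma first_two_eigenvalues_eigenvalue:
  assumes "p > 1" and \<rho>: "regular_density (pi_hat p) \<rho>"
  obtains z where "first_two_eigenvalues p (pi_hat p) \<rho> (eigenvalue p \<rho> 1) (eigenvalue p \<rho> 2) z"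
proof -
  let ?H = "pi_hat p"
  note H = pi_hat_pos[OF \<open>p > 1\<close>]
  obtain \<mu>1 y1 \<phi>1 where y1: "0 < \<mu>1" "regular_solution p (\<lambda>x. \<mu>1 * \<rho> x) 0 ?H y1 \<phi>1"
      "y1 0 = 0" "y1 ?H = 0" "\<And>x. x \<in> {0<..<?H} \<Longrightarrow> y1 x \<noteq> 0"
    using first_eigenfunction[OF \<open>p > 1\<close> H \<rho>] by blast
  obtain \<mu>2 y2 \<phi>2 z where "0 < \<mu>2" and y2: "regular_solution p (\<lambda>x. \<mu>2 * \<rho> x) 0 ?H y2 \<phi>2" "z \<in> {0<..<?H}"
      "y2 0 = 0" "y2 z = 0" "y2 ?H = 0" "\<forall>x\<in>{0<..<?H} - {z}. y2 x \<noteq> 0"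
    using second_eigenfunction[OF \<open>p > 1\<close> H \<rho>] .
  interpret first_two_eigenvalues p ?H \<rho> \<mu>1 \<mu>2 z
    by (rule first_two_eigenvalues_of_eigenfunctions[OF \<open>p > 1\<close> H \<rho> y1 y2])
  have ev1: "is_eigenvalue p \<rho> \<mu>1"
    by (rule regular_solution_imp_is_eigenvalue[OF assms y1(2-4), of "?H / 2"]) (use y1(5) H in auto)
  have ev2: "is_eigenvalue p \<rho> \<mu>2"
    by (rule regular_solution_imp_is_eigenvalue[OF assms y2(1,3,5), of "z / 2"]) (use y2(6) z in auto)
  have classification: "\<nu> = \<mu>1 \<or> \<nu> = \<mu>2 \<or> \<mu>2 < \<nu>" if \<nu>: "is_eigenvalue p \<rho> \<nu>" for \<nu>
  proof -
    obtain y x where y: "dirichlet_solution p \<rho> \<nu> y" "x \<in> {0..?H}" "y x \<noteq> 0"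
      using \<nu> unfolding is_eigenvalue_def by blast
    have ends: "y 0 = 0" "y ?H = 0"
      using y(1) by (simp_all add: dirichlet_solution_def)
    obtain \<phi> where sol: "regular_solution p (\<lambda>x. \<nu> * \<rho> x) 0 ?H y \<phi>"
      using dirichlet_solution_imp_regular_solution[OF \<open>p > 1\<close> \<rho> H y(1)] .
    obtain C where "\<forall>\<^sub>F x in cocountable {0<..<?H}. \<bar>\<nu> * \<rho> x\<bar> \<le> C"
      using regular_density_scaled_bound[OF \<rho>] .
    from eigenvalue_classification[OF sol ends this y(2,3)] show ?thesis .
  qed
  from eigenvalue_1_2_eqI[OF ev1 ev2 \<mu>1_less_\<mu>2 classification] show thesis
    using that first_two_eigenvalues_axioms by simp
qed

section \<open>Comparison with constant densities\<close>

lemma constant_nodal_intervals: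
  assumes "p > 1"
  obtains K where "0 < K" "\<And>a b. a < b \<Longrightarrow> nodal_interval p (\<lambda>_. K / (b - a) powr p) a b"
proof -
  have "regular_density 1 (\<lambda>_. 1)"
    unfolding regular_density_def by (auto intro: eventually_cocountableI)
  then obtain K y \<phi> where K: "0 < K" "regular_solution p (\<lambda>x. K * 1) 0 1 y \<phi>" "y 0 = 0" "y 1 = 0"
    and nz: "\<And>x. x \<in> {0<..<1} \<Longrightarrow> y x \<noteq> 0"
    by (rule first_eigenfunction[OF assms zero_less_one]) blast
  show thesis
  proof (rule that[OF K(1)])
    fix a b :: real assume "a < b"
    define s where "s = 1 / (b - a)"
    have s: "s > 0" "s * (b - a) = 1" "s powr p = 1 / (b - a) powr p"
      using \<open>a < b\<close> by (simp_all add: s_def powr_divide)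
    have scaled: "- s * a + s * x = s * (x - a)" for x
      by (simp add: algebra_simps)
    have range: "s * (x - a) \<le> 1 \<longleftrightarrow> x \<le> b" "s * (x - a) < 1 \<longleftrightarrow> x < b" "0 \<le> s * (x - a) \<longleftrightarrow> a \<le> x"
      "0 < s * (x - a) \<longleftrightarrow> a < x" for x
      using s(1) unfolding s(2)[symmetric] by (simp_all add: zero_le_mult_iff zero_less_mult_iff)
    have maps: "- s * a + s * x \<in> {0..1}" if "x \<in> {a..b}" for x
      unfolding scaled using that by (simp add: range)
    have "regular_solution p (\<lambda>x. \<bar>s\<bar> powr p * (K * 1)) a b
        (\<lambda>x. y (- s * a + s * x)) (\<lambda>x. signed_pow p s * \<phi> (- s * a + s * x))"
      by (rule regular_solution_affine[OF assms K(2) _ maps]) (use s(1) in simp)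
    from regular_solution_nodal_interval[OF assms this, of "\<bar>\<bar>s\<bar> powr p * (K * 1)\<bar>" a b]
    have "nodal_interval p (\<lambda>x. \<bar>s\<bar> powr p * (K * 1)) a b"
      unfolding scaled using \<open>a < b\<close> K(3,4) nz s(2) by (simp add: range)
    then show "nodal_interval p (\<lambda>_. K / (b - a) powr p) a b"
      using s(1) by (simp add: s(3))
  qed
qed

text \<open>The first Dirichlet eigenvalue of an interval of length \<open>l\<close> with density \<open>1\<close>.\<close>

definition interval_eigenvalue :: "real \<Rightarrow> real \<Rightarrow> real" where
  "interval_eigenvalue p l =
     (SOME K. 0 < K \<and> (\<forall>a b. a < b \<longrightarrow> nodal_interval p (\<lambda>_. K / (b - a) powr p) a b)) / l powr p"

lemma interval_eigenvalue_pos: "p > 1 \<Longrightarrow> l > 0 \<Longrightarrow> interval_eigenvalue p l > 0"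
  and nodal_interval_interval_eigenvalue:
    "p > 1 \<Longrightarrow> a < b \<Longrightarrow> nodal_interval p (\<lambda>_. interval_eigenvalue p (b - a)) a b"
proof -
  have "\<exists>K. 0 < K \<and> (\<forall>a b. a < b \<longrightarrow> nodal_interval p (\<lambda>_. K / (b - a) powr p) a b)" if "p > 1"
    using constant_nodal_intervals[OF that] by metis
  note * = someI_ex[OF this]
  show "p > 1 \<Longrightarrow> l > 0 \<Longrightarrow> interval_eigenvalue p l > 0"
    "p > 1 \<Longrightarrow> a < b \<Longrightarrow> nodal_interval p (\<lambda>_. interval_eigenvalue p (b - a)) a b"
    using * by (simp_all add: interval_eigenvalue_def)
qed

lemma interval_eigenvalue_scale:
  "0 < l \<Longrightarrow> 0 < l' \<Longrightarrow> interval_eigenvalue p l * l powr p = interval_eigenvalue p l' * l' powr p"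
  by (simp add: interval_eigenvalue_def)

lemma interval_eigenvalue_antimono:
  assumes "p > 1" "0 < l" "l \<le> l'"
  shows "interval_eigenvalue p l' \<le> interval_eigenvalue p l"
proof -
  have "interval_eigenvalue p l * l powr p = interval_eigenvalue p l' * l' powr p"
    by (rule interval_eigenvalue_scale) (use assms in auto)
  moreover have "interval_eigenvalue p l' * l powr p \<le> interval_eigenvalue p l' * l' powr p"
    using assms interval_eigenvalue_pos[of p l'] by (intro mult_left_mono powr_mono2) auto
  ultimately have "interval_eigenvalue p l' * l powr p \<le> interval_eigenvalue p l * l powr p"
    by simp
  then show ?thesis
    by (rule mult_right_le_imp_le) (use assms(2) in simp)
qed

lemma half_nodal_interval_eigenvalue:
  assumes "p > 1" "a < b"
  obtains U where "half_nodal p (\<lambda>_. interval_eigenvalue p (b - a) / 2 powr p) a b 0 U"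
proof -
  define c where "c = 2 * b - a"
  have c: "b \<in> {a<..<c}" "(a + c) / 2 = b" "c - a = 2 * (b - a)"
    using assms(2) by (auto simp: c_def field_simps)
  obtain U where U: "nodal p (\<lambda>_. interval_eigenvalue p (c - a)) a c U"
    using nodal_interval_interval_eigenvalue[OF assms(1), of a c] c(1) by (auto simp: nodal_interval_def)
  have "U b = 0"
    using nodal_symmetric_midpoint[OF assms(1) U] c(1,2) by (simp add: eventually_cocountableI)
  moreover have "interval_eigenvalue p (c - a) = interval_eigenvalue p (b - a) / 2 powr p"
    unfolding c(3) interval_eigenvalue_def powr_mult by (simp add: mult.commute)
  ultimately show thesis
    using that nodal_imp_half_nodal[OF U c(1)] by simp
qed

lemma le_interval_eigenvalue:
  assumes "p > 1" "nodal_interval p Q c d" and \<kappa>: "\<forall>\<^sub>F x in cocountable {c<..<d}. \<kappa> \<le> Q x"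
  shows "\<kappa> \<le> interval_eigenvalue p (d - c)"
proof (rule ccontr)
  assume less: "\<not> \<kappa> \<le> interval_eigenvalue p (d - c)"
  have cd: "c < d"
    using assms(2) by (simp add: nodal_interval_def)
  have "\<forall>\<^sub>F x in cocountable {c<..<d}. Q x = interval_eigenvalue p (d - c)"
    by (rule nodal_interval_rigid(3)[OF assms(1,2) nodal_interval_interval_eigenvalue[OF assms(1) cd] order_refl order_refl])
      (use \<kappa> less in \<open>auto elim: eventually_mono\<close>)
  from eventually_conj[OF this \<kappa>] cd show False
    by (rule eventually_cocountable_obtains) (use less in auto)
qed

lemma interval_eigenvalue_le:
  assumes "p > 1" "nodal_interval p Q c d" and \<kappa>: "\<forall>\<^sub>F x in cocountable {c<..<d}. Q x \<le> \<kappa>"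
  shows "interval_eigenvalue p (d - c) \<le> \<kappa>"
proof (rule ccontr)
  assume less: "\<not> interval_eigenvalue p (d - c) \<le> \<kappa>"
  have cd: "c < d"
    using assms(2) by (simp add: nodal_interval_def)
  have "\<forall>\<^sub>F x in cocountable {c<..<d}. interval_eigenvalue p (d - c) = Q x"
    by (rule nodal_interval_rigid(3)[OF assms(1) nodal_interval_interval_eigenvalue[OF assms(1) cd] assms(2) order_refl order_refl])
      (use \<kappa> less in \<open>auto elim: eventually_mono\<close>)
  from eventually_conj[OF this \<kappa>] cd show False
    by (rule eventually_cocountable_obtains) (use less in auto)
qed

lemma upcrossing_uminus: "upcrossing a b (\<lambda>x. - f x) (\<lambda>x. - g x) \<longleftrightarrow> upcrossing a b g f"
  by (simp add: upcrossing_def)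

lemma upcrossing_append:
  assumes "upcrossing a b f g" "\<forall>\<^sub>F x in cocountable {b<..<c}. g x \<le> f x" "b \<le> c"
  shows "upcrossing a c f g"
proof -
  obtain e where e: "e \<in> {a..b}" "\<forall>\<^sub>F x in cocountable {a<..<e}. f x \<le> g x"
      "\<forall>\<^sub>F x in cocountable {e<..<b}. g x \<le> f x"
    using assms(1) by (auto simp: upcrossing_def)
  then show ?thesis
    unfolding upcrossing_def using eventually_cocountable_split[OF e(3) assms(2)] assms(3)
    by (intro bexI[of _ e]) auto
qed

lemma upcrossing_of_mono_on:
  fixes f :: "real \<Rightarrow> real"
  assumes f: "mono_on {a<..<b} f" and "a \<le> b"
  shows "upcrossing a b f (\<lambda>_. L)"
proof -
  define T where "T = insert a {x \<in> {a<..<b}. f x \<le> L}"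
  have bdd: "bdd_above T"
    by (rule bdd_aboveI[of _ b]) (use \<open>a \<le> b\<close> in \<open>auto simp: T_def\<close>)
  have "Sup T \<in> {a..b}"
    using cSup_upper[OF _ bdd, of a] cSup_least[of T b] \<open>a \<le> b\<close> by (fastforce simp: T_def)
  moreover have "f x \<le> L" if x: "x \<in> {a<..<Sup T}" for x
  proof -
    obtain y where "y \<in> T" "x < y"
      using x less_cSupD[of T x] by (auto simp: T_def)
    then show ?thesis
      using monotone_onD[OF f, of x y] x by (auto simp: T_def)
  qed
  moreover have "L \<le> f x" if x: "x \<in> {Sup T<..<b}" for x
  proof (rule ccontr)
    assume "\<not> L \<le> f x"
    then have "x \<in> T"
      using x \<open>Sup T \<in> {a..b}\<close> by (auto simp: T_def)
    from cSup_upper[OF this bdd] show False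
      using x by simp
  qed
  ultimately show ?thesis
    unfolding upcrossing_def by (auto intro!: bexI[of _ "Sup T"] eventually_cocountableI)
qed

lemma upcrossing_of_antimono_on:
  fixes f :: "real \<Rightarrow> real"
  assumes "antimono_on {a<..<b} f" "a \<le> b"
  shows "upcrossing a b (\<lambda>_. L) f"
proof -
  have "mono_on {a<..<b} (\<lambda>x. - f x)"
    using assms(1) by (simp add: monotone_on_def)
  from upcrossing_of_mono_on[OF this assms(2), of "- L"] show ?thesis
    unfolding upcrossing_uminus .
qed

text \<open>The constant density is scaled to have the eigenvalue \<open>\<mu>\<close> on \<open>(a, b)\<close>; its first eigenfunction
  on the interval of twice the length is flat at \<open>b\<close>, where the Riccati function vanishes.\<close>

lemma constant_riccati_functions:
  assumes "p > 1" "a < b" "0 < \<mu>" and L: "\<mu> * L = interval_eigenvalue p (b - a)"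
  obtains Z U where "0 < L" "nodal p (\<lambda>_. \<mu> * L) a b Z" "half_nodal p (\<lambda>_. \<mu> / 2 powr p * L) a b 0 U"
proof -
  obtain Z where Z: "nodal p (\<lambda>_. \<mu> * L) a b Z"
    using nodal_interval_interval_eigenvalue[OF assms(1,2)] by (auto simp: nodal_interval_def L)
  obtain U where "half_nodal p (\<lambda>_. interval_eigenvalue p (b - a) / 2 powr p) a b 0 U"
    using half_nodal_interval_eigenvalue[OF assms(1,2)] .
  then have U: "half_nodal p (\<lambda>_. \<mu> / 2 powr p * L) a b 0 U"
    by (simp flip: L)
  have "0 < \<mu> * L"
    unfolding L by (rule interval_eigenvalue_pos[OF \<open>p > 1\<close>]) (use \<open>a < b\<close> in simp)
  then have "0 < L"
    using \<open>0 < \<mu>\<close> by (rule zero_less_mult_pos)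
  from that[OF this Z U] show thesis .
qed

lemma half_nodal_upcrossing_constant:
  assumes "p > 1" and \<mu>: "0 < \<mu>1" "\<mu>1 < \<mu>2"
    and half_W: "half_nodal p (\<lambda>x. \<mu>1 * \<rho> x) a b \<alpha> W" and interval: "nodal_interval p (\<lambda>x. \<mu>2 * \<rho> x) a b"
    and pos: "\<forall>\<^sub>F x in cocountable {a<..<b}. 0 < \<rho> x" and L: "\<mu>2 * L = interval_eigenvalue p (b - a)"
  shows "upcrossing a b \<rho> (\<lambda>_. L) \<Longrightarrow> \<mu>2 \<le> 2 powr p * \<mu>1 \<Longrightarrow>
      \<alpha> \<le> 0 \<and> (\<alpha> = 0 \<longrightarrow> \<mu>2 = 2 powr p * \<mu>1 \<and> (\<forall>\<^sub>F x in cocountable {a<..<b}. \<rho> x = L))"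
    and "upcrossing a b (\<lambda>_. L) \<rho> \<Longrightarrow> 2 powr p * \<mu>1 \<le> \<mu>2 \<Longrightarrow>
      0 \<le> \<alpha> \<and> (\<alpha> = 0 \<longrightarrow> \<mu>2 = 2 powr p * \<mu>1 \<and> (\<forall>\<^sub>F x in cocountable {a<..<b}. \<rho> x = L))"
proof -
  have a_less_b: "a < b"
    using interval by (simp add: nodal_interval_def)
  obtain V where V: "nodal p (\<lambda>x. \<mu>2 * \<rho> x) a b V"
    using interval by (auto simp: nodal_interval_def)
  have \<mu>2: "0 < \<mu>2"
    using \<mu> by simp
  obtain Z U where "0 < L" and Z: "nodal p (\<lambda>_. \<mu>2 * L) a b Z"
    and U: "half_nodal p (\<lambda>_. \<mu>2 / 2 powr p * L) a b 0 U"
    using constant_riccati_functions[OF \<open>p > 1\<close> a_less_b \<mu>2 L] .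
  then have posL: "\<forall>\<^sub>F x in cocountable {a<..<b}. 0 < L"
    by (simp add: eventually_cocountableI)
  have half_\<mu>2: "0 < \<mu>2 / 2 powr p" "\<mu>2 / 2 powr p < \<mu>2"
    using \<mu>2 \<open>p > 1\<close> by (simp_all add: divide_less_eq)
  show "\<alpha> \<le> 0 \<and> (\<alpha> = 0 \<longrightarrow> \<mu>2 = 2 powr p * \<mu>1 \<and> (\<forall>\<^sub>F x in cocountable {a<..<b}. \<rho> x = L))"
    if cross: "upcrossing a b \<rho> (\<lambda>_. L)" and "\<mu>2 \<le> 2 powr p * \<mu>1"
  proof -
    have "\<mu>2 / 2 powr p \<le> \<mu>1"
      using that(2) by (simp add: divide_le_eq mult.commute)
    note comparison = half_nodal_le_of_upcrossing[OF \<open>p > 1\<close> a_less_b half_\<mu>2(1) this less_imp_le[OF \<mu>(2)] half_\<mu>2(2) half_W U V Z pos posL cross]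
    then show ?thesis
      by auto
  qed
  show "0 \<le> \<alpha> \<and> (\<alpha> = 0 \<longrightarrow> \<mu>2 = 2 powr p * \<mu>1 \<and> (\<forall>\<^sub>F x in cocountable {a<..<b}. \<rho> x = L))"
    if cross: "upcrossing a b (\<lambda>_. L) \<rho>" and "2 powr p * \<mu>1 \<le> \<mu>2"
  proof -
    have "\<mu>1 \<le> \<mu>2 / 2 powr p"
      using that(2) by (simp add: le_divide_eq mult.commute)
    note comparison = half_nodal_le_of_upcrossing[OF \<open>p > 1\<close> a_less_b \<mu>(1) this less_imp_le[OF half_\<mu>2(2)] \<mu>(2) U half_W Z V posL pos cross]
    then show ?thesis
      by (auto simp: eq_commute[of L])
  qed
qed

section \<open>Ratio estimates\<close>

definition cocountably_constant :: "real \<Rightarrow> (real \<Rightarrow> real) \<Rightarrow> bool" where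
  "cocountably_constant H f \<longleftrightarrow> (\<exists>c. \<forall>\<^sub>F x in cocountable {0<..<H}. f x = c)"

lemma cocountably_constant_reflect:
  assumes "cocountably_constant H f"
  shows "cocountably_constant H (\<lambda>x. f (H - x))"
  using assms eventually_cocountable_reflect[where c = 0 and d = H and r = H]
  unfolding cocountably_constant_def by fastforce

lemma nodal_interval_unique_right:
  assumes "p > 1" "nodal_interval p Q c d" "nodal_interval p Q c d'"
  shows "d = d'"
proof (cases "d \<le> d'")
  case True
  then show ?thesis
    using nodal_interval_rigid(2)[OF assms(1,3,2)] by simp
next
  case False
  then show ?thesis
    using nodal_interval_rigid(2)[OF assms(1,2,3)] by simp
qed

context first_two_eigenvalues
begin

definition level :: "real \<Rightarrow> real" where
  "level l = interval_eigenvalue p l / \<mu>2"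

lemma level: "\<mu>2 * level l = interval_eigenvalue p l"
  using \<mu>2_pos by (simp add: level_def)

lemma level_antimono: "0 < l \<Longrightarrow> l \<le> l' \<Longrightarrow> level l' \<le> level l"
  using interval_eigenvalue_antimono[OF p] \<mu>2_pos by (simp add: level_def divide_right_mono)

lemma first_riccati_halves:
  obtains w W V where "half_nodal p (\<lambda>x. \<mu>1 * \<rho> x) 0 z w W"
    "half_nodal p (\<lambda>x. \<mu>1 * \<rho> (H - x)) 0 (H - z) (- w) V"
proof -
  obtain W where W: "nodal p (\<lambda>x. \<mu>1 * \<rho> x) 0 H W"
    using first by (auto simp: nodal_interval_def)
  have "nodal p (\<lambda>x. \<mu>1 * \<rho> (H - x)) 0 H (\<lambda>x. - W (H - x))"
    using nodal_reflect[OF W, of H] by simp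
  from nodal_imp_half_nodal[OF this, of "H - z"] nodal_imp_half_nodal[OF W, of z] show thesis
    using z by (intro that[of "W z" W]) simp_all
qed

definition constant_on_nodal_intervals :: bool where
  "constant_on_nodal_intervals \<longleftrightarrow> (\<forall>\<^sub>F x in cocountable {0<..<z}. \<rho> x = level z) \<and>
     (\<forall>\<^sub>F x in cocountable {z<..<H}. \<rho> x = level (H - z))"

lemma
  shows nodal_rigidity_up: "upcrossing 0 z \<rho> (\<lambda>_. level z) \<Longrightarrow>
      upcrossing 0 (H - z) (\<lambda>x. \<rho> (H - x)) (\<lambda>_. level (H - z)) \<Longrightarrow> \<mu>2 \<le> 2 powr p * \<mu>1 \<Longrightarrow>
      \<mu>2 = 2 powr p * \<mu>1 \<and> constant_on_nodal_intervals"
    and nodal_rigidity_down: "upcrossing 0 z (\<lambda>_. level z) \<rho> \<Longrightarrow>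
      upcrossing 0 (H - z) (\<lambda>_. level (H - z)) (\<lambda>x. \<rho> (H - x)) \<Longrightarrow> 2 powr p * \<mu>1 \<le> \<mu>2 \<Longrightarrow>
      \<mu>2 = 2 powr p * \<mu>1 \<and> constant_on_nodal_intervals"
proof -
  interpret reflected: first_two_eigenvalues p H "\<lambda>x. \<rho> (H - x)" \<mu>1 \<mu>2 "H - z"
    by (rule reflect)
  obtain w W V where W: "half_nodal p (\<lambda>x. \<mu>1 * \<rho> x) 0 z w W"
    and V: "half_nodal p (\<lambda>x. \<mu>1 * \<rho> (H - x)) 0 (H - z) (- w) V"
    using first_riccati_halves .
  have levels: "\<mu>2 * level z = interval_eigenvalue p (z - 0)"
      "\<mu>2 * level (H - z) = interval_eigenvalue p (H - z - 0)"
    by (simp_all add: level)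
  have pos: "\<forall>\<^sub>F x in cocountable {0<..<z}. 0 < \<rho> x" "\<forall>\<^sub>F x in cocountable {0<..<H - z}. 0 < \<rho> (H - x)"
    using pos_subset[of 0 z] reflected.pos_subset[of 0 "H - z"] z by simp_all
  note left = half_nodal_upcrossing_constant[OF p \<mu>1_pos \<mu>1_less_\<mu>2 W second(1) pos(1) levels(1)]
    and right = half_nodal_upcrossing_constant[OF p \<mu>1_pos \<mu>1_less_\<mu>2 V reflected.second(1) pos(2) levels(2)]
  have conclusion: "\<mu>2 = 2 powr p * \<mu>1 \<and> constant_on_nodal_intervals"
    if "w = 0 \<longrightarrow> \<mu>2 = 2 powr p * \<mu>1 \<and> (\<forall>\<^sub>F x in cocountable {0<..<z}. \<rho> x = level z)"
      "- w = 0 \<longrightarrow> \<mu>2 = 2 powr p * \<mu>1 \<and> (\<forall>\<^sub>F x in cocountable {0<..<H - z}. \<rho> (H - x) = level (H - z))"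
      "w = 0"
  proof -
    have "- w = 0"
      using that(3) by simp
    with that have eq: "\<mu>2 = 2 powr p * \<mu>1" and left_half: "\<forall>\<^sub>F x in cocountable {0<..<z}. \<rho> x = level z"
      and "\<forall>\<^sub>F x in cocountable {0<..<H - z}. \<rho> (H - x) = level (H - z)"
      by blast+
    from eventually_cocountable_reflect[OF this(3), of H]
    have "\<forall>\<^sub>F x in cocountable {z<..<H}. \<rho> x = level (H - z)"
      by simp
    with eq left_half show ?thesis
      unfolding constant_on_nodal_intervals_def by blast
  qed
  show "\<mu>2 = 2 powr p * \<mu>1 \<and> constant_on_nodal_intervals"
    if "upcrossing 0 z \<rho> (\<lambda>_. level z)" "upcrossing 0 (H - z) (\<lambda>x. \<rho> (H - x)) (\<lambda>_. level (H - z))"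
      "\<mu>2 \<le> 2 powr p * \<mu>1"
  proof (rule conclusion)
    show "w = 0"
      using left(1)[OF that(1,3)] right(1)[OF that(2,3)] by linarith
  qed (use left(1)[OF that(1,3)] right(1)[OF that(2,3)] in blast)+
  show "\<mu>2 = 2 powr p * \<mu>1 \<and> constant_on_nodal_intervals"
    if "upcrossing 0 z (\<lambda>_. level z) \<rho>" "upcrossing 0 (H - z) (\<lambda>_. level (H - z)) (\<lambda>x. \<rho> (H - x))"
      "2 powr p * \<mu>1 \<le> \<mu>2"
  proof (rule conclusion)
    show "w = 0"
      using left(2)[OF that(1,3)] right(2)[OF that(2,3)] by linarith
  qed (use left(2)[OF that(1,3)] right(2)[OF that(2,3)] in blast)+
qed

lemma level_le_beyond_node:
  assumes mono: "mono_on {0..c} \<rho>" and x: "x \<in> {z<..<c}"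
  shows "level z \<le> \<rho> x"
proof -
  have "\<forall>\<^sub>F t in cocountable {0<..<z}. \<mu>2 * \<rho> t \<le> \<mu>2 * \<rho> x"
    by (rule eventually_cocountableI) (use x \<mu>2_pos in \<open>auto intro: monotone_onD[OF mono]\<close>)
  from interval_eigenvalue_le[OF p second(1) this] show ?thesis
    using \<mu>2_pos by (simp flip: level)
qed

lemma barrier_upcrossings:
  assumes mono: "mono_on {0..H / 2} \<rho>" "antimono_on {H / 2..H} \<rho>" and zH: "z \<le> H / 2"
  shows "upcrossing 0 z \<rho> (\<lambda>_. level z)" "upcrossing 0 (H - z) (\<lambda>x. \<rho> (H - x)) (\<lambda>_. level (H - z))"
proof -
  have "mono_on {0<..<z} \<rho>"
    using mono(1) by (rule monotone_on_subset) (use zH in auto)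
  then show "upcrossing 0 z \<rho> (\<lambda>_. level z)"
    by (rule upcrossing_of_mono_on) (use z in simp)
  have "mono_on {0<..<H / 2} (\<lambda>x. \<rho> (H - x))"
    by (rule monotone_onI) (auto intro: monotone_onD[OF mono(2)])
  then have "upcrossing 0 (H / 2) (\<lambda>x. \<rho> (H - x)) (\<lambda>_. level (H - z))"
    by (rule upcrossing_of_mono_on) (use z in simp)
  moreover have "level (H - z) \<le> level z"
    by (rule level_antimono) (use z zH in auto)
  then have "\<forall>\<^sub>F x in cocountable {H / 2<..<H - z}. level (H - z) \<le> \<rho> (H - x)"
    by (intro eventually_cocountableI) (rule order_trans, assumption, rule level_le_beyond_node[OF mono(1)], auto)
  ultimately show "upcrossing 0 (H - z) (\<lambda>x. \<rho> (H - x)) (\<lambda>_. level (H - z))"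
    by (rule upcrossing_append) (use zH in simp)
qed

lemma barrier_rigidity_node_left:
  assumes mono: "mono_on {0..H / 2} \<rho>" "antimono_on {H / 2..H} \<rho>" and zH: "z \<le> H / 2"
    and ratio: "\<mu>2 \<le> 2 powr p * \<mu>1"
  shows "\<mu>2 = 2 powr p * \<mu>1 \<and> cocountably_constant H \<rho>"
proof -
  from nodal_rigidity_up[OF barrier_upcrossings[OF mono zH] ratio]
  have eq: "\<mu>2 = 2 powr p * \<mu>1" and left: "\<forall>\<^sub>F x in cocountable {0<..<z}. \<rho> x = level z"
    and right: "\<forall>\<^sub>F x in cocountable {z<..<H}. \<rho> x = level (H - z)"
    unfolding constant_on_nodal_intervals_def by blast+
  have "level z = level (H - z)"
  proof (cases "z = H / 2")
    case True
    show ?thesis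
      unfolding True by simp
  next
    case False
    have "\<forall>\<^sub>F x in cocountable {z<..<H / 2}. \<rho> x = level (H - z)"
      by (rule eventually_cocountable_subset[OF right]) (use z in auto)
    moreover have "z < H / 2"
      using zH False by simp
    ultimately obtain x where x: "x \<in> {z<..<H / 2}" "\<rho> x = level (H - z)"
      by (rule eventually_cocountable_obtains)
    have "level z \<le> level (H - z)"
      using level_le_beyond_node[OF mono(1) x(1)] unfolding x(2) .
    then show ?thesis
      using level_antimono[of z "H - z"] z zH by simp
  qed
  with right have "\<forall>\<^sub>F x in cocountable {z<..<H}. \<rho> x = level z"
    by (simp only:)
  with left have "\<forall>\<^sub>F x in cocountable {0<..<H}. \<rho> x = level z"
    by (rule eventually_cocountable_split)
  then have "cocountably_constant H \<rho>"
    unfolding cocountably_constant_def by (rule exI)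
  with eq show ?thesis ..
qed

lemma node_eq_midpoint:
  assumes sym: "\<And>x. x \<in> {0..H} \<Longrightarrow> \<rho> (H - x) = \<rho> x"
  shows "z = H / 2"
proof -
  have "nodal_interval p (\<lambda>x. \<mu>2 * \<rho> (H - x)) 0 (H - z)"
    using nodal_interval_reflect[OF second(2), of H] by simp
  then have "nodal_interval p (\<lambda>x. \<mu>2 * \<rho> x) 0 (H - z)"
    by (rule nodal_interval_cong) (use sym z in \<open>auto intro: eventually_cocountableI\<close>)
  from nodal_interval_unique_right[OF p this second(1)] show ?thesis
    by simp
qed

lemma well_rigidity:
  assumes mono: "antimono_on {0..H / 2} \<rho>" "mono_on {H / 2..H} \<rho>"
    and sym: "\<And>x. x \<in> {0..H} \<Longrightarrow> \<rho> (H - x) = \<rho> x" and ratio: "2 powr p * \<mu>1 \<le> \<mu>2"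
  shows "\<mu>2 = 2 powr p * \<mu>1 \<and> cocountably_constant H \<rho>"
proof -
  have mid: "z = H / 2" "H - H / 2 = H / 2"
    using node_eq_midpoint[OF sym] by simp_all
  have "antimono_on {0<..<H / 2} \<rho>" "antimono_on {0<..<H / 2} (\<lambda>x. \<rho> (H - x))"
    using monotone_onD[OF mono(1)] monotone_onD[OF mono(2)] by (auto intro!: monotone_onI)
  then have "upcrossing 0 z (\<lambda>_. level z) \<rho>" "upcrossing 0 (H - z) (\<lambda>_. level (H - z)) (\<lambda>x. \<rho> (H - x))"
    using z unfolding mid by (simp_all add: upcrossing_of_antimono_on)
  from nodal_rigidity_down[OF this ratio]
  have eq: "\<mu>2 = 2 powr p * \<mu>1" and "\<forall>\<^sub>F x in cocountable {0<..<H / 2}. \<rho> x = level (H / 2)"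
      "\<forall>\<^sub>F x in cocountable {H / 2<..<H}. \<rho> x = level (H / 2)"
    unfolding constant_on_nodal_intervals_def unfolding mid by blast+
  from eventually_cocountable_split[OF this(2,3)] have "cocountably_constant H \<rho>"
    unfolding cocountably_constant_def by (rule exI)
  with eq show ?thesis ..
qed

lemma step_before_node:
  assumes b: "0 < b" "b < H" and M: "1 < M" "M * b powr p < (H - b) powr p"
    and \<rho>: "\<And>x. x \<in> {0<..<b} \<Longrightarrow> \<rho> x = M" "\<And>x. x \<in> {b<..<H} \<Longrightarrow> \<rho> x = 1"
  shows "b < z"
proof (rule ccontr)
  assume "\<not> b < z"
  then have zb: "z \<le> b"
    by simp
  have "\<forall>\<^sub>F x in cocountable {0<..<z}. \<mu>2 * \<rho> x \<le> \<mu>2 * M"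
    using \<rho>(1) zb by (intro eventually_cocountableI) auto
  from interval_eigenvalue_le[OF p second(1) this] have upper: "interval_eigenvalue p z \<le> \<mu>2 * M"
    by simp
  have "\<forall>\<^sub>F x in cocountable {z<..<H}. \<mu>2 \<le> \<mu>2 * \<rho> x"
    by (rule eventually_cocountable_split[of _ z b]; rule eventually_cocountableI)
      (use \<rho> M(1) \<mu>2_pos z in auto)
  from le_interval_eigenvalue[OF p second(2) this] have lower: "\<mu>2 \<le> interval_eigenvalue p (H - z)" .
  have "\<mu>2 * (H - z) powr p \<le> interval_eigenvalue p (H - z) * (H - z) powr p"
    by (rule mult_right_mono[OF lower]) simp
  also have "\<dots> = interval_eigenvalue p z * z powr p"
    by (rule interval_eigenvalue_scale) (use z in auto)
  also have "\<dots> \<le> \<mu>2 * (M * z powr p)"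
    using mult_right_mono[OF upper, of "z powr p"] by (simp add: mult.assoc)
  finally have "(H - z) powr p \<le> M * z powr p"
    using \<mu>2_pos by simp
  also have "\<dots> \<le> M * b powr p"
    using zb z M(1) p by (intro mult_left_mono powr_mono2) auto
  also have "\<dots> < (H - b) powr p"
    by (rule M)
  also have "\<dots> \<le> (H - z) powr p"
    using zb b p by (intro powr_mono2) auto
  finally show False
    by simp
qed

lemma step_ratio:
  assumes b: "0 < b" "b < H" and M: "1 < M" "M * b powr p < (H - b) powr p"
    and \<rho>: "\<And>x. x \<in> {0<..<b} \<Longrightarrow> \<rho> x = M" "\<And>x. x \<in> {b<..<H} \<Longrightarrow> \<rho> x = 1"
    and mono: "antimono_on {0<..<H} \<rho>"
  shows "\<mu>2 < 2 powr p * \<mu>1"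
proof (rule ccontr)
  assume "\<not> \<mu>2 < 2 powr p * \<mu>1"
  then have ratio: "2 powr p * \<mu>1 \<le> \<mu>2"
    by simp
  have bz: "b < z"
    by (rule step_before_node[OF b M \<rho>])
  have "antimono_on {0<..<z} \<rho>" "antimono_on {0<..<H - z} (\<lambda>x. \<rho> (H - x))"
    using monotone_onD[OF mono] \<rho>(2) bz z by (auto intro!: monotone_onI)
  then have "upcrossing 0 z (\<lambda>_. level z) \<rho>" "upcrossing 0 (H - z) (\<lambda>_. level (H - z)) (\<lambda>x. \<rho> (H - x))"
    using z by (simp_all add: upcrossing_of_antimono_on)
  from nodal_rigidity_down[OF this ratio] have const: "\<forall>\<^sub>F x in cocountable {0<..<z}. \<rho> x = level z"
    unfolding constant_on_nodal_intervals_def by blast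
  have "\<forall>\<^sub>F x in cocountable {0<..<b}. level z = M" "\<forall>\<^sub>F x in cocountable {b<..<z}. level z = 1"
    using \<rho> b bz z by (auto intro!: eventually_cocountable_subset[OF const])
  then have "level z = M" "level z = 1"
    using b(1) bz by (auto elim: eventually_cocountable_obtains)
  then show False
    using M(1) by simp
qed

end

lemma (in first_two_eigenvalues) barrier_rigidity:
  assumes mono: "mono_on {0..H / 2} \<rho>" "antimono_on {H / 2..H} \<rho>" and ratio: "\<mu>2 \<le> 2 powr p * \<mu>1"
  shows "\<mu>2 = 2 powr p * \<mu>1 \<and> cocountably_constant H \<rho>"
proof (cases "z \<le> H / 2")
  case True
  then show ?thesis
    by (rule barrier_rigidity_node_left[OF mono _ ratio])
next
  case False
  interpret reflected: first_two_eigenvalues p H "\<lambda>x. \<rho> (H - x)" \<mu>1 \<mu>2 "H - z"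
    by (rule reflect)
  have "mono_on {0..H / 2} (\<lambda>x. \<rho> (H - x))" "antimono_on {H / 2..H} (\<lambda>x. \<rho> (H - x))"
    using monotone_onD[OF mono(1)] monotone_onD[OF mono(2)] by (auto intro!: monotone_onI)
  from reflected.barrier_rigidity_node_left[OF this _ ratio]
  have "\<mu>2 = 2 powr p * \<mu>1" "cocountably_constant H (\<lambda>x. \<rho> (H - x))"
    using False by simp_all
  then show ?thesis
    using cocountably_constant_reflect by fastforce
qed

lemma (in first_two_eigenvalues) constant_ratio:
  assumes "cocountably_constant H \<rho>"
  shows "\<mu>2 = 2 powr p * \<mu>1"
proof -
  obtain c where c: "\<forall>\<^sub>F x in cocountable {0<..<H}. \<rho> x = c"
    using assms by (auto simp: cocountably_constant_def)
  have cong: "\<forall>\<^sub>F x in cocountable {s<..<t}. \<mu> * \<rho> x = \<mu> * c" if "0 \<le> s" "t \<le> H" for s t \<mu>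
    by (rule eventually_cocountable_subset[OF c]) (use that in auto)
  interpret flat: first_two_eigenvalues p H "\<lambda>_. c" \<mu>1 \<mu>2 z
    using p z \<mu>1_pos eventually_elim2[OF pos c, of "\<lambda>_. 0 < c"] nodal_interval_cong[OF first cong]
      nodal_interval_cong[OF second(1) cong] nodal_interval_cong[OF second(2) cong]
    by unfold_locales simp_all
  have "mono_on A (\<lambda>_. c)" "antimono_on A (\<lambda>_. c)" for A :: "real set"
    by (simp_all add: monotone_on_def)
  then show ?thesis
    using flat.barrier_rigidity flat.well_rigidity by (cases "\<mu>2 \<le> 2 powr p * \<mu>1") simp_all
qed

lemma (in first_two_eigenvalues) barrier_ratio:
  assumes mono: "mono_on {0..H / 2} \<rho>" "antimono_on {H / 2..H} \<rho>"
  shows "\<mu>2 / \<mu>1 \<ge> 2 powr p" and "\<mu>2 / \<mu>1 = 2 powr p \<longleftrightarrow> cocountably_constant H \<rho>"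
proof -
  note rigidity = barrier_rigidity[OF mono]
  show "\<mu>2 / \<mu>1 \<ge> 2 powr p"
    using rigidity \<mu>1_pos by (cases "\<mu>2 \<le> 2 powr p * \<mu>1") (auto simp: le_divide_eq)
  have "\<mu>2 / \<mu>1 = 2 powr p \<longleftrightarrow> \<mu>2 = 2 powr p * \<mu>1"
    using \<mu>1_pos by (simp add: divide_eq_eq)
  also have "\<dots> \<longleftrightarrow> cocountably_constant H \<rho>"
    using rigidity constant_ratio by (blast dest: eq_refl)
  finally show "\<mu>2 / \<mu>1 = 2 powr p \<longleftrightarrow> cocountably_constant H \<rho>" .
qed

lemma (in first_two_eigenvalues) well_ratio:
  assumes mono: "antimono_on {0..H / 2} \<rho>" "mono_on {H / 2..H} \<rho>"
    and sym: "\<And>x. x \<in> {0..H} \<Longrightarrow> \<rho> (H - x) = \<rho> x"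
  shows "\<mu>2 / \<mu>1 \<le> 2 powr p" and "\<mu>2 / \<mu>1 = 2 powr p \<longleftrightarrow> cocountably_constant H \<rho>"
proof -
  note rigidity = well_rigidity[OF mono sym]
  show "\<mu>2 / \<mu>1 \<le> 2 powr p"
    using rigidity \<mu>1_pos by (cases "2 powr p * \<mu>1 \<le> \<mu>2") (auto simp: divide_le_eq)
  have "\<mu>2 / \<mu>1 = 2 powr p \<longleftrightarrow> \<mu>2 = 2 powr p * \<mu>1"
    using \<mu>1_pos by (simp add: divide_eq_eq)
  also have "\<dots> \<longleftrightarrow> cocountably_constant H \<rho>"
    using rigidity constant_ratio by (blast dest: eq_refl[OF HOL.sym])
  finally show "\<mu>2 / \<mu>1 = 2 powr p \<longleftrightarrow> cocountably_constant H \<rho>" .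
qed

section \<open>Barriers and wells\<close>

lemma AE_interval_obtains:
  fixes a b u v :: real
  assumes "AE x\<in>{a<..<b} in lebesgue. P x" "a \<le> u" "u < v" "v \<le> b"
  obtains t where "t \<in> {u<..<v}" "P t"
proof -
  have "{u<..<v} \<notin> null_sets lebesgue"
    using \<open>u < v\<close> by (simp add: null_sets_def)
  then have "\<not> (AE x in lebesgue. x \<notin> {u<..<v})"
    by (simp add: AE_iff_null_sets)
  moreover have "AE x in lebesgue. x \<notin> {u<..<v}" if "\<not> (\<exists>t\<in>{u<..<v}. P t)"
    using assms(1) by eventually_elim (use that assms(2,4) in auto)
  ultimately show thesis
    using that by blast
qed

definition monotone_between :: "real \<Rightarrow> real \<Rightarrow> (real \<Rightarrow> real) \<Rightarrow> bool" where
  "monotone_between a b f \<longleftrightarrow> mono_on {a..b} f \<or> antimono_on {a..b} f"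

lemma monotone_between_min_max:
  assumes "monotone_between a b f" "a \<le> s" "s \<le> x" "x \<le> t" "t \<le> b"
  shows "min (f s) (f t) \<le> f x" "f x \<le> max (f s) (f t)"
  using assms unfolding monotone_between_def monotone_on_def by (auto simp: min_le_iff_disj le_max_iff_disj)

lemma monotone_between_isCont:
  assumes "monotone_between a b f"
  shows "\<forall>\<^sub>F x in cocountable {a<..<b}. isCont f x"
proof -
  have mono: "\<forall>\<^sub>F x in cocountable {a<..<b}. isCont g x" if "mono_on {a..b} g" for g :: "real \<Rightarrow> real"
  proof -
    have "mono_on {a<..<b} g"
      using that by (rule monotone_on_subset) auto
    then show ?thesis
      unfolding eventually_cocountable by (intro mono_on_ctble_discont_open) simp_all
  qed
  consider "mono_on {a..b} f" | "mono_on {a..b} (\<lambda>x. - f x)"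
    using assms by (auto simp: monotone_between_def monotone_on_def)
  then show ?thesis
  proof cases
    case 2
    from mono[OF this] show ?thesis
      by eventually_elim (auto dest: continuous_minus)
  qed (rule mono)
qed

lemma monotone_between_squeeze_AE:
  assumes f: "monotone_between a b f" and ae: "AE x\<in>{a<..<b} in lebesgue. P (f x)" and x: "x \<in> {a<..<b}"
  obtains s t where "P s" "P t" "min s t \<le> f x" "f x \<le> max s t"
proof -
  obtain u where u: "u \<in> {a<..<x}" "P (f u)"
    by (rule AE_interval_obtains[OF ae, of a x]) (use x in auto)
  obtain v where v: "v \<in> {x<..<b}" "P (f v)"
    by (rule AE_interval_obtains[OF ae, of x b]) (use x in auto)
  show thesis
    by (rule that[OF u(2) v(2)]; rule monotone_between_min_max[OF f]; use u v in auto)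
qed

lemma AE_subinterval:
  fixes a b c d :: real
  assumes "AE x\<in>{a<..<b} in lebesgue. P x" "a \<le> c" "d \<le> b"
  shows "AE x\<in>{c<..<d} in lebesgue. P x"
  using assms(1) by eventually_elim (use assms(2,3) in auto)

lemma piecewise_monotone_AE_imp_cocountable:
  fixes f :: "real \<Rightarrow> real"
  assumes c: "0 \<le> c" "c \<le> H" and f: "monotone_between 0 c f" "monotone_between c H f"
    and ae: "AE x\<in>{0<..<H} in lebesgue. P (f x)"
    and P: "\<And>s t y. P s \<Longrightarrow> P t \<Longrightarrow> min s t \<le> y \<Longrightarrow> y \<le> max s t \<Longrightarrow> P y"
  shows "\<forall>\<^sub>F x in cocountable {0<..<H}. P (f x)"
proof (rule eventually_cocountable_split[of _ 0 c]; rule eventually_cocountableI)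
  show "P (f x)" if "x \<in> {0<..<c}" for x
    by (rule monotone_between_squeeze_AE[OF f(1) AE_subinterval[OF ae order_refl c(2)] that]) (rule P)
  show "P (f x)" if "x \<in> {c<..<H}" for x
    by (rule monotone_between_squeeze_AE[OF f(2) AE_subinterval[OF ae c(1) order_refl] that]) (rule P)
qed

lemma piecewise_monotone_regular_density:
  assumes c: "0 \<le> c" "c \<le> H" and f: "monotone_between 0 c \<rho>" "monotone_between c H \<rho>"
    and ae: "AE x\<in>{0<..<H} in lebesgue. \<rho> x > 0"
  shows "regular_density H \<rho>"
  unfolding regular_density_def
proof (intro conjI exI ballI)
  fix x assume "x \<in> {0..H}"
  then consider "min (\<rho> 0) (\<rho> c) \<le> \<rho> x" "\<rho> x \<le> max (\<rho> 0) (\<rho> c)" | "min (\<rho> c) (\<rho> H) \<le> \<rho> x" "\<rho> x \<le> max (\<rho> c) (\<rho> H)"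
    using monotone_between_min_max[OF f(1), of 0 x c] monotone_between_min_max[OF f(2), of c x H] c
    by (cases "x \<le> c") auto
  then show "\<bar>\<rho> x\<bar> \<le> \<bar>\<rho> 0\<bar> + \<bar>\<rho> c\<bar> + \<bar>\<rho> H\<bar>"
    by cases (auto simp: min_def max_def split: if_splits)
next
  show "\<forall>\<^sub>F x in cocountable {0<..<H}. isCont \<rho> x"
    by (rule eventually_cocountable_split[OF f[THEN monotone_between_isCont]])
  show "\<forall>\<^sub>F x in cocountable {0<..<H}. 0 < \<rho> x"
    by (rule piecewise_monotone_AE_imp_cocountable[OF c f ae]) auto
qed

lemma piecewise_monotone_ae_constant_iff:
  assumes "0 \<le> c" "c \<le> pi_hat p" "monotone_between 0 c \<rho>" "monotone_between c (pi_hat p) \<rho>"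
  shows "ae_constant p \<rho> \<longleftrightarrow> cocountably_constant (pi_hat p) \<rho>"
proof
  show "cocountably_constant (pi_hat p) \<rho>" if "ae_constant p \<rho>"
    using that piecewise_monotone_AE_imp_cocountable[OF assms, of "\<lambda>y. y = k" for k]
    unfolding ae_constant_def cocountably_constant_def by fastforce
  show "ae_constant p \<rho>" if "cocountably_constant (pi_hat p) \<rho>"
    using that AE_of_eventually_cocountable unfolding ae_constant_def cocountably_constant_def by blast
qed

lemma single_well_monotone:
  assumes "single_well p a \<rho>"
  shows "a \<in> {0..pi_hat p}" "antimono_on {0..a} \<rho>" "mono_on {a..pi_hat p} \<rho>"
  using assms by (simp_all add: single_well_def)

lemma single_barrier_monotone:
  assumes "single_barrier p a \<rho>"
  shows "a \<in> {0..pi_hat p}" "mono_on {0..a} \<rho>" "antimono_on {a..pi_hat p} \<rho>"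
  using assms by (auto simp: single_barrier_def single_well_def monotone_on_def)

lemma piecewise_monotone_first_two_eigenvalues:
  assumes "p > 1" "is_density p \<rho>" "c \<in> {0..pi_hat p}" "monotone_between 0 c \<rho>" "monotone_between c (pi_hat p) \<rho>"
  obtains z where "first_two_eigenvalues p (pi_hat p) \<rho> (eigenvalue p \<rho> 1) (eigenvalue p \<rho> 2) z"
proof -
  have "regular_density (pi_hat p) \<rho>"
    by (rule piecewise_monotone_regular_density[of c]) (use assms in \<open>auto simp: is_density_def\<close>)
  with that show thesis
    using first_two_eigenvalues_eigenvalue[OF \<open>p > 1\<close>] by blast
qed

lemma barrier_eigenvalue_ratio:
  assumes "p > 1" "is_density p \<rho>" "single_barrier p (pi_hat p / 2) \<rho>"
  shows "eigenvalue p \<rho> 2 / eigenvalue p \<rho> 1 \<ge> 2 powr p"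
    and "eigenvalue p \<rho> 2 / eigenvalue p \<rho> 1 = 2 powr p \<longleftrightarrow> ae_constant p \<rho>"
proof -
  note mono = single_barrier_monotone[OF assms(3)]
  then have pieces: "monotone_between 0 (pi_hat p / 2) \<rho>" "monotone_between (pi_hat p / 2) (pi_hat p) \<rho>"
    by (simp_all add: monotone_between_def)
  obtain z where "first_two_eigenvalues p (pi_hat p) \<rho> (eigenvalue p \<rho> 1) (eigenvalue p \<rho> 2) z"
    using piecewise_monotone_first_two_eigenvalues[OF assms(1,2) mono(1) pieces] .
  then interpret first_two_eigenvalues p "pi_hat p" \<rho> "eigenvalue p \<rho> 1" "eigenvalue p \<rho> 2" z .
  have "ae_constant p \<rho> \<longleftrightarrow> cocountably_constant (pi_hat p) \<rho>"
    by (rule piecewise_monotone_ae_constant_iff[OF _ _ pieces]) (use mono(1) in auto)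
  then show "eigenvalue p \<rho> 2 / eigenvalue p \<rho> 1 \<ge> 2 powr p"
    "eigenvalue p \<rho> 2 / eigenvalue p \<rho> 1 = 2 powr p \<longleftrightarrow> ae_constant p \<rho>"
    using barrier_ratio[OF mono(2,3)] by (simp_all only:)
qed

lemma well_eigenvalue_ratio:
  assumes "p > 1" "is_density p \<rho>" "symmetric p \<rho>" "single_well p (pi_hat p / 2) \<rho>"
  shows "eigenvalue p \<rho> 2 / eigenvalue p \<rho> 1 \<le> 2 powr p"
    and "eigenvalue p \<rho> 2 / eigenvalue p \<rho> 1 = 2 powr p \<longleftrightarrow> ae_constant p \<rho>"
proof -
  note mono = single_well_monotone[OF assms(4)]
  then have pieces: "monotone_between 0 (pi_hat p / 2) \<rho>" "monotone_between (pi_hat p / 2) (pi_hat p) \<rho>"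
    by (simp_all add: monotone_between_def)
  obtain z where "first_two_eigenvalues p (pi_hat p) \<rho> (eigenvalue p \<rho> 1) (eigenvalue p \<rho> 2) z"
    using piecewise_monotone_first_two_eigenvalues[OF assms(1,2) mono(1) pieces] .
  then interpret first_two_eigenvalues p "pi_hat p" \<rho> "eigenvalue p \<rho> 1" "eigenvalue p \<rho> 2" z .
  have sym: "\<rho> (pi_hat p - x) = \<rho> x" if "x \<in> {0..pi_hat p}" for x
    using assms(3)[unfolded symmetric_def, rule_format, OF that] by (rule HOL.sym)
  have "ae_constant p \<rho> \<longleftrightarrow> cocountably_constant (pi_hat p) \<rho>"
    by (rule piecewise_monotone_ae_constant_iff[OF _ _ pieces]) (use mono(1) in auto)
  then show "eigenvalue p \<rho> 2 / eigenvalue p \<rho> 1 \<le> 2 powr p"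
    "eigenvalue p \<rho> 2 / eigenvalue p \<rho> 1 = 2 powr p \<longleftrightarrow> ae_constant p \<rho>"
    using well_ratio[OF mono(2,3) sym] by (simp_all only:)
qed

lemma regular_density_imp_is_density:
  assumes "regular_density (pi_hat p) \<rho>"
  shows "is_density p \<rho>"
proof -
  obtain B where B: "\<And>x. x \<in> {0..pi_hat p} \<Longrightarrow> \<bar>\<rho> x\<bar> \<le> B"
    using regular_densityE[OF assms] by blast
  have "\<rho> absolutely_integrable_on {0..pi_hat p}"
    by (rule absolutely_integrable_of_isCont[OF B regular_densityD(1)[OF assms]])
  then have "\<rho> absolutely_integrable_on {0<..<pi_hat p}"
    using absolutely_integrable_on_open_interval[where f = \<rho> and a = 0 and b = "pi_hat p"] by simp
  then show ?thesis
    using AE_of_eventually_cocountable[OF regular_densityD(2)[OF assms]] by (simp add: is_density_def)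
qed

lemma step_height:
  fixes p b H :: real
  assumes "p > 1" "0 < b" "b < H / 2"
  obtains M where "1 < M" "M * b powr p < (H - b) powr p"
proof -
  have "b powr p < (H - b) powr p"
    using assms by (intro powr_less_mono2) auto
  then have "1 < (H - b) powr p / b powr p"
    using assms(2) by (simp add: less_divide_eq)
  then obtain M where "1 < M" "M < (H - b) powr p / b powr p"
    using dense by blast
  then show thesis
    using that assms(2) by (simp add: less_divide_eq)
qed

lemma off_center_barrier:
  assumes "p > 1" and a: "a \<in> {0..pi_hat p}" "a \<noteq> pi_hat p / 2"
  obtains \<rho> where "is_density p \<rho>" "single_barrier p a \<rho>" "eigenvalue p \<rho> 2 / eigenvalue p \<rho> 1 < 2 powr p"
proof -
  let ?H = "pi_hat p"
  define b where "b = (min a (?H - a) + ?H / 2) / 2"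
  have b: "0 < b" "b < ?H" "b < ?H / 2" "a < b \<or> ?H - b < a"
    using a pi_hat_pos[OF \<open>p > 1\<close>] by (auto simp: b_def min_def field_simps)
  obtain M where M: "1 < M" "M * b powr p < (?H - b) powr p"
    using step_height[OF \<open>p > 1\<close> b(1,3)] .
  define step where "step x = (if x < b then M else 1)" for x :: real
  define \<rho> where "\<rho> x = (if a < b then step x else step (?H - x))" for x
  have "monotone_between 0 ?H \<rho>" "monotone_between ?H ?H \<rho>" "0 < \<rho> x" for x
    using M(1) by (auto simp: \<rho>_def step_def monotone_between_def monotone_on_def)
  then have regular: "regular_density ?H \<rho>"
    by (intro piecewise_monotone_regular_density[of ?H]) (use b in auto)
  have barrier: "single_barrier p a \<rho>"
    using a b M(1) by (auto simp: \<rho>_def step_def single_barrier_def single_well_def monotone_on_def)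
  obtain z where "first_two_eigenvalues p ?H \<rho> (eigenvalue p \<rho> 1) (eigenvalue p \<rho> 2) z"
    using first_two_eigenvalues_eigenvalue[OF \<open>p > 1\<close> regular] .
  then interpret first_two_eigenvalues p ?H \<rho> "eigenvalue p \<rho> 1" "eigenvalue p \<rho> 2" z .
  interpret reflected: first_two_eigenvalues p ?H "\<lambda>x. \<rho> (?H - x)" "eigenvalue p \<rho> 1" "eigenvalue p \<rho> 2" "?H - z"
    by (rule reflect)
  have "eigenvalue p \<rho> 2 < 2 powr p * eigenvalue p \<rho> 1"
  proof (cases "a < b")
    case True
    show ?thesis
      by (rule step_ratio[OF b(1,2) M]) (use True M(1) in \<open>auto simp: \<rho>_def step_def monotone_on_def\<close>)
  next
    case False
    show ?thesis
      by (rule reflected.step_ratio[OF b(1,2) M]) (use False M(1) in \<open>auto simp: \<rho>_def step_def monotone_on_def\<close>)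
  qed
  then show thesis
    using that[OF regular_density_imp_is_density[OF regular] barrier] \<mu>1_pos by (simp add: divide_less_eq)
qed

theorem theorem1p2:
  fixes p :: real
  assumes "p > 1"
  shows
    "(\<forall>\<rho>. is_density p \<rho> \<and> single_barrier p (pi_hat p / 2) \<rho> \<longrightarrow>
        eigenvalue p \<rho> 2 / eigenvalue p \<rho> 1 \<ge> 2 powr p \<and>
        (eigenvalue p \<rho> 2 / eigenvalue p \<rho> 1 = 2 powr p \<longleftrightarrow> ae_constant p \<rho>)) \<and>
     (\<forall>a\<in>{0..pi_hat p}. a \<noteq> pi_hat p / 2 \<longrightarrow>
        (\<exists>\<rho>. is_density p \<rho> \<and> single_barrier p a \<rho> \<and>
             eigenvalue p \<rho> 2 / eigenvalue p \<rho> 1 < 2 powr p)) \<and>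
     (\<forall>\<rho>. is_density p \<rho> \<and> symmetric p \<rho> \<and> single_well p (pi_hat p / 2) \<rho> \<longrightarrow>
        eigenvalue p \<rho> 2 / eigenvalue p \<rho> 1 \<le> 2 powr p \<and>
        (eigenvalue p \<rho> 2 / eigenvalue p \<rho> 1 = 2 powr p \<longleftrightarrow> ae_constant p \<rho>))"
proof (intro conjI allI ballI impI; (elim conjE)?)
  fix \<rho> assume \<rho>: "is_density p \<rho>" "single_barrier p (pi_hat p / 2) \<rho>"
  show "eigenvalue p \<rho> 2 / eigenvalue p \<rho> 1 \<ge> 2 powr p"
    "eigenvalue p \<rho> 2 / eigenvalue p \<rho> 1 = 2 powr p \<longleftrightarrow> ae_constant p \<rho>"
    by (rule barrier_eigenvalue_ratio[OF assms \<rho>])+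
next
  fix a assume "a \<in> {0..pi_hat p}" "a \<noteq> pi_hat p / 2"
  then show "\<exists>\<rho>. is_density p \<rho> \<and> single_barrier p a \<rho> \<and> eigenvalue p \<rho> 2 / eigenvalue p \<rho> 1 < 2 powr p"
    using off_center_barrier[OF assms] by metis
next
  fix \<rho> assume \<rho>: "is_density p \<rho>" "symmetric p \<rho>" "single_well p (pi_hat p / 2) \<rho>"
  show "eigenvalue p \<rho> 2 / eigenvalue p \<rho> 1 \<le> 2 powr p"
    "eigenvalue p \<rho> 2 / eigenvalue p \<rho> 1 = 2 powr p \<longleftrightarrow> ae_constant p \<rho>"
    by (rule well_eigenvalue_ratio[OF assms \<rho>])+
qed

end
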